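(* Fix $k\in\mathbb{N}$ and consider the Erdős–Rényi hypergraph $\mathcal{H}(n,\bm{r},\bm{p})$ with hyperedge sizes $r_i=r_i(n)$ and connection probabilities $p_i=p_i(n)$, $1\le i\le k$. Assume that $\sigma^2>0$ and that the limits $$w_i:=\lim_{n\to\infty}\frac{\binom{n-2}{r_i-2}\sigma_i^2}{\sum_{j=1}^k\binom{n-2}{r_j-2}\sigma_j^2},\qquad 1\le i\le k,$$ exist. For each $1\le i\le k$, assume that $r_i/n\to c_i\in[0,1)$ and $1-p_i=\Theta(1)$ as $n\to\infty$. Suppose moreover that $$\frac{\left(\sum_{i=1}^k r_i d_i\right)^2}{r_{\max}^{16}\,\xi^2\,\sum_{i=1}^k \frac{d_i}{r_i}}\longrightarrow\infty\qquad (n\to\infty),$$ where $d_i:=\binom{n-1}{r_i-1}p_i$, $r_{\max}:=\max\{r_i: 1\le i\le k\}$ and $\xi:=\sum_{i=1}^k w_i\frac{1}{r_i^2}$. Then $$\bar{\mu}_{H_n(\bm{X})}\longrightarrow\nu_{s^2}\quad\text{weakly as } n\to\infty,$$ where $\nu_{s^2}$ is the semicircle law with variance $$s^2=\sum_{i=1}^k w_i(1-c_i)^2 .$$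
   Context: Model. $k\in\mathbb{N}$ is fixed, independent of $n$. For each $n$, $\bm{r}=(r_1,\dots,r_k)$ are integers with $2\le r_i\le n$ and $\bm{p}=(p_1,\dots,p_k)\in[0,1]^k$; both may depend on $n$. Let $V=\{1,\dots,n\}$, $M_0=0$, $M_i=\sum_{j=1}^i\binom{n}{r_j}$, $M=M_k$. Let $e_1,\dots,e_M$ be such that, for each $i$, $e_{M_{i-1}+1},\dots,e_{M_i}$ enumerate all subsets of $V$ of size $r_i$ (these are the potential $r_i$-edges). The random hypergraph $\mathcal{H}(n,\bm{r},\bm{p})$ includes the potential hyperedges independently, each $r_i$-edge with probability $p_i$: the indicators $h_1,\dots,h_M$ are independent and $h_l\sim\mathrm{Ber}(p_i)$ for $M_{i-1}<l\le M_i$. For each $l$, $Q_l$ is the $n\times n$ matrix with $(Q_l)_{uv}=1$ if $u\ne v$ and $u,v\in e_l$, and $(Q_l)_{uv}=0$ otherwise. The adjacency matrix is $A=\sum_{l=1}^M h_lQ_l$ (for $u\neq v$, $A_{uv}$ counts the present hyperedges containing both $u$ and $v$; diagonal entries are $0$). Set $\sigma_i^2=p_i(1-p_i)$ and $\sigma^2=\sum_{i=1}^k\binom{n-2}{r_i-2}\sigma_i^2$, which is the variance of each off-diagonal entry of $A$. Let $\bm{X}=(X_1,\dots,X_M)$, $X_l=h_l-\mathbb{E}[h_l]$, and $$H_n(\bm{x})=\frac{1}{\sqrt{n\sigma^2}}\sum_{l=1}^M x_lQ_l,\quad \bm{x}\in\mathbb{R}^M,\qquad\text{so that } H_n(\bm{X})=\frac{A-\mathbb{E}[A]}{\sqrt{n\sigma^2}}.$$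 For a random real symmetric $n\times n$ matrix $B$ with eigenvalues $\lambda_1,\dots,\lambda_n$, $\mu_B=\frac1n\sum_{i=1}^n\delta_{\lambda_i}$ is its empirical spectral distribution, and $\bar\mu_B$ is the deterministic probability measure given by $\int f\,d\bar\mu_B=\mathbb{E}\left[\int f\,d\mu_B\right]$ for bounded continuous $f$. The semicircle law $\nu_{s^2}$ with variance $s^2$ has density $\frac{1}{2\pi s^2}\sqrt{4s^2-x^2}\,\mathbf{1}(|x|\le 2s)$ on $\mathbb{R}$. $f(n)=\Theta(g(n))$ means $f=O(g)$ and $g=O(f)$ as $n\to\infty$; thus $1-p_i=\Theta(1)$ means that $1-p_i(n)$ is bounded below by a positive constant for all large $n$. *)

theory Defs
  imports "HOL-Probability.Probability" "Jordan_Normal_Form.Char_Poly"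
begin

text \<open>
  Throughout, \<open>n\<close> is the number of vertices, and \<open>r\<close>, \<open>p\<close> give the \<open>k\<close> hyperedge sizes and
  connection probabilities \<open>r i\<close>, \<open>p i\<close> for \<open>i \<in> {1..k}\<close>. The vertex set is \<open>{0..<n}\<close>, to agree with
  the 0-based indices of matrices.
\<close>

text \<open>
  A potential hyperedge is a pair \<open>(i, e)\<close> with \<open>e\<close> a set of \<open>r i\<close> vertices; the pairs play the role of
  an enumeration \<open>1, \<dots>, M\<close>. The tag \<open>i\<close> is essential: if \<open>r i = r j\<close> with \<open>i \<noteq> j\<close>, then every
  set of this size occurs twice, with independent indicators.
\<close>
definition potential_edges :: "nat \<Rightarrow> nat \<Rightarrow> (nat \<Rightarrow> nat) \<Rightarrow> (nat \<times> nat set) set" where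
  "potential_edges k n r = (SIGMA i:{1..k}. {e. e \<subseteq> {0..<n} \<and> card e = r i})"

text \<open>
  An outcome tells for each potential hyperedge whether it is present; it is constantly \<open>False\<close>
  outside \<open>potential_edges k n r\<close>.
\<close>
definition random_hypergraph ::
    "nat \<Rightarrow> nat \<Rightarrow> (nat \<Rightarrow> nat) \<Rightarrow> (nat \<Rightarrow> real) \<Rightarrow> (nat \<times> nat set \<Rightarrow> bool) pmf" where
  "random_hypergraph k n r p =
     Pi_pmf (potential_edges k n r) False (\<lambda>(i, e). bernoulli_pmf (p i))"

definition edge_matrix :: "nat \<Rightarrow> nat \<times> nat set \<Rightarrow> real mat" where
  "edge_matrix n l =
     Matrix.mat n n (\<lambda>(u, v). if u \<noteq> v \<and> u \<in> snd l \<and> v \<in> snd l then 1 else 0)"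

definition edge_var :: "(nat \<Rightarrow> real) \<Rightarrow> nat \<Rightarrow> real" where
  "edge_var p i = p i * (1 - p i)"

definition total_var :: "nat \<Rightarrow> nat \<Rightarrow> (nat \<Rightarrow> nat) \<Rightarrow> (nat \<Rightarrow> real) \<Rightarrow> real" where
  "total_var k n r p = (\<Sum>i=1..k. real ((n - 2) choose (r i - 2)) * edge_var p i)"

definition H_matrix ::
    "nat \<Rightarrow> nat \<Rightarrow> (nat \<Rightarrow> nat) \<Rightarrow> (nat \<Rightarrow> real) \<Rightarrow> (nat \<times> nat set \<Rightarrow> real) \<Rightarrow> real mat" where
  "H_matrix k n r p x =
     Matrix.mat n n (\<lambda>(u, v). 1 / sqrt (real n * total_var k n r p) *
       (\<Sum>l\<in>potential_edges k n r. x l * edge_matrix n l $$ (u, v)))"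

definition centered_indicators ::
    "nat \<Rightarrow> nat \<Rightarrow> (nat \<Rightarrow> nat) \<Rightarrow> (nat \<Rightarrow> real) \<Rightarrow>
     (nat \<times> nat set \<Rightarrow> bool) \<Rightarrow> nat \<times> nat set \<Rightarrow> real" where
  "centered_indicators k n r p h l =
     of_bool (h l) - measure_pmf.expectation (random_hypergraph k n r p) (\<lambda>h'. of_bool (h' l))"

text \<open>
  The uniform distribution on the eigenvalues, repeated according to their multiplicity. It is meant
  for symmetric matrices of positive dimension, where the multiset of real roots of the characteristic
  polynomial has exactly \<open>dim_row B\<close> elements.
\<close>
definition esd :: "real mat \<Rightarrow> real pmf" where
  "esd B = pmf_of_multiset (proots (char_poly B))"

text \<open>
  The expected empirical spectral distribution of a random matrix \<open>B\<close> on the discrete probability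
  space \<open>P\<close>, as a Borel measure on the real line; \<open>integral_mean_esd\<close> below is its defining
  property.
\<close>
definition mean_esd :: "'a pmf \<Rightarrow> ('a \<Rightarrow> real mat) \<Rightarrow> real measure" where
  "mean_esd P B = distr (measure_pmf (bind_pmf P (\<lambda>\<omega>. esd (B \<omega>)))) borel (\<lambda>x. x)"

lemma real_distribution_mean_esd: "real_distribution (mean_esd P B)"
  unfolding mean_esd_def by (rule prob_space.real_distribution_distr) (auto intro: measure_pmf.prob_space_axioms)

lemma integral_mean_esd:
  fixes f :: "real \<Rightarrow> real"
  assumes "continuous_on UNIV f" and "\<And>x. \<bar>f x\<bar> \<le> C"
  shows "(\<integral>x. f x \<partial>mean_esd P B) =
    measure_pmf.expectation P (\<lambda>\<omega>. measure_pmf.expectation (esd (B \<omega>)) f)"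
proof -
  have [measurable]: "f \<in> borel_measurable borel"
    using assms(1) by (rule borel_measurable_continuous_onI)
  have "(\<integral>x. f x \<partial>mean_esd P B) = measure_pmf.expectation (bind_pmf P (\<lambda>\<omega>. esd (B \<omega>))) f"
    unfolding mean_esd_def by (subst integral_distr) auto
  also have "\<dots> = measure_pmf.expectation P (\<lambda>\<omega>. measure_pmf.expectation (esd (B \<omega>)) f)"
    unfolding measure_pmf_bind
    by (rule integral_bind[where K = "count_space UNIV" and B' = 1 and B = C])
       (use assms(2) in \<open>auto simp: measure_pmf.emeasure_space_1 measure_pmf_in_subprob_algebra\<close>)
  finally show ?thesis .
qed

text \<open>The semicircle law with variance \<open>v > 0\<close>.\<close>
definition semicircle :: "real \<Rightarrow> real measure" where
  "semicircle v = density lborel (\<lambda>x. ennreal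
     (1 / (2 * pi * v) * sqrt (4 * v - x\<^sup>2) * indicator {x. \<bar>x\<bar> \<le> 2 * sqrt v} x))"

definition avg_degree :: "nat \<Rightarrow> (nat \<Rightarrow> nat) \<Rightarrow> (nat \<Rightarrow> real) \<Rightarrow> nat \<Rightarrow> real" where
  "avg_degree n r p i = real ((n - 1) choose (r i - 1)) * p i"

definition r_max :: "nat \<Rightarrow> (nat \<Rightarrow> nat) \<Rightarrow> nat" where
  "r_max k r = Max (r ` {1..k})"

definition xi :: "nat \<Rightarrow> (nat \<Rightarrow> nat) \<Rightarrow> (nat \<Rightarrow> real) \<Rightarrow> real" where
  "xi k r w = (\<Sum>i=1..k. w i * (1 / (real (r i))\<^sup>2))"

end

theory Submission
  imports Defs
begin

text \<open>
  Let \<open>G\<close> be the inverse of \<open>H - z\<close> for a point \<open>z\<close> of the upper half-plane and \<open>S\<close> the expectation of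
  its normalised trace. The theorem holds because \<open>S\<close> satisfies, up to a vanishing error, the
  quadratic equation \<open>z S + 1 + s\<^sup>2 S\<^sup>2 = 0\<close> that characterises the Stieltjes transform of the
  semicircle law.

  From \<open>H G = z G + 1\<close> one gets \<open>z S + 1 = (a / n) \<Sum>\<^sub>l E (X\<^sub>l tr (Q\<^sub>l G))\<close> with \<open>a\<^sup>2 = 1 / (n \<sigma>\<^sup>2)\<close>. Expanding \<open>G\<close>
  exactly, by the resolvent identity, around the resolvent without the hyperedge \<open>l\<close> and using that
  \<open>X\<^sub>l\<close> is centred with variance \<open>\<sigma>\<^sub>l\<^sup>2\<close> turns each summand into \<open>- a \<sigma>\<^sub>l\<^sup>2 E tr (Q\<^sub>l G Q\<^sub>l G)\<close> plus a third
  order term (\<open>ibp_edge\<close>). The third order terms add up to \<open>O (R ^ 4 / sqrt (n \<sigma>\<^sup>2))\<close>, where \<open>R\<close> is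
  the largest size, and the growth hypothesis forces \<open>n \<sigma>\<^sup>2 / R ^ 10\<close> to tend to infinity
  (\<open>growth_comparison\<close>).

  Summed over all vertex sets of one size, \<open>tr (Q G Q G)\<close> becomes a sum over four vertices of
  entries of \<open>G\<close>, weighted by the number of hyperedges through these vertices. If \<open>r\<^sub>i\<close> is of order \<open>n\<close>,
  this number is not negligible for four distinct vertices, which is why entries of \<open>H\<close> at different
  positions are correlated, and terms such as \<open>1\<^sup>T G 1\<close> appear. They vanish when \<open>H\<close> is replaced by
  its compression \<open>P H P\<close> to the orthogonal complement of the constant vector, since the compressed
  resolvent \<open>K\<close> has row sums zero. Then \<open>four_point_sum\<close> leaves \<open>(tr K)\<^sup>2\<close> with the coefficient
  \<open>c\<^sub>2 - 2 c\<^sub>3 + c\<^sub>4\<close>, where \<open>c\<^sub>j\<close> counts the hyperedges through \<open>j\<close> given vertices; relative to \<open>c\<^sub>2\<close> this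
  tends to \<open>1 - 2 c\<^sub>i + c\<^sub>i\<^sup>2 = (1 - c\<^sub>i)\<^sup>2\<close>, the factor in the variance of the limit law. The
  difference \<open>H - P H P\<close> has rank at most two and changes the normalised trace by \<open>O (n powr (- 1 / 2))\<close>
  in expectation (\<open>unprojected_close\<close>). The Efron-Stein inequality shows that the normalised trace
  concentrates, so that the expectation of its square may be replaced by \<open>S\<^sup>2\<close> (\<open>variance_m\<close>).

  The equation has one root in the closed upper half-plane, and this root is stable
  (\<open>self_consistent_stability\<close>); for the semicircle law it is computed in \<open>semicircle_stieltjes\<close>. The
  imaginary parts of the Stieltjes transforms are Poisson integrals, and their pointwise convergence
  gives weak convergence by Scheffe's lemma (\<open>weak_conv_m_of_poisson\<close>).
\<close>

section \<open>Weak convergence from Poisson integrals\<close>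

text \<open>
  The Poisson kernel of the upper half-plane, normalised to integral \<open>1\<close>: \<open>pi * poisson \<eta> (E - x)\<close> is the
  imaginary part of \<open>1 / (x - z)\<close> at \<open>z = Complex E \<eta>\<close>.
\<close>

definition poisson :: "real \<Rightarrow> real \<Rightarrow> real" where
  "poisson \<eta> y = \<eta> / (pi * (y\<^sup>2 + \<eta>\<^sup>2))"

lemma poisson_nonneg: "\<eta> > 0 \<Longrightarrow> 0 \<le> poisson \<eta> y"
  by (simp add: poisson_def)

lemma poisson_le: "\<eta> > 0 \<Longrightarrow> poisson \<eta> y \<le> 1 / (pi * \<eta>)"
proof -
  assume "\<eta> > 0"
  then have "\<eta> / (pi * (y\<^sup>2 + \<eta>\<^sup>2)) \<le> \<eta> / (pi * \<eta>\<^sup>2)"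
    by (intro divide_left_mono mult_left_mono mult_pos_pos) (auto simp: add_nonneg_pos)
  also have "\<dots> = 1 / (pi * \<eta>)"
    using \<open>\<eta> > 0\<close> by (simp add: power2_eq_square)
  finally show ?thesis by (simp add: poisson_def)
qed

lemma poisson_measurable [measurable]: "poisson \<eta> \<in> borel_measurable borel"
  unfolding poisson_def by measurable

lemma Im_complex_of_real_times: "Im (complex_of_real a * w) = a * Im w"
  by simp

lemma Im_inverse_diff:
  assumes "\<eta> > 0"
  shows "Im (1 / (of_real x - Complex E \<eta>)) = pi * poisson \<eta> (E - x)"
proof -
  have "pi * poisson \<eta> (E - x) = \<eta> / ((x - E)\<^sup>2 + \<eta>\<^sup>2)"
    unfolding power2_commute[of x E] by (simp add: poisson_def)
  then show ?thesis by (simp add: Im_divide)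
qed

lemma poisson_1_integrable: "integrable lborel (poisson 1)"
  and poisson_1_integral: "(\<integral>t. poisson 1 t \<partial>lborel) = 1"
proof -
  have lim1: "(((\<lambda>x. arctan x / pi) \<circ> real_of_ereal) \<longlongrightarrow> - 1 / 2) (at_right (-\<infinity>))"
    unfolding ereal_tendsto_simps
    by (rule tendsto_eq_intros refl tendsto_arctan_at_bot)+ auto
  have lim2: "(((\<lambda>x. arctan x / pi) \<circ> real_of_ereal) \<longlongrightarrow> 1 / 2) (at_left \<infinity>)"
    unfolding ereal_tendsto_simps
    by (rule tendsto_eq_intros refl tendsto_arctan_at_top)+ auto
  have der: "DERIV (\<lambda>x. arctan x / pi) x :> poisson 1 x" for x
    unfolding poisson_def using pi_gt_zero
    by (auto intro!: derivative_eq_intros simp: add.commute divide_inverse mult.commute)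
  have cont: "isCont (poisson 1) x" for x
    unfolding poisson_def
    by (intro continuous_intros) (auto simp: add_nonneg_eq_0_iff)
  have 1: "set_integrable lborel (einterval (-\<infinity>) \<infinity>) (poisson 1)"
    by (rule interval_integral_FTC_nonneg[where F = "\<lambda>x. arctan x / pi", OF _ _ _ _ lim1 lim2])
       (use der cont in \<open>auto simp: poisson_nonneg\<close>)
  have 2: "(LBINT x=-\<infinity>..\<infinity>. poisson 1 x) = 1 / 2 - (- 1 / 2)"
    by (rule interval_integral_FTC_nonneg[where F = "\<lambda>x. arctan x / pi", OF _ _ _ _ lim1 lim2])
       (use der cont in \<open>auto simp: poisson_nonneg\<close>)
  show "integrable lborel (poisson 1)" using 1 by (simp add: set_integrable_def)
  show "(\<integral>t. poisson 1 t \<partial>lborel) = 1"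
    using 2 by (simp add: interval_lebesgue_integral_def set_lebesgue_integral_def)
qed

lemma poisson_scale: "\<eta> > 0 \<Longrightarrow> \<eta> * poisson \<eta> (\<eta> * t) = poisson 1 t"
proof -
  assume "\<eta> > 0"
  then have "(\<eta> * t)\<^sup>2 + \<eta>\<^sup>2 = \<eta>\<^sup>2 * (t\<^sup>2 + 1)" by (simp add: algebra_simps power2_eq_square)
  with \<open>\<eta> > 0\<close> show ?thesis
    by (simp add: poisson_def power2_eq_square)
qed

lemma poisson_smoothing_integrable:
  fixes f :: "real \<Rightarrow> real"
  assumes [measurable]: "f \<in> borel_measurable borel" and "\<And>x. \<bar>f x\<bar> \<le> 1" and "\<eta> > 0"
  shows "integrable lborel (\<lambda>t. f (x + \<eta> * t) * poisson 1 t)"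
    and "integrable lborel (\<lambda>E. f E * poisson \<eta> (E - x))"
    and "(\<integral>E. f E * poisson \<eta> (E - x) \<partial>lborel) = (\<integral>t. f (x + \<eta> * t) * poisson 1 t \<partial>lborel)"
proof -
  show 1: "integrable lborel (\<lambda>t. f (x + \<eta> * t) * poisson 1 t)"
  proof (rule Bochner_Integration.integrable_bound[OF poisson_1_integrable])
    show "AE t in lborel. norm (f (x + \<eta> * t) * poisson 1 t) \<le> norm (poisson 1 t)"
      using assms(2) by (auto simp: abs_mult poisson_nonneg intro!: mult_left_le_one_le)
  qed measurable
  have eq: "f (x + \<eta> * t) * poisson 1 t = \<eta> * (f (x + \<eta> * t) * poisson \<eta> (x + \<eta> * t - x))" for t
    using poisson_scale[OF \<open>\<eta> > 0\<close>, of t] by (simp add: mult_ac)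
  have "integrable lborel (\<lambda>t. f (x + \<eta> * t) * poisson \<eta> (x + \<eta> * t - x))"
    using 1 \<open>\<eta> > 0\<close> unfolding eq by simp
  then show "integrable lborel (\<lambda>E. f E * poisson \<eta> (E - x))"
    using \<open>\<eta> > 0\<close> lborel_integrable_real_affine_iff[of \<eta> "\<lambda>E. f E * poisson \<eta> (E - x)" x] by simp
  show "(\<integral>E. f E * poisson \<eta> (E - x) \<partial>lborel) = (\<integral>t. f (x + \<eta> * t) * poisson 1 t \<partial>lborel)"
    unfolding eq
    using \<open>\<eta> > 0\<close> by (subst lborel_integral_real_affine[of \<eta> _ x]) simp_all
qed

lemma poisson_translate_integral:
  assumes "\<eta> > 0"
  shows "integrable lborel (\<lambda>E. poisson \<eta> (E - x))" "(\<integral>E. poisson \<eta> (E - x) \<partial>lborel) = 1"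
  using poisson_smoothing_integrable[of "\<lambda>_. 1" \<eta> x] assms poisson_1_integral by auto

text \<open>
  The bound does not depend on \<open>x\<close>, so smoothing a test function costs the same for every
  probability law.
\<close>

lemma lipschitz_smoothing_error:
  fixes f :: "real \<Rightarrow> real"
  assumes [measurable]: "f \<in> borel_measurable borel" and bd: "\<And>x. 0 \<le> f x \<and> f x \<le> 1"
    and lip: "\<And>x y. \<bar>f x - f y\<bar> \<le> L * \<bar>x - y\<bar>" and "\<eta> > 0"
  shows "\<bar>(\<integral>E. f E * poisson \<eta> (E - x) \<partial>lborel) - f x\<bar>
           \<le> (\<integral>t. min 1 (L * \<eta> * \<bar>t\<bar>) * poisson 1 t \<partial>lborel)"
proof -
  have L: "0 \<le> L" using lip[of 0 1] by auto
  have abs1: "\<bar>f x\<bar> \<le> 1" for x using bd[of x] by auto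
  note int = poisson_smoothing_integrable[OF assms(1) abs1 \<open>\<eta> > 0\<close>, of x]
  have intx: "integrable lborel (\<lambda>t. f x * poisson 1 t)" using poisson_1_integrable by simp
  have intm: "integrable lborel (\<lambda>t. min 1 (L * \<eta> * \<bar>t\<bar>) * poisson 1 t)"
  proof (rule Bochner_Integration.integrable_bound[OF poisson_1_integrable])
    show "AE t in lborel. norm (min 1 (L * \<eta> * \<bar>t\<bar>) * poisson 1 t) \<le> norm (poisson 1 t)"
      using L \<open>\<eta> > 0\<close> by (auto simp: abs_mult poisson_nonneg intro!: mult_left_le_one_le)
  qed measurable
  have "(\<integral>E. f E * poisson \<eta> (E - x) \<partial>lborel) - f x
      = (\<integral>t. f (x + \<eta> * t) * poisson 1 t - f x * poisson 1 t \<partial>lborel)"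
    using int(1) intx poisson_1_integral by (simp add: int(3))
  also have "\<bar>\<dots>\<bar> \<le> (\<integral>t. min 1 (L * \<eta> * \<bar>t\<bar>) * poisson 1 t \<partial>lborel)"
  proof (rule order_trans[OF integral_abs_bound], rule integral_mono[OF _ intm])
    show "integrable lborel (\<lambda>t. \<bar>f (x + \<eta> * t) * poisson 1 t - f x * poisson 1 t\<bar>)"
      using int(1) intx by (intro integrable_abs Bochner_Integration.integrable_diff)
    fix t
    have "\<bar>f (x + \<eta> * t) - f x\<bar> \<le> 1"
      using bd[of x] bd[of "x + \<eta> * t"] by auto
    moreover have "\<bar>f (x + \<eta> * t) - f x\<bar> \<le> L * \<eta> * \<bar>t\<bar>"
      using lip[of "x + \<eta> * t" x] \<open>\<eta> > 0\<close> by (simp add: abs_mult mult_ac)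
    ultimately have "\<bar>f (x + \<eta> * t) - f x\<bar> \<le> min 1 (L * \<eta> * \<bar>t\<bar>)" by simp
    then show "\<bar>f (x + \<eta> * t) * poisson 1 t - f x * poisson 1 t\<bar> \<le> min 1 (L * \<eta> * \<bar>t\<bar>) * poisson 1 t"
      by (simp add: left_diff_distrib[symmetric] abs_mult poisson_nonneg mult_right_mono)
  qed
  finally show ?thesis .
qed

lemma smoothing_modulus_tendsto_0:
  assumes "0 \<le> L"
  shows "(\<lambda>m. \<integral>t. min 1 (L * (1 / real (Suc m)) * \<bar>t\<bar>) * poisson 1 t \<partial>lborel) \<longlonglongrightarrow> 0"
proof -
  have "(\<lambda>m. \<integral>t. min 1 (L * (1 / real (Suc m)) * \<bar>t\<bar>) * poisson 1 t \<partial>lborel)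
      \<longlonglongrightarrow> (\<integral>t. 0 \<partial>(lborel :: real measure))"
  proof (rule integral_dominated_convergence[where w = "poisson 1"])
    show "AE t in lborel. (\<lambda>m. min 1 (L * (1 / real (Suc m)) * \<bar>t\<bar>) * poisson 1 t) \<longlonglongrightarrow> 0"
    proof (rule AE_I2)
      fix t :: real
      have "(\<lambda>m. min 1 (L * (1 / real (Suc m)) * \<bar>t\<bar>) * poisson 1 t)
          \<longlonglongrightarrow> min 1 (L * 0 * \<bar>t\<bar>) * poisson 1 t"
        by (intro tendsto_intros LIMSEQ_Suc[OF lim_1_over_n])
      then show "(\<lambda>m. min 1 (L * (1 / real (Suc m)) * \<bar>t\<bar>) * poisson 1 t) \<longlonglongrightarrow> 0" by simp
    qed
    show "AE t in lborel. norm (min 1 (L * (1 / real (Suc m)) * \<bar>t\<bar>) * poisson 1 t) \<le> poisson 1 t" for m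
      using assms by (auto simp: abs_mult poisson_nonneg intro!: mult_left_le_one_le)
  qed (use poisson_1_integrable in auto)
  then show ?thesis by simp
qed

lemma (in real_distribution) poisson_smoothing_fubini:
  fixes f :: "real \<Rightarrow> real"
  assumes [measurable]: "f \<in> borel_measurable borel" and bd: "\<And>x. 0 \<le> f x \<and> f x \<le> 1" and "\<eta> > 0"
  shows "(\<integral>x. (\<integral>E. f E * poisson \<eta> (E - x) \<partial>lborel) \<partial>M)
       = (\<integral>E. f E * (\<integral>x. poisson \<eta> (E - x) \<partial>M) \<partial>lborel)"
    and "integrable lborel (\<lambda>E. f E * (\<integral>x. poisson \<eta> (E - x) \<partial>M))"
    and "integrable M (\<lambda>x. \<integral>E. f E * poisson \<eta> (E - x) \<partial>lborel)"
proof -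
  interpret pair_sigma_finite M lborel ..
  have abs1: "\<bar>f x\<bar> \<le> 1" for x using bd[of x] by auto
  note int = poisson_smoothing_integrable[OF assms(1) abs1 \<open>\<eta> > 0\<close>]
  have [measurable]: "(\<lambda>(x, E). f E * poisson \<eta> (E - x)) \<in> borel_measurable (M \<Otimes>\<^sub>M lborel)"
    by measurable
  have le1: "(\<integral>E. f E * poisson \<eta> (E - x) \<partial>lborel) \<le> 1" for x
    unfolding poisson_translate_integral(2)[OF \<open>\<eta> > 0\<close>, of x, symmetric]
    using bd by (intro integral_mono int poisson_translate_integral(1) \<open>\<eta> > 0\<close>)
      (auto simp: poisson_nonneg \<open>\<eta> > 0\<close> intro!: mult_left_le_one_le)
  have ge0: "0 \<le> (\<integral>E. f E * poisson \<eta> (E - x) \<partial>lborel)" for x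
    using bd by (intro integral_nonneg_AE) (auto simp: poisson_nonneg \<open>\<eta> > 0\<close>)
  have [measurable]: "(\<lambda>x. \<integral>E. f E * poisson \<eta> (E - x) \<partial>lborel) \<in> borel_measurable M"
    by measurable
  show intM: "integrable M (\<lambda>x. \<integral>E. f E * poisson \<eta> (E - x) \<partial>lborel)"
    by (rule integrable_const_bound[of _ 1]) (use le1 ge0 in auto)
  have norm_eq: "norm (f E * poisson \<eta> (E - x)) = f E * poisson \<eta> (E - x)" for E x
    using bd by (simp add: poisson_nonneg \<open>\<eta> > 0\<close>)
  have I: "integrable (M \<Otimes>\<^sub>M lborel) (\<lambda>(x, E). f E * poisson \<eta> (E - x))"
    
  proof (rule Fubini_integrable)
    show "integrable M (\<lambda>x. \<integral>E. norm (case (x, E) of (x, E) \<Rightarrow> f E * poisson \<eta> (E - x)) \<partial>lborel)"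
      using intM by (simp only: prod.case norm_eq)
  qed (use int(2) in auto)
  have "(\<integral>E. (\<integral>x. f E * poisson \<eta> (E - x) \<partial>M) \<partial>lborel) = (\<integral>x. (\<integral>E. f E * poisson \<eta> (E - x) \<partial>lborel) \<partial>M)"
    using Fubini_integral[OF I] by simp
  then show "(\<integral>x. (\<integral>E. f E * poisson \<eta> (E - x) \<partial>lborel) \<partial>M)
       = (\<integral>E. f E * (\<integral>x. poisson \<eta> (E - x) \<partial>M) \<partial>lborel)" by simp
  show "integrable lborel (\<lambda>E. f E * (\<integral>x. poisson \<eta> (E - x) \<partial>M))"
    using integrable_snd[OF I] by simp
qed

text \<open>
  As functions of \<open>E\<close> the Poisson integrals are densities of the laws convolved with the
  kernel. Pointwise convergence of probability densities is convergence in \<open>L\<^sup>1\<close> by Scheffe's lemma,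
  hence integrals of smoothed test functions converge. The smoothing error is uniform over the laws
  and tends to zero with \<open>\<eta>\<close>.
\<close>

theorem weak_conv_m_of_poisson:
  assumes M: "\<And>n. real_distribution (M n)" and N: "real_distribution N"
    and conv: "\<And>E \<eta>. \<eta> > 0 \<Longrightarrow>
      (\<lambda>n. \<integral>x. poisson \<eta> (E - x) \<partial>M n) \<longlonglongrightarrow> (\<integral>x. poisson \<eta> (E - x) \<partial>N)"
  shows "weak_conv_m M N"
proof (rule integral_cts_step_conv_imp_weak_conv[OF M N])
  fix a b :: real assume ab: "a < b"
  let ?f = "cts_step a b"
  define L where "L = 1 / (b - a)"
  have L: "0 \<le> L" using ab by (simp add: L_def)
  have [measurable]: "?f \<in> borel_measurable borel"
    by (intro borel_measurable_continuous_onI uniformly_continuous_imp_continuous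
        cts_step_uniformly_continuous ab)
  have bd: "0 \<le> ?f x \<and> ?f x \<le> 1" for x
    using ab by (auto simp: cts_step_def divide_simps)
  have lip: "\<bar>?f x - ?f y\<bar> \<le> L * \<bar>x - y\<bar>" for x y
    using ab unfolding cts_step_def L_def by (auto simp: divide_simps abs_if)
  define sm where "sm \<eta> x = (\<integral>E. ?f E * poisson \<eta> (E - x) \<partial>lborel)" for \<eta> x
  define \<omega> where "\<omega> \<eta> = (\<integral>t. min 1 (L * \<eta> * \<bar>t\<bar>) * poisson 1 t \<partial>lborel)" for \<eta>
  have close: "\<bar>(\<integral>x. sm \<eta> x \<partial>D) - (\<integral>x. ?f x \<partial>D)\<bar> \<le> \<omega> \<eta>" if "\<eta> > 0" "real_distribution D" for \<eta> D
  proof -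
    interpret D: real_distribution D by fact
    have i1: "integrable D (sm \<eta>)"
      unfolding sm_def by (rule D.poisson_smoothing_fubini) (use bd that in auto)
    have i2: "integrable D ?f" by (rule D.integrable_cts_step[OF ab])
    have "\<bar>(\<integral>x. sm \<eta> x \<partial>D) - (\<integral>x. ?f x \<partial>D)\<bar> = \<bar>\<integral>x. sm \<eta> x - ?f x \<partial>D\<bar>"
      using i1 i2 by simp
    also have "\<dots> \<le> (\<integral>x. \<omega> \<eta> \<partial>D)"
      unfolding sm_def \<omega>_def using i1 i2 bd lip that
      by (intro order_trans[OF integral_abs_bound] integral_mono integrable_abs
          Bochner_Integration.integrable_diff lipschitz_smoothing_error) (auto simp: sm_def[abs_def])
    also have "\<dots> = \<omega> \<eta>" using D.prob_space by simp
    finally show ?thesis .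
  qed
  have smconv: "(\<lambda>n. \<integral>x. sm \<eta> x \<partial>M n) \<longlonglongrightarrow> (\<integral>x. sm \<eta> x \<partial>N)" if \<eta>: "\<eta> > 0" for \<eta>
  proof -
    define g where "g D E = (\<integral>x. poisson \<eta> (E - x) \<partial>D)" for D E
    have gint: "integrable lborel (g D)" "(\<integral>E. g D E \<partial>lborel) = 1" "\<And>E. 0 \<le> g D E"
      "(\<integral>x. sm \<eta> x \<partial>D) = (\<integral>E. ?f E * g D E \<partial>lborel)"
      "integrable lborel (\<lambda>E. ?f E * g D E)"
      if "real_distribution D" for D
    proof -
      interpret D: real_distribution D by fact
      note F = D.poisson_smoothing_fubini[of "\<lambda>_. 1" \<eta>]
      show "integrable lborel (g D)" unfolding g_def using F(2) \<eta> by simp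
      show "(\<integral>E. g D E \<partial>lborel) = 1"
        unfolding g_def using F(1) \<eta> poisson_translate_integral(2)[OF \<eta>] D.prob_space by simp
      show "0 \<le> g D E" for E unfolding g_def by (intro integral_nonneg_AE) (auto simp: poisson_nonneg \<eta>)
      show "(\<integral>x. sm \<eta> x \<partial>D) = (\<integral>E. ?f E * g D E \<partial>lborel)"
        unfolding g_def sm_def by (rule D.poisson_smoothing_fubini) (use bd \<eta> in auto)
      show "integrable lborel (\<lambda>E. ?f E * g D E)"
        unfolding g_def sm_def by (rule D.poisson_smoothing_fubini) (use bd \<eta> in auto)
    qed
    have nn: "(\<integral>\<^sup>+ E. norm (g D E) \<partial>lborel) = 1" if "real_distribution D" for D
      using gint[OF that] by (simp add: nn_integral_eq_integral)
    have S: "(\<lambda>n. \<integral>\<^sup>+ E. norm (g (M n) E - g N E) \<partial>lborel) \<longlonglongrightarrow> 0"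
    proof (rule Scheffe_lemma1)
      show "AE E in lborel. (\<lambda>n. g (M n) E) \<longlonglongrightarrow> g N E"
        unfolding g_def using conv[OF \<eta>] by auto
      show "limsup (\<lambda>n. \<integral>\<^sup>+ E. norm (g (M n) E) \<partial>lborel) \<le> (\<integral>\<^sup>+ E. norm (g N E) \<partial>lborel)"
        using nn[OF M] nn[OF N] by (simp add: Limsup_const)
    qed (use gint M N in auto)
    have le: "ennreal \<bar>(\<integral>x. sm \<eta> x \<partial>M n) - (\<integral>x. sm \<eta> x \<partial>N)\<bar>
        \<le> (\<integral>\<^sup>+ E. norm (g (M n) E - g N E) \<partial>lborel)" for n
    proof -
      have i: "integrable lborel (\<lambda>E. g (M n) E - g N E)" using gint(1)[OF M] gint(1)[OF N] by auto
      have "(\<integral>x. sm \<eta> x \<partial>M n) - (\<integral>x. sm \<eta> x \<partial>N) = (\<integral>E. ?f E * g (M n) E - ?f E * g N E \<partial>lborel)"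
        using gint(4,5)[OF M] gint(4,5)[OF N] by simp
      also have "\<bar>\<dots>\<bar> \<le> (\<integral>E. \<bar>g (M n) E - g N E\<bar> \<partial>lborel)"
      proof (rule order_trans[OF integral_abs_bound], rule integral_mono)
        show "integrable lborel (\<lambda>E. \<bar>?f E * g (M n) E - ?f E * g N E\<bar>)"
          using gint(5)[OF M] gint(5)[OF N] by (intro integrable_abs Bochner_Integration.integrable_diff)
        show "integrable lborel (\<lambda>E. \<bar>g (M n) E - g N E\<bar>)" using i by auto
        show "\<bar>?f E * g (M n) E - ?f E * g N E\<bar> \<le> \<bar>g (M n) E - g N E\<bar>" for E
          using bd[of E] by (auto simp: right_diff_distrib[symmetric] abs_mult intro!: mult_left_le_one_le)
      qed
      also have "ennreal \<dots> = (\<integral>\<^sup>+ E. norm (g (M n) E - g N E) \<partial>lborel)"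
        using i by (subst nn_integral_eq_integral) (auto intro!: integrable_abs)
      finally show ?thesis by (simp add: ennreal_leI)
    qed
    have "(\<lambda>n. ennreal \<bar>(\<integral>x. sm \<eta> x \<partial>M n) - (\<integral>x. sm \<eta> x \<partial>N)\<bar>) \<longlonglongrightarrow> 0"
      by (rule tendsto_sandwich[OF _ _ tendsto_const S]) (use le in auto)
    then have "(\<lambda>n. \<bar>(\<integral>x. sm \<eta> x \<partial>M n) - (\<integral>x. sm \<eta> x \<partial>N)\<bar>) \<longlonglongrightarrow> 0"
      by (subst (asm) ennreal_0[symmetric], subst (asm) tendsto_ennreal_iff) auto
    then show ?thesis by (subst LIM_zero_iff[symmetric]) (rule tendsto_rabs_zero_cancel)
  qed
  show "(\<lambda>n. \<integral>x. ?f x \<partial>M n) \<longlonglongrightarrow> (\<integral>x. ?f x \<partial>N)"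
  proof (rule LIMSEQ_I)
    fix e :: real assume e: "0 < e"
    have "\<forall>\<^sub>F m in sequentially. \<omega> (1 / real (Suc m)) < e / 3"
      using order_tendstoD(2)[OF smoothing_modulus_tendsto_0[OF L], of "e/3"] e
      unfolding \<omega>_def by auto
    then obtain m where m: "\<omega> (1 / real (Suc m)) < e / 3" by (auto simp: eventually_sequentially)
    define \<eta> where "\<eta> = 1 / real (Suc m)"
    have \<eta>: "\<eta> > 0" by (simp add: \<eta>_def)
    obtain n0 where n0: "\<And>n. n \<ge> n0 \<Longrightarrow> norm ((\<integral>x. sm \<eta> x \<partial>M n) - (\<integral>x. sm \<eta> x \<partial>N)) < e / 3"
      using LIMSEQ_D[OF smconv[OF \<eta>], of "e/3"] e by auto
    show "\<exists>no. \<forall>n\<ge>no. norm ((\<integral>x. ?f x \<partial>M n) - (\<integral>x. ?f x \<partial>N)) < e"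
    proof (intro exI[of _ n0] allI impI)
      fix n assume "n \<ge> n0"
      from n0[OF this] close[OF \<eta> M[of n]] close[OF \<eta> N] m
      show "norm ((\<integral>x. ?f x \<partial>M n) - (\<integral>x. ?f x \<partial>N)) < e"
        unfolding \<eta>_def[symmetric] real_norm_def by linarith
    qed
  qed
qed

section \<open>The Stieltjes transform of the semicircle law\<close>

definition sc_density :: "real \<Rightarrow> real \<Rightarrow> real" where
  "sc_density v x = 1 / (2 * pi * v) * sqrt (4 * v - x\<^sup>2) * indicator {x. \<bar>x\<bar> \<le> 2 * sqrt v} x"

lemma semicircle_eq_density: "semicircle v = density lborel (\<lambda>x. ennreal (sc_density v x))"
  by (simp add: semicircle_def sc_density_def)

lemma sc_density_nonneg: "v > 0 \<Longrightarrow> 0 \<le> sc_density v x"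
proof (cases "\<bar>x\<bar> \<le> 2 * sqrt v")
  assume v: "v > 0" and x: "\<bar>x\<bar> \<le> 2 * sqrt v"
  have "x\<^sup>2 \<le> (2 * sqrt v)\<^sup>2"
    using x by (subst abs_le_square_iff[symmetric]) (use v in auto)
  then show ?thesis using v by (simp add: sc_density_def power_mult_distrib)
qed (simp add: sc_density_def)

lemma sc_density_measurable [measurable]: "sc_density v \<in> borel_measurable borel"
  unfolding sc_density_def by measurable

text \<open>
  The substitution is \<open>x = - 2 sqrt v cos t\<close>, with the sign that makes it increasing on \<open>[0, pi]\<close>.
\<close>

lemma sc_substitution:
  fixes f :: "real \<Rightarrow> real"
  assumes v: "v > 0" and cont: "continuous_on UNIV f"
  shows "integrable lborel (\<lambda>x. sc_density v x * f x)"
    and "(\<integral>x. sc_density v x * f x \<partial>lborel)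
       = (\<integral>t. 2 / pi * (sin t)\<^sup>2 * f (- 2 * sqrt v * cos t) * indicator {0..pi} t \<partial>lborel)"
proof -
  define s where "s = sqrt v"
  have s: "s > 0" "s\<^sup>2 = v" using v by (auto simp: s_def)
  define h where "h x = 1 / (2 * pi * v) * sqrt (4 * v - x\<^sup>2) * f x" for x
  have conth: "continuous_on A h" for A
    unfolding h_def by (intro continuous_intros continuous_on_subset[OF cont]) auto
  have eq: "sc_density v x * f x = h x * indicator {- 2 * s * cos 0..- 2 * s * cos pi} x" for x
    using s by (auto simp: sc_density_def h_def s_def[symmetric] split: split_indicator)
  have int: "set_integrable lborel {- 2 * s * cos 0..- 2 * s * cos pi} h"
    by (rule borel_integrable_atLeastAtMost') (rule conth)
  show "integrable lborel (\<lambda>x. sc_density v x * f x)"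
    using int unfolding eq set_integrable_def by (simp add: mult.commute)
  have "(\<integral>x. sc_density v x * f x \<partial>lborel)
      = (\<integral>t. h (- 2 * s * cos t) * (2 * s * sin t) * indicator {0..pi} t \<partial>lborel)"
    unfolding eq
    by (rule integral_substitution(2)[where g = "\<lambda>t. - 2 * s * cos t" and a = 0 and b = pi and f = h, OF int])
       (auto intro!: derivative_eq_intros continuous_intros mult_nonneg_nonneg sin_ge_zero simp: less_imp_le[OF s(1)])
  also have "\<dots> = (\<integral>t. 2 / pi * (sin t)\<^sup>2 * f (- 2 * sqrt v * cos t) * indicator {0..pi} t \<partial>lborel)"
  proof (intro Bochner_Integration.integral_cong refl)
    fix t
    show "h (- 2 * s * cos t) * (2 * s * sin t) * indicator {0..pi} t
        = 2 / pi * (sin t)\<^sup>2 * f (- 2 * sqrt v * cos t) * indicator {0..pi} t"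
    proof (cases "t \<in> {0..pi}")
      case True
      then have "sin t \<ge> 0" by (auto intro: sin_ge_zero)
      have "4 * v - (- 2 * s * cos t)\<^sup>2 = (2 * s * sin t)\<^sup>2"
        using s(2) by (simp add: power_mult_distrib sin_squared_eq algebra_simps)
      then have "sqrt (4 * v - (- 2 * s * cos t)\<^sup>2) = 2 * s * sin t"
        using s \<open>sin t \<ge> 0\<close> by simp
      then have "h (- 2 * s * cos t) * (2 * s * sin t) = 1 / (2 * pi * v) * (2 * s * sin t) * f (- 2 * s * cos t) * (2 * s * sin t)"
        by (simp add: h_def)
      also have "\<dots> = 2 / pi * (sin t)\<^sup>2 * f (- 2 * s * cos t)"
        unfolding s(2)[symmetric] using s(1) by (simp add: power2_eq_square)
      finally show ?thesis by (simp add: s_def)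
    qed simp
  qed
  finally show "(\<integral>x. sc_density v x * f x \<partial>lborel)
       = (\<integral>t. 2 / pi * (sin t)\<^sup>2 * f (- 2 * sqrt v * cos t) * indicator {0..pi} t \<partial>lborel)" .
qed

lemma integral_sin_sin:
  assumes "m > 0"
  shows "((\<lambda>t. sin t * sin (real m * t)) has_integral (if m = 1 then pi / 2 else 0)) {0..pi}"
proof (cases "m = 1")
  case True
  have "((\<lambda>t. sin t * sin t) has_integral ((pi - sin pi * cos pi) / 2 - (0 - sin 0 * cos 0) / 2)) {0..pi}"
  proof (rule fundamental_theorem_of_calculus)
    fix t :: real
    have "cos t * (cos t * 2) + sin t * (sin t * 2) = 2 * (cos t * cos t + sin t * sin t)"
      by (simp only: algebra_simps)
    then have F: "cos t * (cos t * 2) + sin t * (sin t * 2) = 2" by simp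
    have "((\<lambda>t. (t - sin t * cos t) / 2) has_real_derivative sin t * sin t) (at t within {0..pi})"
      by (auto intro!: derivative_eq_intros simp: field_simps F)
    then show "((\<lambda>t. (t - sin t * cos t) / 2) has_vector_derivative sin t * sin t) (at t within {0..pi})"
      by (simp add: has_real_derivative_iff_has_vector_derivative)
  qed auto
  then show ?thesis using True by simp
next
  case False
  define a where "a = real m - 1"
  define b where "b = real m + 1"
  have a: "a \<noteq> 0" "b \<noteq> 0" using False assms by (auto simp: a_def b_def)
  have ab: "a = of_int (int m - 1)" "b = of_int (int m + 1)" by (auto simp: a_def b_def)
  have sa: "sin (a * pi) = 0" "sin (b * pi) = 0"
    unfolding ab by (simp_all only: mult.commute[of _ pi] sin_npi_int)
  have eq: "sin t * sin (real m * t) = (cos (a * t) - cos (b * t)) / 2" for t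
  proof -
    have "a * t = real m * t - t" "b * t = real m * t + t" by (auto simp: a_def b_def algebra_simps)
    then show ?thesis by (simp add: cos_diff cos_add)
  qed
  have "((\<lambda>t. sin t * sin (real m * t)) has_integral
      ((sin (a * pi) / a - sin (b * pi) / b) / 2 - (sin (a * 0) / a - sin (b * 0) / b) / 2)) {0..pi}"
  proof (rule fundamental_theorem_of_calculus)
    fix t :: real
    have "((\<lambda>t. (sin (a * t) / a - sin (b * t) / b) / 2) has_real_derivative sin t * sin (real m * t)) (at t within {0..pi})"
      unfolding eq using a by (auto intro!: derivative_eq_intros simp: field_simps)
    then show "((\<lambda>t. (sin (a * t) / a - sin (b * t) / b) / 2) has_vector_derivative sin t * sin (real m * t)) (at t within {0..pi})"
      by (simp add: has_real_derivative_iff_has_vector_derivative)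
  qed auto
  then show ?thesis using False by (simp add: sa)
qed

text \<open>
  A truncation of the expansion of \<open>sin t / (1 - 2 q cos t + q\<^sup>2)\<close> into \<open>\<Sum>k. q ^ k sin ((k + 1) t)\<close>. With the
  remainder explicit, no series has to be integrated termwise.
\<close>

lemma geometric_sine_sum:
  fixes q :: complex
  shows "(1 - 2 * q * of_real (cos t) + q\<^sup>2) * (\<Sum>k<K. q ^ k * of_real (sin (real (Suc k) * t)))
       = of_real (sin t) - q ^ K * of_real (sin (real (Suc K) * t)) + q ^ Suc K * of_real (sin (real K * t))"
proof (induction K)
  case (Suc K)
  have "sin (real (Suc (Suc K)) * t) = 2 * cos t * sin (real (Suc K) * t) - sin (real K * t)"
  proof -
    have "real (Suc (Suc K)) * t = real (Suc K) * t + t" "real K * t = real (Suc K) * t - t"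
      by (auto simp: algebra_simps)
    then show ?thesis by (simp only: sin_add sin_diff) simp
  qed
  then have "complex_of_real (sin (real (Suc (Suc K)) * t))
     = 2 * of_real (cos t) * of_real (sin (real (Suc K) * t)) - of_real (sin (real K * t))"
    by (simp only: of_real_diff of_real_mult of_real_numeral)
  then show ?case
    using Suc.IH by (simp only: sum.lessThan_Suc distrib_left power_Suc) (simp add: algebra_simps power2_eq_square)
qed simp

text \<open>
  The two roots \<open>q\<close> of \<open>z = s (q + 1 / q)\<close> have product \<open>1\<close>. If both had modulus \<open>1\<close>, they would be
  complex conjugates and \<open>z\<close> would be real.
\<close>

lemma joukowski:
  fixes z :: complex and s :: real
  assumes s: "s > 0" and z: "Im z > 0"
  obtains q where "q \<noteq> 0" "norm q < 1" "z = of_real s * (q + 1 / q)"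
proof -
  define w where "w = z / of_real s"
  have w: "Im w > 0" using assms by (simp add: w_def)
  define d where "d = csqrt (w\<^sup>2 - 4)"
  have d2: "d\<^sup>2 = w\<^sup>2 - 4" by (simp add: d_def)
  define q1 where "q1 = (w - d) / 2"
  define q2 where "q2 = (w + d) / 2"
  have p: "q1 * q2 = 1"
  proof -
    have "q1 * q2 = (w\<^sup>2 - d\<^sup>2) / 4" by (simp add: q1_def q2_def power2_eq_square algebra_simps)
    then show ?thesis by (simp add: d2)
  qed
  have sm: "q1 + q2 = w" by (simp add: q1_def q2_def add_divide_distrib[symmetric])
  have nz: "q1 \<noteq> 0" "q2 \<noteq> 0" using p by auto
  have inv: "q2 = 1 / q1" "q1 = 1 / q2" using p nz by (auto simp: field_simps)
  have n1: "norm q1 \<noteq> 1"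
  proof
    assume "norm q1 = 1"
    then have "cnj q1 * q1 = 1" using complex_norm_square[of q1] by (simp add: mult.commute)
    then have "cnj q1 * q1 = q2 * q1" using p by (simp only: mult.commute)
    then have "cnj q1 = q2" using nz by simp
    then have "Im q2 = - Im q1" by (metis cnj.simps(2))
    then have "Im w = 0" unfolding sm[symmetric] by simp
    then show False using w by simp
  qed
  have np: "norm q1 * norm q2 = 1" using p by (metis norm_mult norm_one)
  have zq: "z = of_real s * w" using s by (simp add: w_def)
  show ?thesis
  proof (cases "norm q1 < 1")
    case True
    then show ?thesis using that[OF nz(1) _ zq[folded sm, unfolded inv(1)]] by simp
  next
    case False
    then have "norm q1 > 1" using n1 by simp
    moreover have "norm q2 = 1 / norm q1" using np nz by (simp add: field_simps)
    ultimately have "norm q2 < 1" by (simp add: divide_less_eq_1)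
    then show ?thesis using that[OF nz(2)] zq[folded sm, unfolded inv(2)] by (simp add: add.commute)
  qed
qed

text \<open>
  By orthogonality of the sines only the term \<open>k = 0\<close> of the truncated expansion contributes, and the
  remainder is \<open>O (|q| ^ K)\<close> for every \<open>K\<close>.
\<close>

lemma semicircle_integral_complex:
  fixes q :: complex and \<delta> :: real
  assumes q: "norm q < 1" and \<delta>: "\<delta> > 0"
    and D: "\<And>t. norm (1 - 2 * q * of_real (cos t) + q\<^sup>2) \<ge> \<delta>"
  shows "((\<lambda>t. of_real ((sin t)\<^sup>2) / (1 - 2 * q * of_real (cos t) + q\<^sup>2)) has_integral of_real (pi / 2)) {0..pi}"
proof -
  define d where "d t = 1 - 2 * q * of_real (cos t) + q\<^sup>2" for t :: real
  have d0: "d t \<noteq> 0" for t using D[of t] \<delta> by (auto simp: d_def)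
  define g where "g t = of_real ((sin t)\<^sup>2) / d t" for t
  have contd: "continuous_on A d" for A unfolding d_def by (intro continuous_intros)
  have contg: "continuous_on {0..pi} g"
    unfolding g_def by (intro continuous_intros contd) (use d0 in auto)
  have intg: "g integrable_on {0..pi}" by (rule integrable_continuous_real[OF contg])
  define P where "P K t = of_real (sin t) * (\<Sum>k<K. q ^ k * of_real (sin (real (Suc k) * t)))" for K t
  have P: "(P (Suc K) has_integral of_real (pi / 2)) {0..pi}" for K
  proof -
    have "((\<lambda>t. \<Sum>k<Suc K. q ^ k * of_real (sin t * sin (real (Suc k) * t)))
        has_integral (\<Sum>k<Suc K. q ^ k * of_real (if Suc k = 1 then pi / 2 else 0))) {0..pi}"
    proof (rule has_integral_sum)
      fix k
      have bl: "bounded_linear (\<lambda>x. q ^ k * complex_of_real x)"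
        by (rule bounded_linear_const_mult[OF bounded_linear_of_real])
      show "((\<lambda>t. q ^ k * of_real (sin t * sin (real (Suc k) * t)))
          has_integral q ^ k * of_real (if Suc k = 1 then pi / 2 else 0)) {0..pi}"
        using has_integral_linear[OF integral_sin_sin[of "Suc k"] bl] by (simp add: o_def)
    qed simp
    also have "(\<Sum>k<Suc K. q ^ k * of_real (if Suc k = 1 then pi / 2 else 0))
        = (\<Sum>k<Suc K. if k = 0 then of_real (pi / 2) else 0)"
      by (intro sum.cong) auto
    also have "\<dots> = complex_of_real (pi / 2)" by (simp add: sum.delta)
    also have "(\<lambda>t. \<Sum>k<Suc K. q ^ k * of_real (sin t * sin (real (Suc k) * t))) = P (Suc K)"
      unfolding P_def sum_distrib_left by (intro ext sum.cong) auto
    finally show ?thesis .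
  qed
  have err: "norm (g t - P K t) \<le> 2 * norm q ^ K / \<delta>" for K t
  proof -
    have "g t - P K t = of_real (sin t) * (q ^ K * of_real (sin (real (Suc K) * t)) - q ^ Suc K * of_real (sin (real K * t))) / d t"
    proof -
      have "d t * (\<Sum>k<K. q ^ k * of_real (sin (real (Suc k) * t)))
          = of_real (sin t) - q ^ K * of_real (sin (real (Suc K) * t)) + q ^ Suc K * of_real (sin (real K * t))"
        unfolding d_def by (rule geometric_sine_sum)
      then have S: "(\<Sum>k<K. q ^ k * of_real (sin (real (Suc k) * t)))
          = (of_real (sin t) - q ^ K * of_real (sin (real (Suc K) * t)) + q ^ Suc K * of_real (sin (real K * t))) / d t"
        using d0[of t] by (simp add: eq_divide_eq mult.commute)
      show ?thesis
        unfolding g_def P_def S using d0[of t] by (simp add: diff_divide_distrib[symmetric] power2_eq_square algebra_simps)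
    qed
    also have "norm \<dots> \<le> 2 * norm q ^ K / \<delta>"
    proof -
      have n1: "norm (q ^ K * of_real (sin (real (Suc K) * t))) \<le> norm q ^ K"
        unfolding norm_mult norm_power norm_of_real by (intro mult_left_le) auto
      have "norm (q ^ Suc K * of_real (sin (real K * t))) \<le> norm q ^ Suc K"
        unfolding norm_mult norm_power norm_of_real by (intro mult_left_le) auto
      also have "\<dots> \<le> norm q ^ K"
        using q by (intro power_decreasing) auto
      finally have "norm (q ^ K * of_real (sin (real (Suc K) * t)) - q ^ Suc K * of_real (sin (real K * t))) \<le> 2 * norm q ^ K"
        using n1 by (intro order_trans[OF norm_triangle_ineq4]) auto
      moreover have "norm (complex_of_real (sin t)) \<le> 1" by simp
      ultimately have "norm (of_real (sin t) * (q ^ K * of_real (sin (real (Suc K) * t)) - q ^ Suc K * of_real (sin (real K * t)))) \<le> 1 * (2 * norm q ^ K)"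
        unfolding norm_mult[of "of_real (sin t)"] by (intro mult_mono) auto
      then show ?thesis
        unfolding norm_divide using D[of t] \<delta> by (intro frac_le) (auto simp: d_def)
    qed
    finally show ?thesis .
  qed
  have bound: "norm (integral {0..pi} g - of_real (pi / 2)) \<le> 2 * norm q ^ Suc K / \<delta> * pi" for K
  proof -
    have "((\<lambda>t. g t - P (Suc K) t) has_integral (integral {0..pi} g - of_real (pi / 2))) (cbox 0 pi)"
      using has_integral_diff[OF integrable_integral[OF intg] P] by simp
    from has_integral_bound[OF _ this err[of _ "Suc K"]] show ?thesis
      using \<delta> by simp
  qed
  have "(\<lambda>K. 2 * norm q ^ Suc K / \<delta> * pi) \<longlonglongrightarrow> 2 * 0 / \<delta> * pi"
    using q \<delta> by (intro tendsto_intros LIMSEQ_Suc[OF LIMSEQ_power_zero]) auto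
  then have "norm (integral {0..pi} g - of_real (pi / 2)) \<le> 2 * 0 / \<delta> * pi"
    by (rule LIMSEQ_le_const) (use bound in auto)
  then have I: "integral {0..pi} g = of_real (pi / 2)" by simp
  show ?thesis
    using integrable_integral[OF intg] unfolding I unfolding g_def d_def .
qed

lemma prob_space_semicircle: "v > 0 \<Longrightarrow> prob_space (semicircle v)"
proof (rule prob_spaceI)
  assume v: "v > 0"
  have sub: "(\<integral>x. sc_density v x * 1 \<partial>lborel)
       = (\<integral>t. 2 / pi * (sin t)\<^sup>2 * 1 * indicator {0..pi} t \<partial>lborel)"
    and int: "integrable lborel (\<lambda>x. sc_density v x * 1)"
    by (rule sc_substitution[OF v]; simp)+
  have si: "set_integrable lborel {0..pi} (\<lambda>t. 2 / pi * (sin t)\<^sup>2)"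
    by (rule borel_integrable_atLeastAtMost') (intro continuous_intros)
  have "((\<lambda>t. 2 / pi * (sin t * sin (real 1 * t))) has_integral 2 / pi * (pi / 2)) {0..pi}"
    using has_integral_mult_right[OF integral_sin_sin[of 1], of "2/pi"] by simp
  then have "integral {0..pi} (\<lambda>t. 2 / pi * (sin t)\<^sup>2) = 1"
    by (intro integral_unique) (simp add: power2_eq_square)
  then have "(\<integral>x. sc_density v x \<partial>lborel) = 1"
    using sub set_borel_integral_eq_integral(2)[OF si]
    by (simp add: set_lebesgue_integral_def mult_ac)
  then have "(\<integral>\<^sup>+x. ennreal (sc_density v x) \<partial>lborel) = 1"
    using int v by (subst nn_integral_eq_integral) (auto simp: sc_density_nonneg)
  then show "emeasure (semicircle v) (space (semicircle v)) = 1"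
    by (simp add: semicircle_eq_density emeasure_density)
qed

lemma real_distribution_semicircle:
  assumes "v > 0" shows "real_distribution (semicircle v)"
proof -
  interpret prob_space "semicircle v" by (rule prob_space_semicircle[OF assms])
  show ?thesis by unfold_locales (simp_all add: semicircle_eq_density)
qed

text \<open>
  In the parametrisation \<open>z = - s (q + 1 / q)\<close> with \<open>s = sqrt v\<close> the substituted denominator factors as
  \<open>x - z = (s / q) (1 - 2 q cos t + q\<^sup>2)\<close>. Hence the Stieltjes transform is \<open>m = q / s\<close>, which visibly
  solves the quadratic equation.
\<close>

lemma semicircle_stieltjes:
  assumes v: "v > 0" and \<eta>: "\<eta> > 0"
  obtains m where "of_real v * m\<^sup>2 + Complex E \<eta> * m + 1 = 0" "Im m \<ge> 0"
    "pi * (\<integral>x. poisson \<eta> (E - x) \<partial>semicircle v) = Im m"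
proof -
  define s where "s = sqrt v"
  have s: "s > 0" "s * s = v" using v by (auto simp: s_def)
  define z where "z = Complex E \<eta>"
  have Imz: "Im z = \<eta>" by (simp add: z_def)
  have "Im z > 0" using \<eta> by (simp add: z_def)
  then obtain q' where q': "q' \<noteq> 0" "norm q' < 1" "z = of_real s * (q' + 1 / q')"
    by (rule joukowski[OF s(1)])
  define q where "q = - q'"
  have q: "q \<noteq> 0" "norm q < 1" "z = - of_real s * (q + 1 / q)"
    using q' by (auto simp: q_def algebra_simps)
  define m where "m = q / of_real s"
  have D: "1 - 2 * q * of_real (cos t) + q\<^sup>2 = m * (of_real (- 2 * s * cos t) - z)" for t :: real
    unfolding q(3) m_def using q(1) s(1) by (simp add: field_simps power2_eq_square)
  have m0: "m \<noteq> 0" using q s by (simp add: m_def)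
  have eq: "of_real v * m\<^sup>2 + z * m + 1 = 0"
    unfolding q(3) m_def s(2)[symmetric] using q(1) s(1) by (simp add: field_simps power2_eq_square)
  have Dge: "norm (1 - 2 * q * of_real (cos t) + q\<^sup>2) \<ge> norm m * \<eta>" for t :: real
  proof -
    have "\<eta> \<le> \<bar>Im (of_real (- 2 * s * cos t) - z)\<bar>" using \<eta> by (simp add: z_def)
    also have "\<dots> \<le> norm (of_real (- 2 * s * cos t) - z)" by (rule abs_Im_le_cmod)
    finally show ?thesis unfolding D norm_mult by (intro mult_left_mono) auto
  qed
  have hi: "((\<lambda>t. of_real ((sin t)\<^sup>2) / (1 - 2 * q * of_real (cos t) + q\<^sup>2)) has_integral of_real (pi / 2)) {0..pi}"
    by (rule semicircle_integral_complex[OF q(2) _ Dge]) (use m0 \<eta> in auto)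
  have bl: "bounded_linear (\<lambda>x. Im (m * x))" by (intro bounded_linear_intros bounded_linear_compose[OF bounded_linear_Im])
  have "((\<lambda>t. Im (m * (of_real ((sin t)\<^sup>2) / (1 - 2 * q * of_real (cos t) + q\<^sup>2)))) has_integral Im (m * of_real (pi / 2))) {0..pi}"
    using has_integral_linear[OF hi bl] by (simp only: o_def)
  moreover have "Im (m * (of_real ((sin t)\<^sup>2) / (1 - 2 * q * of_real (cos t) + q\<^sup>2)))
      = pi * ((sin t)\<^sup>2 * poisson \<eta> (E - (- 2 * s * cos t)))" for t
  proof -
    have "m * (of_real ((sin t)\<^sup>2) / (1 - 2 * q * of_real (cos t) + q\<^sup>2))
        = of_real ((sin t)\<^sup>2) * (1 / (of_real (- 2 * s * cos t) - Complex E \<eta>))"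
      unfolding D z_def[symmetric] using m0 by simp
    moreover have "Im (of_real ((sin t)\<^sup>2) * (1 / (of_real (- 2 * s * cos t) - Complex E \<eta>)))
        = (sin t)\<^sup>2 * Im (1 / (of_real (- 2 * s * cos t) - Complex E \<eta>))"
      by (rule Im_complex_of_real_times)
    ultimately show ?thesis
      by (simp only: Im_inverse_diff[OF \<eta>] mult_ac)
  qed
  moreover have "Im (m * of_real (pi / 2)) = Im m * (pi / 2)" by simp
  ultimately have hi2: "((\<lambda>t. pi * ((sin t)\<^sup>2 * poisson \<eta> (E - (- 2 * s * cos t)))) has_integral Im m * (pi / 2)) {0..pi}"
    by (simp only:)
  have "((\<lambda>t. 2 / pi * (sin t)\<^sup>2 * poisson \<eta> (E - (- 2 * s * cos t))) has_integral Im m / pi) {0..pi}"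
    using has_integral_mult_right[OF hi2, of "2 / pi\<^sup>2"] by (simp add: power2_eq_square mult_ac)
  then have I: "integral {0..pi} (\<lambda>t. 2 / pi * (sin t)\<^sup>2 * poisson \<eta> (E - (- 2 * s * cos t))) = Im m / pi"
    by (rule integral_unique)
  have contp: "continuous_on A (\<lambda>x. poisson \<eta> (h x))" if "continuous_on A h" for A and h :: "real \<Rightarrow> real"
    unfolding poisson_def using \<eta> that
    by (intro continuous_intros) (auto simp: add_nonneg_eq_0_iff)
  have si: "set_integrable lborel {0..pi} (\<lambda>t. 2 / pi * (sin t)\<^sup>2 * poisson \<eta> (E - (- 2 * s * cos t)))"
    by (rule borel_integrable_atLeastAtMost') (intro continuous_intros contp)
  have "(\<integral>x. poisson \<eta> (E - x) \<partial>semicircle v) = (\<integral>x. sc_density v x * poisson \<eta> (E - x) \<partial>lborel)"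
    unfolding semicircle_eq_density using v
    by (subst integral_real_density) (auto simp: sc_density_nonneg)
  also have "\<dots> = (\<integral>t. 2 / pi * (sin t)\<^sup>2 * poisson \<eta> (E - (- 2 * sqrt v * cos t)) * indicator {0..pi} t \<partial>lborel)"
    by (rule sc_substitution(2)[OF v]) (intro continuous_intros contp)
  also have "\<dots> = Im m / pi"
    using I set_borel_integral_eq_integral(2)[OF si]
    by (simp add: set_lebesgue_integral_def mult_ac s_def)
  finally have P: "pi * (\<integral>x. poisson \<eta> (E - x) \<partial>semicircle v) = Im m" by simp
  have "0 \<le> (\<integral>x. poisson \<eta> (E - x) \<partial>semicircle v)"
    by (intro integral_nonneg_AE) (auto simp: poisson_nonneg \<eta>)
  then have "Im m \<ge> 0" unfolding P[symmetric] by simp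
  with eq P that show ?thesis unfolding z_def by blast
qed

section \<open>Resolvents of real symmetric matrices\<close>

text \<open>
  The dimension varies and long products occur. Matrices are therefore functions of two indices,
  summed over indices below \<open>n\<close>: associativity and bilinearity then hold without side conditions.
\<close>

definition mm :: "nat \<Rightarrow> (nat \<Rightarrow> nat \<Rightarrow> complex) \<Rightarrow> (nat \<Rightarrow> nat \<Rightarrow> complex) \<Rightarrow> nat \<Rightarrow> nat \<Rightarrow> complex" where
  "mm n A B i j = (\<Sum>k<n. A i k * B k j)"

definition mv :: "nat \<Rightarrow> (nat \<Rightarrow> nat \<Rightarrow> complex) \<Rightarrow> (nat \<Rightarrow> complex) \<Rightarrow> nat \<Rightarrow> complex" where
  "mv n A v i = (\<Sum>k<n. A i k * v k)"

definition tr :: "nat \<Rightarrow> (nat \<Rightarrow> nat \<Rightarrow> complex) \<Rightarrow> complex" where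
  "tr n A = (\<Sum>i<n. A i i)"

definition idn :: "nat \<Rightarrow> nat \<Rightarrow> nat \<Rightarrow> complex" where
  "idn n i j = of_bool (i < n \<and> i = j)"

text \<open>
  Entries outside the square are cut off, so that the resolvent equations below are equations
  between functions.
\<close>

definition cm :: "nat \<Rightarrow> (nat \<Rightarrow> nat \<Rightarrow> real) \<Rightarrow> nat \<Rightarrow> nat \<Rightarrow> complex" where
  "cm n H i j = (if i < n \<and> j < n then of_real (H i j) else 0)"

definition vnorm :: "nat \<Rightarrow> (nat \<Rightarrow> complex) \<Rightarrow> real" where
  "vnorm n v = L2_set (\<lambda>i. norm (v i)) {..<n}"

definition symm :: "nat \<Rightarrow> (nat \<Rightarrow> nat \<Rightarrow> real) \<Rightarrow> bool" where
  "symm n H \<longleftrightarrow> (\<forall>i<n. \<forall>j<n. H i j = H j i)"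

lemma mm_assoc: "mm n (mm n A B) C = mm n A (mm n B C)"
  unfolding mm_def sum_distrib_left sum_distrib_right
  by (intro ext, subst sum.swap) (simp add: mult.assoc)

lemma mm_add_left: "mm n (\<lambda>i j. A i j + B i j) C = (\<lambda>i j. mm n A C i j + mm n B C i j)"
  and mm_add_right: "mm n A (\<lambda>i j. B i j + C i j) = (\<lambda>i j. mm n A B i j + mm n A C i j)"
  and mm_diff_left: "mm n (\<lambda>i j. A i j - B i j) C = (\<lambda>i j. mm n A C i j - mm n B C i j)"
  and mm_diff_right: "mm n A (\<lambda>i j. B i j - C i j) = (\<lambda>i j. mm n A B i j - mm n A C i j)"
  and mm_scale_left: "mm n (\<lambda>i j. c * A i j) C = (\<lambda>i j. c * mm n A C i j)"
  and mm_scale_right: "mm n A (\<lambda>i j. c * B i j) = (\<lambda>i j. c * mm n A B i j)"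
  by (simp_all add: mm_def fun_eq_iff algebra_simps sum.distrib sum_subtractf sum_distrib_left)

lemma mm_sum_left: "mm n (\<lambda>i j. \<Sum>l\<in>S. c l * A l i j) C = (\<lambda>i j. \<Sum>l\<in>S. c l * mm n (A l) C i j)"
  by (simp add: mm_def fun_eq_iff sum_distrib_left sum_distrib_right mult.assoc, subst sum.swap, simp)

lemma tr_add: "tr n (\<lambda>i j. A i j + B i j) = tr n A + tr n B"
  and tr_diff: "tr n (\<lambda>i j. A i j - B i j) = tr n A - tr n B"
  and tr_scale: "tr n (\<lambda>i j. c * A i j) = c * tr n A"
  by (simp_all add: tr_def sum.distrib sum_subtractf sum_distrib_left)

lemma tr_mm_comm: "tr n (mm n A B) = tr n (mm n B A)"
  unfolding tr_def mm_def by (subst sum.swap) (simp add: mult.commute)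

lemma tr_idn: "tr n (idn n) = of_nat n"
  by (simp add: tr_def idn_def)

lemma mm_idn_right: "(\<And>i j. j \<ge> n \<Longrightarrow> A i j = 0) \<Longrightarrow> mm n A (idn n) = A"
proof (intro ext)
  fix i j assume "\<And>i j. j \<ge> n \<Longrightarrow> A i j = 0"
  moreover have "mm n A (idn n) i j = (\<Sum>k<n. if k = j then A i j else 0)"
    unfolding mm_def idn_def by (intro sum.cong) auto
  ultimately show "mm n A (idn n) i j = A i j" by (simp add: sum.delta)
qed

lemma mm_idn_left: "(\<And>i j. i \<ge> n \<Longrightarrow> A i j = 0) \<Longrightarrow> mm n (idn n) A = A"
proof (intro ext)
  fix i j assume "\<And>i j. i \<ge> n \<Longrightarrow> A i j = 0"
  moreover have "mm n (idn n) A i j = (\<Sum>k<n. if k = i then A i j else 0)"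
    unfolding mm_def idn_def by (intro sum.cong) auto
  ultimately show "mm n (idn n) A i j = A i j" by (simp add: sum.delta)
qed

lemma mv_mm: "mv n (mm n A B) v = mv n A (mv n B v)"
  unfolding mm_def mv_def sum_distrib_left sum_distrib_right
  by (intro ext, subst sum.swap) (simp add: mult.assoc)

lemma vnorm_nonneg [simp]: "0 \<le> vnorm n v"
  by (simp add: vnorm_def L2_set_nonneg)

lemma vnorm_sq: "(vnorm n v)\<^sup>2 = (\<Sum>i<n. (norm (v i))\<^sup>2)"
  by (simp add: vnorm_def L2_set_def sum_nonneg)

lemma norm_le_vnorm: "i < n \<Longrightarrow> norm (v i) \<le> vnorm n v"
  unfolding vnorm_def by (rule member_le_L2_set) auto

lemma cauchy_schwarz_vnorm: "norm (\<Sum>i<n. u i * v i) \<le> vnorm n u * vnorm n v"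
proof -
  have "norm (\<Sum>i<n. u i * v i) \<le> (\<Sum>i<n. \<bar>norm (u i)\<bar> * \<bar>norm (v i)\<bar>)"
    by (rule order_trans[OF norm_sum]) (simp add: norm_mult)
  also have "\<dots> \<le> vnorm n u * vnorm n v" unfolding vnorm_def by (rule L2_set_mult_ineq)
  finally show ?thesis .
qed

text \<open>
  The quadratic form of a real symmetric matrix takes real values, so the imaginary part of
  \<open>\<langle>u, (H - z) u\<rangle>\<close> is \<open>- Im z |u|\<^sup>2\<close>. Both the invertibility of \<open>H - z\<close> and the norm bound of its inverse
  follow.
\<close>

lemma symm_coercive:
  assumes H: "symm n H" and w: "\<And>i. i < n \<Longrightarrow> w i = (\<Sum>k<n. of_real (H i k) * u k) - z * u i"
  shows "\<bar>Im z\<bar> * vnorm n u \<le> vnorm n w"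
proof -
  define S where "S = (\<Sum>i<n. \<Sum>k<n. cnj (u i) * (of_real (H i k) * u k))"
  have "cnj S = (\<Sum>i<n. \<Sum>k<n. u i * (of_real (H i k) * cnj (u k)))"
    by (simp add: S_def)
  also have "\<dots> = (\<Sum>k<n. \<Sum>i<n. u i * (of_real (H i k) * cnj (u k)))" by (rule sum.swap)
  also have "\<dots> = S"
    unfolding S_def using H by (intro sum.cong refl) (auto simp: symm_def mult_ac)
  finally have ImS: "Im S = 0" by (metis Reals_cnj_iff complex_is_Real_iff)
  have "(\<Sum>i<n. cnj (u i) * w i) = S - z * of_real ((vnorm n u)\<^sup>2)"
  proof -
    have "(\<Sum>i<n. cnj (u i) * w i) = (\<Sum>i<n. (\<Sum>k<n. cnj (u i) * (of_real (H i k) * u k)) - z * of_real ((norm (u i))\<^sup>2))"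
      by (intro sum.cong refl) (simp add: w right_diff_distrib sum_distrib_left complex_norm_square mult_ac del: of_real_power)
    then show ?thesis by (simp add: S_def sum_subtractf sum_distrib_left vnorm_sq del: of_real_power)
  qed
  then have "Im (\<Sum>i<n. cnj (u i) * w i) = - (Im z * (vnorm n u)\<^sup>2)"
    using ImS by (simp del: of_real_power)
  then have "\<bar>Im z\<bar> * (vnorm n u)\<^sup>2 = \<bar>Im (\<Sum>i<n. cnj (u i) * w i)\<bar>" by (simp add: abs_mult)
  also have "\<dots> \<le> norm (\<Sum>i<n. cnj (u i) * w i)" by (rule abs_Im_le_cmod)
  also have "\<dots> \<le> vnorm n (\<lambda>i. cnj (u i)) * vnorm n w" by (rule cauchy_schwarz_vnorm)
  also have "vnorm n (\<lambda>i. cnj (u i)) = vnorm n u" by (simp add: vnorm_def)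
  finally have "vnorm n u * (\<bar>Im z\<bar> * vnorm n u) \<le> vnorm n u * vnorm n w"
    by (simp add: power2_eq_square mult_ac)
  then show ?thesis
    by (cases "vnorm n u = 0") (auto simp: less_le mult_le_cancel_left)
qed

definition shifted :: "nat \<Rightarrow> (nat \<Rightarrow> nat \<Rightarrow> real) \<Rightarrow> complex \<Rightarrow> complex mat" where
  "shifted n H z = Matrix.mat n n (\<lambda>(i, j). of_bool (i = j) * z - of_real (H i j))"

lemma shifted_carrier [simp]: "shifted n H z \<in> carrier_mat n n"
  by (simp add: shifted_def)

lemma det_shifted_nonzero:
  assumes H: "symm n H" and z: "Im z \<noteq> 0"
  shows "det (shifted n H z) \<noteq> 0"
proof
  assume "det (shifted n H z) = 0"
  then obtain v where v: "v \<in> carrier_vec n" "v \<noteq> 0\<^sub>v n" "shifted n H z *\<^sub>v v = 0\<^sub>v n"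
    using det_0_iff_vec_prod_zero[OF shifted_carrier] by blast
  have "\<bar>Im z\<bar> * vnorm n (\<lambda>i. v $ i) \<le> vnorm n (\<lambda>i. 0)"
  proof (rule symm_coercive[OF H])
    fix i assume i: "i < n"
    have "0 = (shifted n H z *\<^sub>v v) $ i" using v(3) i by simp
    also have "\<dots> = (\<Sum>k<n. (of_bool (i = k) * z - of_real (H i k)) * v $ k)"
      using i v(1) by (simp add: shifted_def mult_mat_vec_def scalar_prod_def lessThan_atLeast0)
    also have "\<dots> = (\<Sum>k<n. (if k = i then z * v $ i else 0) - of_real (H i k) * v $ k)"
      by (intro sum.cong) (auto simp: algebra_simps)
    also have "\<dots> = z * v $ i - (\<Sum>k<n. of_real (H i k) * v $ k)"
      using i by (simp add: sum_subtractf sum.delta)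
    finally show "0 = (\<Sum>k<n. of_real (H i k) * v $ k) - z * v $ i" by simp
  qed
  also have "vnorm n (\<lambda>i. 0) = 0" by (simp add: vnorm_def L2_set_def)
  finally have "vnorm n (\<lambda>i. v $ i) = 0"
    using z by (intro antisym vnorm_nonneg) (auto simp: mult_le_0_iff)
  then have "v $ i = 0" if "i < n" for i using norm_le_vnorm[OF that, of "\<lambda>i. v $ i"] by simp
  then have "v = 0\<^sub>v n" using v(1) by (intro eq_vecI) auto
  with v(2) show False by simp
qed

text \<open>
  The inverse of \<open>H - z\<close> by Cramer's rule, extended by zero.
\<close>

definition res :: "nat \<Rightarrow> (nat \<Rightarrow> nat \<Rightarrow> real) \<Rightarrow> complex \<Rightarrow> nat \<Rightarrow> nat \<Rightarrow> complex" where
  "res n H z i j = (if i < n \<and> j < n then - (adj_mat (shifted n H z) $$ (i, j) / det (shifted n H z)) else 0)"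

lemma res_outside: "i \<ge> n \<Longrightarrow> res n H z i j = 0" "j \<ge> n \<Longrightarrow> res n H z i j = 0"
  by (auto simp: res_def)

context
  fixes n :: nat and H :: "nat \<Rightarrow> nat \<Rightarrow> real" and z :: complex
  assumes H: "symm n H" and z: "Im z > 0"
begin

lemma res_right: "mm n (cm n H) (res n H z) = (\<lambda>i j. z * res n H z i j + idn n i j)"
proof (intro ext)
  fix i j
  let ?N = "shifted n H z"
  have d: "det ?N \<noteq> 0" using det_shifted_nonzero[OF H] z by auto
  show "mm n (cm n H) (res n H z) i j = z * res n H z i j + idn n i j"
  proof (cases "i < n \<and> j < n")
    case True
    have "(?N * adj_mat ?N) $$ (i, j) = det ?N * of_bool (i = j)"
      using True by (subst adj_mat(2)[OF shifted_carrier]) auto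
    moreover have "(?N * adj_mat ?N) $$ (i, j) = (\<Sum>k<n. ?N $$ (i, k) * adj_mat ?N $$ (k, j))"
      using True adj_mat(1)[OF shifted_carrier, of n H z] by (simp add: scalar_prod_def lessThan_atLeast0 carrier_matD[OF shifted_carrier])
    moreover have "(\<Sum>k<n. ?N $$ (i, k) * adj_mat ?N $$ (k, j)) = - det ?N * (\<Sum>k<n. ?N $$ (i, k) * res n H z k j)"
      unfolding sum_distrib_left using True d by (intro sum.cong) (auto simp: res_def)
    ultimately have "det ?N * of_bool (i = j) = - det ?N * (\<Sum>k<n. ?N $$ (i, k) * res n H z k j)" by simp
    then have "det ?N * of_bool (i = j) = det ?N * (- (\<Sum>k<n. ?N $$ (i, k) * res n H z k j))"
      by (simp only: mult_minus_left mult_minus_right)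
    then have "of_bool (i = j) = - (\<Sum>k<n. ?N $$ (i, k) * res n H z k j)"
      using d by (simp only: mult_cancel_left) blast
    then have "- of_bool (i = j) = (\<Sum>k<n. ?N $$ (i, k) * res n H z k j)"
      by simp
    also have "\<dots> = (\<Sum>k<n. (if k = i then z * res n H z i j else 0) - cm n H i k * res n H z k j)"
      using True by (intro sum.cong) (auto simp: shifted_def cm_def algebra_simps)
    also have "\<dots> = z * res n H z i j - mm n (cm n H) (res n H z) i j"
      using True by (simp add: sum_subtractf sum.delta mm_def)
    finally have e: "- of_bool (i = j) = z * res n H z i j - mm n (cm n H) (res n H z) i j" .
    have "mm n (cm n H) (res n H z) i j = z * res n H z i j - (- of_bool (i = j))"
      unfolding e by simp
    then show ?thesis using True by (simp add: idn_def)
  qed (auto simp: mm_def cm_def res_def idn_def)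
qed

lemma res_symmetric: "res n H z i j = res n H z j i"
proof -
  define G where "G = res n H z"
  define G' where "G' i j = G j i" for i j
  have cmt: "cm n H i j = cm n H j i" for i j using H by (auto simp: cm_def symm_def)
  have out: "\<And>i j. i \<ge> n \<Longrightarrow> G i j = 0" "\<And>i j. j \<ge> n \<Longrightarrow> G i j = 0" by (auto simp: G_def res_outside)
  have R: "mm n (cm n H) G = (\<lambda>i j. z * G i j + idn n i j)" unfolding G_def by (rule res_right)
  have L: "mm n G' (cm n H) = (\<lambda>i j. z * G' i j + idn n i j)"
  proof (intro ext)
    fix i j
    have "mm n G' (cm n H) i j = mm n (cm n H) G j i"
      unfolding mm_def G'_def by (intro sum.cong refl) (simp add: mult.commute cmt)
    then show "mm n G' (cm n H) i j = z * G' i j + idn n i j" by (auto simp: R G'_def idn_def)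
  qed
  have "mm n G' (mm n (cm n H) G) = mm n (mm n G' (cm n H)) G" by (simp only: mm_assoc)
  then have "(\<lambda>i j. z * mm n G' G i j + mm n G' (idn n) i j) = (\<lambda>i j. z * mm n G' G i j + mm n (idn n) G i j)"
    unfolding R L by (simp only: mm_add_left mm_add_right mm_scale_left mm_scale_right)
  moreover have "mm n G' (idn n) = G'" using out by (intro mm_idn_right) (simp add: G'_def)
  moreover have "mm n (idn n) G = G" using out by (intro mm_idn_left) simp
  ultimately have "G' i j = G i j" by (simp add: fun_eq_iff)
  then show ?thesis by (simp add: G'_def G_def)
qed

lemma res_left: "mm n (res n H z) (cm n H) = (\<lambda>i j. z * res n H z i j + idn n i j)"
proof (intro ext)
  fix i j
  have cmt: "cm n H i j = cm n H j i" for i j using H by (auto simp: cm_def symm_def)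
  have "mm n (res n H z) (cm n H) i j = mm n (cm n H) (res n H z) j i"
    unfolding mm_def by (intro sum.cong refl) (subst res_symmetric, subst cmt, simp add: mult.commute)
  then show "mm n (res n H z) (cm n H) i j = z * res n H z i j + idn n i j"
    by (auto simp: res_right idn_def res_symmetric)
qed

lemma vnorm_res: "Im z * vnorm n (mv n (res n H z) v) \<le> vnorm n v"
proof -
  have "\<bar>Im z\<bar> * vnorm n (mv n (res n H z) v) \<le> vnorm n v"
  proof (rule symm_coercive[OF H])
    fix i assume i: "i < n"
    have "(\<Sum>k<n. of_real (H i k) * mv n (res n H z) v k) = mv n (cm n H) (mv n (res n H z) v) i"
      unfolding mv_def using i by (intro sum.cong) (auto simp: cm_def)
    also have "\<dots> = mv n (\<lambda>i j. z * res n H z i j + idn n i j) v i"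
      by (simp only: mv_mm[symmetric] res_right)
    also have "\<dots> = z * mv n (res n H z) v i + (\<Sum>k<n. if k = i then v i else 0)"
      unfolding mv_def idn_def using i
      by (subst sum_distrib_left, subst sum.distrib[symmetric]) (intro sum.cong, auto simp: algebra_simps)
    finally show "v i = (\<Sum>k<n. of_real (H i k) * mv n (res n H z) v k) - z * mv n (res n H z) v i"
      using i by (simp add: sum.delta)
  qed
  then show ?thesis using z by simp
qed

lemma vnorm_res_row: "Im z * vnorm n (\<lambda>j. res n H z i j) \<le> 1"
proof (cases "i < n")
  case True
  have "mv n (res n H z) (\<lambda>k. of_bool (k = i)) = (\<lambda>j. res n H z i j)"
  proof
    fix j
    have "mv n (res n H z) (\<lambda>k. of_bool (k = i)) j = (\<Sum>k<n. if k = i then res n H z j i else 0)"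
      unfolding mv_def by (intro sum.cong) auto
    then show "mv n (res n H z) (\<lambda>k. of_bool (k = i)) j = res n H z i j"
      using True res_symmetric[of i j] by (simp add: sum.delta)
  qed
  moreover have "vnorm n (\<lambda>k. of_bool (k = i)) = 1"
  proof -
    have "(vnorm n (\<lambda>k. of_bool (k = i)))\<^sup>2 = (\<Sum>k<n. if k = i then 1 else 0)"
      unfolding vnorm_sq by (intro sum.cong) auto
    then have "(vnorm n (\<lambda>k. of_bool (k = i)))\<^sup>2 = 1" using True by (simp add: sum.delta)
    then show ?thesis using vnorm_nonneg[of n "\<lambda>k. of_bool (k = i)"] by (simp add: power2_eq_1_iff)
  qed
  ultimately show ?thesis using vnorm_res[of "\<lambda>k. of_bool (k = i)"] by simp
qed (simp add: res_def vnorm_def L2_set_def)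

lemma norm_res_le: "norm (res n H z i j) \<le> 1 / Im z"
proof (cases "j < n")
  case True
  have "Im z * norm (res n H z i j) \<le> Im z * vnorm n (\<lambda>j. res n H z i j)"
    using z True by (intro mult_left_mono norm_le_vnorm[of j n "\<lambda>j. res n H z i j"]) auto
  then have "Im z * norm (res n H z i j) \<le> 1" using vnorm_res_row[of i] by (rule order_trans)
  then show ?thesis using z by (simp add: field_simps)
qed (use z in \<open>simp add: res_def\<close>)

end

text \<open>
  The resolvent identity. It serves as an exact Taylor expansion, so that resolvents are never
  differentiated.
\<close>

lemma res_diff:
  assumes H1: "symm n H1" and H2: "symm n H2" and z: "Im z > 0"
  shows "res n H2 z i j - res n H1 z i j
    = mm n (mm n (res n H1 z) (cm n (\<lambda>i j. H1 i j - H2 i j))) (res n H2 z) i j"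
proof -
  let ?G1 = "res n H1 z" and ?G2 = "res n H2 z"
  have c: "cm n (\<lambda>i j. H1 i j - H2 i j) = (\<lambda>i j. cm n H1 i j - cm n H2 i j)"
    by (auto simp: cm_def fun_eq_iff)
  have "mm n (mm n ?G1 (cm n (\<lambda>i j. H1 i j - H2 i j))) ?G2
     = (\<lambda>i j. mm n (mm n ?G1 (cm n H1)) ?G2 i j - mm n ?G1 (mm n (cm n H2) ?G2) i j)"
    unfolding c mm_diff_left mm_diff_right by (simp only: mm_assoc)
  also have "\<dots> = (\<lambda>i j. mm n (idn n) ?G2 i j - mm n ?G1 (idn n) i j)"
    unfolding res_left[OF H1 z] res_right[OF H2 z] mm_add_left mm_add_right mm_scale_left mm_scale_right
    by simp
  also have "\<dots> = (\<lambda>i j. ?G2 i j - ?G1 i j)"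
    by (subst mm_idn_left, simp add: res_outside, subst mm_idn_right, simp add: res_outside) simp
  finally show ?thesis by simp
qed

lemma poly_pderiv_linear_factors:
  fixes z :: "'a :: field"
  assumes "z \<notin> set as"
  shows "poly (pderiv (\<Prod>a\<leftarrow>as. [:- a, 1:])) z = poly (\<Prod>a\<leftarrow>as. [:- a, 1:]) z * (\<Sum>a\<leftarrow>as. 1 / (z - a))"
  using assms
proof (induction as)
  case (Cons a as)
  define p where "p = (\<Prod>a\<leftarrow>as. [:- a, 1:])"
  have "pderiv [:- a, 1:] = 1" by (simp add: pderiv_pCons)
  then have "poly (pderiv ([:- a, 1:] * p)) z = (z - a) * poly (pderiv p) z + poly p z"
    unfolding pderiv_mult by (simp add: algebra_simps)
  moreover have "poly (pderiv p) z = poly p z * (\<Sum>a\<leftarrow>as. 1 / (z - a))"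
    unfolding p_def by (rule Cons.IH) (use Cons.prems in simp)
  moreover have "poly ([:- a, 1:] * p) z = (z - a) * poly p z" by (simp add: algebra_simps)
  moreover have "(z - a) * poly p z * (1 / (z - a)) = poly p z" using Cons.prems by simp
  ultimately show ?case
    by (simp only: list.map prod_list.Cons sum_list.Cons p_def[symmetric] distrib_left)
      (simp only: mult.assoc add.commute)
qed (simp add: pderiv_1)

text \<open>
  By Jacobi's formula the trace of the adjugate of \<open>z - H\<close> is the derivative of the characteristic
  polynomial, so the trace of the resolvent is minus its logarithmic derivative.
\<close>

lemma trace_res_factors:
  assumes H: "symm n H" and z: "Im z > 0"
    and fact: "char_poly (Matrix.mat n n (\<lambda>(i, j). complex_of_real (H i j))) = (\<Prod>a\<leftarrow>as. [:- a, 1:])"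
  shows "tr n (res n H z) = (\<Sum>a\<leftarrow>as. 1 / (a - z))"
proof -
  define A where "A = Matrix.mat n n (\<lambda>(i, j). complex_of_real (H i j))"
  have A: "A \<in> carrier_mat n n" by (simp add: A_def)
  have N: "shifted n H z = - char_matrix A z"
    by (rule eq_matI) (auto simp: shifted_def char_matrix_def A_def)
  have det: "det (shifted n H z) = poly (char_poly A) z"
    unfolding N char_poly_matrix[OF A] ..
  have d0: "det (shifted n H z) \<noteq> 0" using det_shifted_nonzero[OF H] z by auto
  have z_as: "z \<notin> set as"
    using d0 unfolding det fact[folded A_def] by (auto simp: poly_prod_list prod_list_zero_iff)
  have adj: "adj_mat (shifted n H z) $$ (i, i) = poly (char_poly (mat_delete A i i)) z" if i: "i < n" for i
  proof -
    have B: "mat_delete A i i \<in> carrier_mat (n - 1) (n - 1)" using A by (rule mat_delete_carrier)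
    have "adj_mat (shifted n H z) $$ (i, i) = det (mat_delete (shifted n H z) i i)"
      using i by (simp add: adj_mat_def cofactor_def carrier_matD[OF shifted_carrier])
    also have "mat_delete (shifted n H z) i i = - char_matrix (mat_delete A i i) z"
      using i by (intro eq_matI) (auto simp: N mat_delete_def char_matrix_def A_def)
    finally show ?thesis unfolding char_poly_matrix[OF B] .
  qed
  have "tr n (res n H z) = (\<Sum>i<n. - (poly (char_poly (mat_delete A i i)) z / det (shifted n H z)))"
    unfolding tr_def by (intro sum.cong refl) (simp add: res_def adj)
  also have "\<dots> = - (poly (pderiv (char_poly A)) z / poly (char_poly A) z)"
    unfolding pderiv_char_poly[OF A] det by (simp add: poly_sum sum_negf sum_divide_distrib)
  also have "\<dots> = - (\<Sum>a\<leftarrow>as. 1 / (z - a))"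
    using d0 unfolding det fact[folded A_def] by (subst poly_pderiv_linear_factors[OF z_as]) simp
  also have "\<dots> = (\<Sum>a\<leftarrow>as. 1 / (a - z))"
  proof -
    have "- (1 / (z - a)) = 1 / (a - z)" for a
      by (metis minus_diff_eq minus_divide_right)
    then show ?thesis by (simp add: uminus_sum_list_map o_def)
  qed
  finally show ?thesis .
qed

text \<open>
  A non-real root of the characteristic polynomial would contradict the invertibility of \<open>H - z\<close> off
  the real axis.
\<close>

lemma symm_char_poly_real_factors:
  assumes H: "symm n H"
  obtains bs where "length bs = n"
    "char_poly (Matrix.mat n n (\<lambda>(i, j). H i j)) = (\<Prod>b\<leftarrow>bs. [:- b, 1:])"
    "char_poly (Matrix.mat n n (\<lambda>(i, j). complex_of_real (H i j))) = (\<Prod>a\<leftarrow>map of_real bs. [:- a, 1:])"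
proof -
  define R where "R = Matrix.mat n n (\<lambda>(i, j). H i j)"
  define A where "A = Matrix.mat n n (\<lambda>(i, j). complex_of_real (H i j))"
  have RA: "R \<in> carrier_mat n n" "A \<in> carrier_mat n n" by (simp_all add: A_def R_def)
  have AR: "A = map_mat of_real R" by (rule eq_matI) (auto simp: A_def R_def)

  interpret mp: map_poly_comm_ring_hom "of_real :: real \<Rightarrow> complex" ..
  have cp: "char_poly A = map_poly of_real (char_poly R)"
    unfolding AR by (rule of_real_hom.char_poly_hom[OF RA(1)])
  obtain as where as: "char_poly A = (\<Prod>a\<leftarrow>as. [:- a, 1:])" "length as = n"
    using char_poly_factorized[OF RA(2)] by blast
  have real: "Im a = 0" if a: "a \<in> set as" for a
  proof (rule ccontr)
    assume "Im a \<noteq> 0"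
    then have "det (shifted n H a) \<noteq> 0" by (rule det_shifted_nonzero[OF H])
    moreover have "shifted n H a = - char_matrix A a"
      by (rule eq_matI) (auto simp: shifted_def char_matrix_def A_def)
    ultimately have "poly (char_poly A) a \<noteq> 0" unfolding char_poly_matrix[OF RA(2)] by simp
    then show False using a by (auto simp: as poly_prod_list prod_list_zero_iff)
  qed
  define bs where "bs = map Re as"
  have asb: "as = map of_real bs"
    unfolding bs_def using real by (auto simp: o_def complex_eq_iff intro!: nth_equalityI)
  have "map_poly of_real (\<Prod>b\<leftarrow>bs. [:- b, 1:]) = (\<Prod>a\<leftarrow>map of_real bs. [:- (a::complex), 1:])" for bs :: "real list"
  proof (induction bs)
    case (Cons b bs)
    have "map_poly complex_of_real [:- b, 1:] = [:- complex_of_real b, 1:]"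
      by (simp add: map_poly_pCons)
    then show ?case
      using Cons.IH by (simp only: list.map prod_list.Cons mp.hom_mult)
  qed simp
  then have "map_poly complex_of_real (char_poly R) = map_poly of_real (\<Prod>b\<leftarrow>bs. [:- b, 1:])"
    unfolding cp[symmetric] as asb by simp
  then have eq: "coeff (map_poly complex_of_real (char_poly R)) i
      = coeff (map_poly of_real (\<Prod>b\<leftarrow>bs. [:- b, 1:])) i" for i
    by (rule arg_cong)
  have cpR: "char_poly R = (\<Prod>b\<leftarrow>bs. [:- b, 1:])"
    by (rule poly_eqI) (use eq in \<open>simp add: coeff_map_poly\<close>)
  have len: "length bs = n" using as(2) by (simp add: bs_def)
  show ?thesis
    by (rule that[OF len cpR[unfolded R_def] as(1)[unfolded asb A_def]])
qed

lemma expectation_pmf_of_multiset: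
  fixes f :: "'a \<Rightarrow> real"
  assumes "M \<noteq> {#}"
  shows "measure_pmf.expectation (pmf_of_multiset M) f = (\<Sum>x\<in>#M. f x) / size M"
proof -
  have S: "(\<Sum>x\<in>S. f x * real (count M x)) = (\<Sum>x\<in>#M. f x)" if "finite S" "set_mset M \<subseteq> S" for S
    using that(2)
  proof (induction M)
    case (add a M)
    have "(\<Sum>x\<in>S. f x * real (count (add_mset a M) x)) = (\<Sum>x\<in>S. f x * real (count M x) + (if x = a then f a else 0))"
      by (intro sum.cong) (auto simp: algebra_simps)
    then show ?case using add that(1) by (simp add: sum.distrib sum.delta)
  qed simp
  have "measure_pmf.expectation (pmf_of_multiset M) f = (\<Sum>x\<in>set_mset M. f x * pmf (pmf_of_multiset M) x)"
    by (rule integral_measure_pmf_real) (use assms in \<open>auto simp: set_pmf_of_multiset\<close>)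
  also have "\<dots> = (\<Sum>x\<in>set_mset M. f x * real (count M x)) / size M"
    using assms by (simp add: pmf_of_multiset sum_divide_distrib)
  finally show ?thesis using S[of "set_mset M"] by simp
qed

lemma esd_poisson_eq_trace:
  assumes n: "n > 0" and H: "symm n H" and \<eta>: "\<eta> > 0"
  shows "pi * measure_pmf.expectation (esd (Matrix.mat n n (\<lambda>(i, j). H i j))) (\<lambda>x. poisson \<eta> (E - x))
    = Im (tr n (res n H (Complex E \<eta>)) / of_nat n)"
proof -
  obtain bs where bs: "length bs = n"
    "char_poly (Matrix.mat n n (\<lambda>(i, j). H i j)) = (\<Prod>b\<leftarrow>bs. [:- b, 1:])"
    "char_poly (Matrix.mat n n (\<lambda>(i, j). complex_of_real (H i j))) = (\<Prod>a\<leftarrow>map of_real bs. [:- a, 1:])"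
    using symm_char_poly_real_factors[OF H] by blast
  have "proots (\<Prod>b\<leftarrow>bs. [:- b, 1:]) = mset bs" for bs :: "real list"
  proof (induction bs)
    case (Cons b bs)
    have "(\<Prod>b\<leftarrow>bs. [:- b, 1:]) \<noteq> 0" by (auto simp: prod_list_zero_iff)
    then show ?case
      using Cons by (simp add: proots_mult del: mult_pCons_left)
  qed simp
  then have pr: "proots (char_poly (Matrix.mat n n (\<lambda>(i, j). H i j))) = mset bs" by (simp add: bs)
  have ne: "mset bs \<noteq> {#}" using n bs(1) by auto
  have "pi * measure_pmf.expectation (esd (Matrix.mat n n (\<lambda>(i, j). H i j))) (\<lambda>x. poisson \<eta> (E - x))
     = pi * ((\<Sum>x\<leftarrow>bs. poisson \<eta> (E - x)) / real n)"
    unfolding esd_def pr expectation_pmf_of_multiset[OF ne]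
    by (simp add: bs(1) sum_mset_sum_list[symmetric])
  moreover have "(\<Sum>x\<leftarrow>bs. pi * poisson \<eta> (E - x)) = Im (\<Sum>a\<leftarrow>map of_real bs. 1 / (a - Complex E \<eta>))" for bs
    by (induction bs) (simp_all add: Im_inverse_diff[OF \<eta>])
  moreover have "tr n (res n H (Complex E \<eta>)) = (\<Sum>a\<leftarrow>map of_real bs. 1 / (a - Complex E \<eta>))"
    by (rule trace_res_factors[OF H _ bs(3)]) (use \<eta> in simp)
  ultimately show ?thesis
    by (simp add: sum_list_const_mult Im_divide_of_nat)
qed

section \<open>Independent Bernoulli variables\<close>

lemma finite_set_Pi_bernoulli:
  assumes "finite A"
  shows "finite (set_pmf (Pi_pmf A False (\<lambda>l. bernoulli_pmf (q l))))"
proof (rule finite_subset)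
  show "set_pmf (Pi_pmf A False (\<lambda>l. bernoulli_pmf (q l))) \<subseteq> PiE_dflt A False (\<lambda>_. UNIV)"
    using set_Pi_pmf_subset'[OF assms] by (fastforce simp: PiE_dflt_def)
  show "finite (PiE_dflt A False (\<lambda>_. UNIV :: bool set))" using assms by (intro finite_PiE_dflt) auto
qed

lemma bernoulli_two_point:
  fixes f :: "bool \<Rightarrow> 'a :: {banach, second_countable_topology}"
  assumes "0 \<le> p" "p \<le> 1"
  shows "measure_pmf.expectation (bernoulli_pmf p) f = p *\<^sub>R f True + (1 - p) *\<^sub>R f False"
  using assms by (subst integral_measure_pmf[where A = UNIV]) (auto simp: UNIV_bool)

lemma expectation_Pi_bernoulli_insert:
  fixes f :: "('a \<Rightarrow> bool) \<Rightarrow> 'b :: {banach, second_countable_topology}"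
  assumes A: "finite A" "x \<notin> A" and q: "0 \<le> q x" "q x \<le> 1"
  shows "measure_pmf.expectation (Pi_pmf (insert x A) False (\<lambda>l. bernoulli_pmf (q l))) f
    = measure_pmf.expectation (Pi_pmf A False (\<lambda>l. bernoulli_pmf (q l)))
        (\<lambda>h. q x *\<^sub>R f (h(x := True)) + (1 - q x) *\<^sub>R f (h(x := False)))"
proof -
  let ?P = "Pi_pmf A False (\<lambda>l. bernoulli_pmf (q l))"
  have "Pi_pmf (insert x A) False (\<lambda>l. bernoulli_pmf (q l))
      = bind_pmf ?P (\<lambda>h. map_pmf (\<lambda>b. h(x := b)) (bernoulli_pmf (q x)))"
    unfolding Pi_pmf_insert'[OF A] map_pmf_def by (rule bind_commute_pmf)
  moreover have "finite (set_pmf (map_pmf (\<lambda>b. h(x := b)) (bernoulli_pmf (q x))))" for h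
    by (simp add: finite_subset[OF subset_UNIV])
  ultimately have "measure_pmf.expectation (Pi_pmf (insert x A) False (\<lambda>l. bernoulli_pmf (q l))) f
    = (\<Sum>h\<in>set_pmf ?P. pmf ?P h *\<^sub>R measure_pmf.expectation (map_pmf (\<lambda>b. h(x := b)) (bernoulli_pmf (q x))) f)"
    using finite_set_Pi_bernoulli[OF A(1)]
    by (simp add: pmf_expectation_bind[where A = "set_pmf ?P"])
  also have "\<dots> = (\<Sum>h\<in>set_pmf ?P. pmf ?P h *\<^sub>R (q x *\<^sub>R f (h(x := True)) + (1 - q x) *\<^sub>R f (h(x := False))))"
    by (simp only: integral_map_pmf bernoulli_two_point[OF q])
  also have "\<dots> = measure_pmf.expectation ?P (\<lambda>h. q x *\<^sub>R f (h(x := True)) + (1 - q x) *\<^sub>R f (h(x := False)))"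
    using finite_set_Pi_bernoulli[OF A(1)] by (subst integral_measure_pmf[where A = "set_pmf ?P"]) auto
  finally show ?thesis .
qed

text \<open>
  The integrand on the right does not depend on the coordinate \<open>x\<close> any more: this is the conditional
  expectation given all other coordinates.
\<close>

lemma expectation_Pi_bernoulli_resample:
  fixes f :: "('a \<Rightarrow> bool) \<Rightarrow> 'b :: {banach, second_countable_topology}"
  assumes A: "finite A" "x \<in> A" and q: "0 \<le> q x" "q x \<le> 1"
  defines "P \<equiv> Pi_pmf A False (\<lambda>l. bernoulli_pmf (q l))"
  shows "measure_pmf.expectation P f
    = measure_pmf.expectation P (\<lambda>h. q x *\<^sub>R f (h(x := True)) + (1 - q x) *\<^sub>R f (h(x := False)))"
proof -
  have A': "insert x (A - {x}) = A" "finite (A - {x})" "x \<notin> A - {x}" using A by auto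
  note E = expectation_Pi_bernoulli_insert[where q = q, OF A'(2,3) q, unfolded A'(1), folded P_def]
  show ?thesis
    unfolding E[of f] E[of "\<lambda>h. q x *\<^sub>R f (h(x := True)) + (1 - q x) *\<^sub>R f (h(x := False))"]
    by (simp add: scaleR_left_distrib[symmetric])
qed

text \<open>
  Induction on the set of coordinates. A new coordinate with parameter \<open>p\<close> adds the conditional
  variance \<open>p (1 - p) D\<^sup>2\<close>, and averaging the function over this coordinate does not increase the mean
  squares of its other increments, by convexity.
\<close>

lemma efron_stein_bernoulli:
  fixes f :: "('a \<Rightarrow> bool) \<Rightarrow> real"
  assumes "finite A" and q: "\<And>l. l \<in> A \<Longrightarrow> 0 \<le> q l \<and> q l \<le> 1"
  shows "measure_pmf.expectation (Pi_pmf A False (\<lambda>l. bernoulli_pmf (q l))) (\<lambda>h. (f h)\<^sup>2)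
    - (measure_pmf.expectation (Pi_pmf A False (\<lambda>l. bernoulli_pmf (q l))) f)\<^sup>2
    \<le> (\<Sum>l\<in>A. q l * (1 - q l) * measure_pmf.expectation (Pi_pmf A False (\<lambda>l. bernoulli_pmf (q l)))
          (\<lambda>h. (f (h(l := True)) - f (h(l := False)))\<^sup>2))"
  using assms
proof (induction A arbitrary: f rule: finite_induct)
  case empty
  show ?case by simp
next
  case (insert x A)
  let ?P = "Pi_pmf A False (\<lambda>l. bernoulli_pmf (q l))"
  let ?Q = "Pi_pmf (insert x A) False (\<lambda>l. bernoulli_pmf (q l))"
  let ?E = "measure_pmf.expectation ?P"
  define p where "p = q x"
  have p: "0 \<le> p" "p \<le> 1" using insert.prems[of x] by (auto simp: p_def)
  have EQ: "measure_pmf.expectation ?Q g = ?E (\<lambda>h. p * g (h(x := True)) + (1 - p) * g (h(x := False)))"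
    for g :: "('a \<Rightarrow> bool) \<Rightarrow> real"
    using expectation_Pi_bernoulli_insert[OF insert.hyps(1,2), of q g] p by (simp add: p_def)
  have int [simp]: "integrable (measure_pmf ?P) g" for g :: "('a \<Rightarrow> bool) \<Rightarrow> real"
    by (rule integrable_measure_pmf_finite[OF finite_set_Pi_bernoulli[OF insert.hyps(1)]])
  define g where "g h = p * f (h(x := True)) + (1 - p) * f (h(x := False))" for h
  define D where "D h = f (h(x := True)) - f (h(x := False))" for h
  have IH: "?E (\<lambda>h. (g h)\<^sup>2) - (?E g)\<^sup>2
    \<le> (\<Sum>l\<in>A. q l * (1 - q l) * ?E (\<lambda>h. (g (h(l := True)) - g (h(l := False)))\<^sup>2))"
    by (rule insert.IH) (use insert.prems in auto)
  have sq: "p * (f (h(x := True)))\<^sup>2 + (1 - p) * (f (h(x := False)))\<^sup>2 = (g h)\<^sup>2 + p * (1 - p) * (D h)\<^sup>2" for h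
    by (simp add: g_def D_def power2_eq_square algebra_simps)
  have step: "?E (\<lambda>h. (g (h(l := True)) - g (h(l := False)))\<^sup>2)
      \<le> measure_pmf.expectation ?Q (\<lambda>h. (f (h(l := True)) - f (h(l := False)))\<^sup>2)" if l: "l \<in> A" for l
  proof -
    have lx: "l \<noteq> x" using l insert.hyps by auto
    show ?thesis
      unfolding EQ
    proof (rule integral_mono[OF int int])
      fix h
      define a where "a = f (h(x := True, l := True)) - f (h(x := True, l := False))"
      define b where "b = f (h(x := False, l := True)) - f (h(x := False, l := False))"
      have "g (h(l := True)) - g (h(l := False)) = p * a + (1 - p) * b"
        using lx by (simp add: g_def a_def b_def fun_upd_twist[OF lx] algebra_simps)
      moreover have "p * a\<^sup>2 + (1 - p) * b\<^sup>2 - (p * a + (1 - p) * b)\<^sup>2 = p * (1 - p) * (a - b)\<^sup>2"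
        by (simp add: power2_eq_square algebra_simps)
      moreover have "0 \<le> p * (1 - p) * (a - b)\<^sup>2" using p by simp
      ultimately show "(g (h(l := True)) - g (h(l := False)))\<^sup>2
        \<le> p * (f (h(x := True, l := True)) - f (h(x := True, l := False)))\<^sup>2 +
          (1 - p) * (f (h(x := False, l := True)) - f (h(x := False, l := False)))\<^sup>2"
        unfolding a_def[symmetric] b_def[symmetric] by simp
    qed
  qed
  have "measure_pmf.expectation ?Q (\<lambda>h. (f h)\<^sup>2) - (measure_pmf.expectation ?Q f)\<^sup>2
      = (?E (\<lambda>h. (g h)\<^sup>2) - (?E g)\<^sup>2) + p * (1 - p) * ?E (\<lambda>h. (D h)\<^sup>2)"
    unfolding EQ sq g_def[symmetric] by simp
  also have "\<dots> \<le> (\<Sum>l\<in>A. q l * (1 - q l) * measure_pmf.expectation ?Q (\<lambda>h. (f (h(l := True)) - f (h(l := False)))\<^sup>2))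
      + p * (1 - p) * ?E (\<lambda>h. (D h)\<^sup>2)"
    using insert.prems by (intro add_right_mono order_trans[OF IH] sum_mono mult_left_mono step) auto
  also have "?E (\<lambda>h. (D h)\<^sup>2) = measure_pmf.expectation ?Q (\<lambda>h. (f (h(x := True)) - f (h(x := False)))\<^sup>2)"
    unfolding EQ fun_upd_upd D_def by (simp add: distrib_right[symmetric])
  finally show ?case unfolding sum.insert[OF insert.hyps(1,2)] p_def by linarith
qed

lemma two_point_moments:
  fixes q :: real
  assumes "0 \<le> q" "q \<le> 1"
  defines "s \<equiv> q * (1 - q)"
  shows "0 \<le> s" "s \<le> 1 / 4"
    "q * ((1 - q) ^ 3 + 2 * s * (1 - q)) + (1 - q) * (q ^ 3 + 2 * s * q) \<le> 3 * s"
proof -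
  show s0: "0 \<le> s" using assms by simp
  have "0 \<le> (q - 1 / 2)\<^sup>2" by simp
  then show s4: "s \<le> 1 / 4" by (simp add: s_def power2_eq_square algebra_simps)
  have "q * ((1 - q) ^ 3 + 2 * s * (1 - q)) + (1 - q) * (q ^ 3 + 2 * s * q) = s * (1 + 2 * s)"
    by (simp add: s_def eval_nat_numeral algebra_simps)
  also have "\<dots> \<le> s * 3" using s0 s4 by (intro mult_left_mono) auto
  finally show "q * ((1 - q) ^ 3 + 2 * s * (1 - q)) + (1 - q) * (q ^ 3 + 2 * s * q) \<le> 3 * s" by simp
qed

text \<open>
  Integration by parts for a centred Bernoulli variable \<open>X\<close> with variance \<open>s\<close>. Here \<open>F1\<close> and \<open>F0\<close> are the values
  of \<open>X f(X) + a s g(X)\<close> at \<open>X = 1 - q\<close> and \<open>X = - q\<close>, where \<open>f(X) = t1 - a X t2 + (a X)\<^sup>2 w\<close> and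
  \<open>g(X) = t2 - a X (w + w')\<close>; in the application \<open>f\<close> is a trace and \<open>- a g\<close> its derivative. Since \<open>X\<close> has mean
  zero and second moment \<open>s\<close>, the terms with \<open>t1\<close> and \<open>t2\<close> cancel and only third moments are left.
\<close>

lemma two_point_ibp:
  fixes q a \<beta> :: real and t1 t2 w1 w1' w0 w0' F1 F0 :: complex
  assumes q: "0 \<le> q" "q \<le> 1" and a: "0 \<le> a"
    and w: "norm w1 \<le> \<beta>" "norm w1' \<le> \<beta>" "norm w0 \<le> \<beta>" "norm w0' \<le> \<beta>"
  defines "s \<equiv> q * (1 - q)"
  assumes F1: "F1 = of_real (1 - q) * (t1 - of_real (a * (1 - q)) * t2 + (of_real (a * (1 - q)))\<^sup>2 * w1)
      + of_real (a * s) * (t2 - of_real (a * (1 - q)) * (w1 + w1'))"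
    and F0: "F0 = of_real (- q) * (t1 - of_real (a * (- q)) * t2 + (of_real (a * (- q)))\<^sup>2 * w0)
      + of_real (a * s) * (t2 - of_real (a * (- q)) * (w0 + w0'))"
  shows "norm (of_real q * F1 + of_real (1 - q) * F0) \<le> 3 * a\<^sup>2 * s * \<beta>"
proof -
  have b0: "0 \<le> \<beta>" using w(1) norm_ge_zero order_trans by blast
  have s0: "0 \<le> s" using two_point_moments(1)[OF q] by (simp add: s_def)
  define c where "c = (of_real q :: complex)"
  define d where "d = (of_real a :: complex)"
  have e1: "of_real q * F1 + of_real (1 - q) * F0
    = of_real (a\<^sup>2 * q) * (of_real ((1 - q) ^ 3) * w1 - of_real (s * (1 - q)) * (w1 + w1'))
    + of_real (a\<^sup>2 * (1 - q)) * (- of_real (q ^ 3) * w0 + of_real (s * q) * (w0 + w0'))"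
    unfolding F1 F0 s_def of_real_mult of_real_diff of_real_minus of_real_power of_real_1 c_def[symmetric] d_def[symmetric]
    by (simp add: algebra_simps eval_nat_numeral)
  have n1: "norm (of_real ((1 - q) ^ 3) * w1 - of_real (s * (1 - q)) * (w1 + w1')) \<le> ((1 - q) ^ 3 + 2 * s * (1 - q)) * \<beta>"
  proof -
    have "norm (of_real ((1 - q) ^ 3) * w1 - of_real (s * (1 - q)) * (w1 + w1'))
      \<le> (1 - q) ^ 3 * norm w1 + s * (1 - q) * norm (w1 + w1')"
      using q s0 by (intro order_trans[OF norm_triangle_ineq4]) (simp add: norm_mult norm_power abs_mult del: of_real_power of_real_mult of_real_diff)
    also have "\<dots> \<le> (1 - q) ^ 3 * \<beta> + s * (1 - q) * (\<beta> + \<beta>)"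
      using q s0 w by (intro add_mono mult_left_mono order_trans[OF norm_triangle_ineq]) auto
    finally show ?thesis by (simp add: algebra_simps)
  qed
  have n0: "norm (- of_real (q ^ 3) * w0 + of_real (s * q) * (w0 + w0')) \<le> (q ^ 3 + 2 * s * q) * \<beta>"
  proof -
    have "norm (- of_real (q ^ 3) * w0 + of_real (s * q) * (w0 + w0'))
      \<le> q ^ 3 * norm w0 + s * q * norm (w0 + w0')"
      using q s0 by (intro order_trans[OF norm_triangle_ineq]) (simp add: norm_mult norm_power abs_mult del: of_real_power of_real_mult)
    also have "\<dots> \<le> q ^ 3 * \<beta> + s * q * (\<beta> + \<beta>)"
      using q s0 w by (intro add_mono mult_left_mono order_trans[OF norm_triangle_ineq]) auto
    finally show ?thesis by (simp add: algebra_simps)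
  qed
  have "norm (of_real q * F1 + of_real (1 - q) * F0)
    \<le> a\<^sup>2 * q * (((1 - q) ^ 3 + 2 * s * (1 - q)) * \<beta>) + a\<^sup>2 * (1 - q) * ((q ^ 3 + 2 * s * q) * \<beta>)"
    unfolding e1
  proof (intro order_trans[OF norm_triangle_ineq] add_mono)
    show "norm (complex_of_real (a\<^sup>2 * q) * (of_real ((1 - q) ^ 3) * w1 - of_real (s * (1 - q)) * (w1 + w1')))
      \<le> a\<^sup>2 * q * (((1 - q) ^ 3 + 2 * s * (1 - q)) * \<beta>)"
      unfolding norm_mult[of "complex_of_real (a\<^sup>2 * q)"] norm_of_real using q n1 by (simp add: abs_mult mult_left_mono del: of_real_power of_real_mult of_real_diff)
    show "norm (complex_of_real (a\<^sup>2 * (1 - q)) * (- of_real (q ^ 3) * w0 + of_real (s * q) * (w0 + w0')))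
      \<le> a\<^sup>2 * (1 - q) * ((q ^ 3 + 2 * s * q) * \<beta>)"
      unfolding norm_mult[of "complex_of_real (a\<^sup>2 * (1 - q))"] norm_of_real using q n0 by (simp add: abs_mult mult_left_mono del: of_real_power of_real_mult of_real_diff)
  qed
  also have "\<dots> = a\<^sup>2 * \<beta> * (q * ((1 - q) ^ 3 + 2 * s * (1 - q)) + (1 - q) * (q ^ 3 + 2 * s * q))"
    by (simp add: algebra_simps)
  also have "\<dots> \<le> a\<^sup>2 * \<beta> * (3 * s)"
    using two_point_moments(3)[OF q] b0 by (intro mult_left_mono) (auto simp: s_def)
  finally show ?thesis by (simp add: mult_ac)
qed

section \<open>Counting hyperedges through four vertices\<close>

lemma sum_of_bool_eq: fixes u n :: nat shows "u < n \<Longrightarrow> (\<Sum>x<n. of_bool (u = x) * f x) = (f u :: complex)"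
proof -
  assume "u < n"
  have "(\<Sum>x<n. of_bool (u = x) * f x) = (\<Sum>x<n. if x = u then f x else 0)"
    by (intro sum.cong) auto
  also have "\<dots> = f u" using \<open>u < n\<close> by (subst sum.delta) auto
  finally show ?thesis .
qed

lemma sum_of_bool_neq: fixes u n :: nat shows "u < n \<Longrightarrow> (\<Sum>x<n. of_bool (u \<noteq> x) * f x) = (\<Sum>x<n. f x) - (f u :: complex)"
proof -
  assume u: "u < n"
  have "(\<Sum>x<n. of_bool (u \<noteq> x) * f x) = (\<Sum>x<n. f x - of_bool (u = x) * f x)"
    by (intro sum.cong) auto
  also have "\<dots> = (\<Sum>x<n. f x) - f u" by (simp only: sum_subtractf sum_of_bool_eq[OF u])
  finally show ?thesis .
qed

text \<open>
  Inclusion-exclusion over the coincidences between the two pairs: two distinct pairs share at most one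
  vertex, and equal pairs are matched in one of two ways.
\<close>

lemma card_pairs_pattern:
  fixes c :: "nat \<Rightarrow> complex"
  assumes "u \<noteq> v" "w \<noteq> x"
  shows "c (card {u, v, w, x}) = c 4
    + (c 3 - c 4) * (of_bool (u = w) + of_bool (u = x) + of_bool (v = w) + of_bool (v = x))
    + (c 2 - 2 * c 3 + c 4) * (of_bool (u = w) * of_bool (v = x) + of_bool (u = x) * of_bool (v = w))"
  using assms by (auto simp: card_insert_if numeral_eq_Suc)

text \<open>
  With row sums zero, a sum over a free index that only has to avoid one value collapses to minus a
  single entry. Of the seven terms of the pattern only the one that pairs \<open>u\<close> with \<open>x\<close> and \<open>v\<close> with \<open>w\<close>
  produces \<open>(tr K)\<^sup>2\<close>; what is left are sums of squares of entries, which for a resolvent are of order \<open>n\<close> instead of \<open>n\<^sup>2\<close>.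
\<close>

lemma four_point_sum:
  fixes K :: "nat \<Rightarrow> nat \<Rightarrow> complex" and c :: "nat \<Rightarrow> complex"
  assumes sym: "\<And>i j. i < n \<Longrightarrow> j < n \<Longrightarrow> K i j = K j i"
    and zero: "\<And>i. i < n \<Longrightarrow> (\<Sum>j<n. K i j) = 0"
  shows "(\<Sum>u<n. \<Sum>v<n. \<Sum>w<n. \<Sum>x<n. of_bool (u \<noteq> v) * of_bool (w \<noteq> x) * c (card {u, v, w, x}) * (K v w * K x u))
    = (c 2 - 2 * c 3 + c 4) * ((tr n K)\<^sup>2 + (\<Sum>u<n. \<Sum>v<n. (K u v)\<^sup>2) - 2 * (\<Sum>u<n. (K u u)\<^sup>2))
      + c 4 * (\<Sum>u<n. \<Sum>v<n. (K u v)\<^sup>2) + 4 * (c 3 - c 4) * (\<Sum>u<n. (K u u)\<^sup>2)"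
proof -
  define b where "b u v = (of_bool (u \<noteq> v) :: complex)" for u v :: nat
  define d where "d u v = (of_bool (u = v) :: complex)" for u v :: nat
  have b_comm: "b u v = b v u" and d_comm: "d u v = d v u" for u v by (auto simp: b_def d_def)
  have sum_d: "(\<Sum>x<n. d u x * f x) = f u" if "u < n" for u f
    unfolding d_def by (rule sum_of_bool_eq[OF that])
  have sum_b: "(\<Sum>x<n. b u x * f x) = (\<Sum>x<n. f x) - f u" if "u < n" for u f
    unfolding b_def by (rule sum_of_bool_neq[OF that])
  have bb: "b u v * b u v * t = b u v * t" for u v t by (auto simp: b_def)
  define F where "F = (\<Sum>u<n. \<Sum>v<n. (K u v)\<^sup>2)"
  define D where "D = (\<Sum>u<n. (K u u)\<^sup>2)"
  have zero': "(\<Sum>j<n. K j i) = 0" if "i < n" for i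
  proof -
    have "(\<Sum>j<n. K j i) = (\<Sum>j<n. K i j)" by (intro sum.cong) (auto intro: sym that)
    then show ?thesis using zero[OF that] by simp
  qed
  have col: "(\<Sum>x<n. b u x * K x w) = - K u w" if "u < n" "w < n" for u w
    using that by (simp only: sum_b zero') simp
  have row: "(\<Sum>x<n. b u x * K w x) = - K w u" if "u < n" "w < n" for u w
    using that by (simp only: sum_b zero) simp
  let ?S = "\<lambda>g. (\<Sum>u<n. \<Sum>v<n. \<Sum>w<n. \<Sum>x<n. b u v * b w x * g u v w x * (K v w * K x u)) :: complex"
  have swp: "(\<Sum>v<n. \<Sum>w<n. f v w) = (\<Sum>w<n. \<Sum>v<n. f v w)" for f :: "nat \<Rightarrow> nat \<Rightarrow> complex" by (rule sum.swap)
  have S0: "?S (\<lambda>u v w x. 1) = F"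
  proof -
    have "?S (\<lambda>u v w x. 1) = (\<Sum>u<n. \<Sum>w<n. (\<Sum>v<n. b u v * K v w) * (\<Sum>x<n. b w x * K x u))"
      by (rule sum.cong[OF refl], rule trans[OF swp], rule sum.cong[OF refl], subst sum_product) (intro sum.cong refl, simp add: mult_ac b_comm d_comm)
    also have "\<dots> = F" unfolding F_def by (intro sum.cong refl) (simp only: col lessThan_iff, simp add: power2_eq_square sym)
    finally show ?thesis .
  qed
  have S1: "?S (\<lambda>u v w x. d u w) = D"
  proof -
    have "?S (\<lambda>u v w x. d u w) = (\<Sum>u<n. \<Sum>w<n. d u w * ((\<Sum>v<n. b u v * K v w) * (\<Sum>x<n. b w x * K x u)))"
      by (rule sum.cong[OF refl], rule trans[OF swp], rule sum.cong[OF refl], subst sum_product, simp only: sum_distrib_left) (intro sum.cong refl, simp add: mult_ac b_comm d_comm)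
    also have "\<dots> = D" unfolding D_def by (intro sum.cong refl) (simp only: sum_d col lessThan_iff, simp add: power2_eq_square)
    finally show ?thesis .
  qed
  have S2: "?S (\<lambda>u v w x. d u x) = D"
  proof -
    have "?S (\<lambda>u v w x. d u x) = (\<Sum>u<n. \<Sum>w<n. (\<Sum>v<n. b u v * K v w) * (\<Sum>x<n. d u x * (b w x * K x u)))"
      by (rule sum.cong[OF refl], rule trans[OF swp], rule sum.cong[OF refl], subst sum_product) (intro sum.cong refl, simp add: mult_ac b_comm d_comm)
    also have "\<dots> = (\<Sum>u<n. \<Sum>w<n. - K u u * (b u w * K u w))"
      by (intro sum.cong refl) (simp only: sum_d col lessThan_iff, simp add: mult_ac b_comm d_comm)
    also have "\<dots> = D" unfolding D_def sum_distrib_left[symmetric]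
      by (intro sum.cong refl) (simp only: row lessThan_iff, simp add: power2_eq_square)
    finally show ?thesis .
  qed
  have S3: "?S (\<lambda>u v w x. d v w) = D"
  proof -
    have "?S (\<lambda>u v w x. d v w) = (\<Sum>u<n. \<Sum>w<n. (\<Sum>v<n. d w v * (b u v * K v w)) * (\<Sum>x<n. b w x * K x u))"
      by (rule sum.cong[OF refl], rule trans[OF swp], rule sum.cong[OF refl], subst sum_product) (intro sum.cong refl, simp add: mult_ac b_comm d_comm)
    also have "\<dots> = (\<Sum>u<n. \<Sum>w<n. - K w w * (b w u * K w u))"
      by (intro sum.cong refl) (simp only: sum_d col lessThan_iff, simp add: mult_ac b_comm d_comm)
    also have "\<dots> = (\<Sum>w<n. \<Sum>u<n. - K w w * (b w u * K w u))" by (rule swp)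
    also have "\<dots> = D" unfolding D_def sum_distrib_left[symmetric]
      by (intro sum.cong refl) (simp only: row lessThan_iff, simp add: power2_eq_square)
    finally show ?thesis .
  qed
  have S4: "?S (\<lambda>u v w x. d v x) = D"
  proof -
    have "?S (\<lambda>u v w x. d v x) = (\<Sum>u<n. \<Sum>v<n. \<Sum>w<n. b v u * K v u * (b v w * K v w))"
    proof (intro sum.cong refl)
      fix u v w assume "u \<in> {..<n}" "v \<in> {..<n}" "w \<in> {..<n}"
      have "(\<Sum>x<n. b u v * b w x * d v x * (K v w * K x u))
          = (\<Sum>x<n. d v x * (b u v * b w x * (K v w * K x u)))"
        by (intro sum.cong refl) (simp add: mult_ac)
      also have "\<dots> = b u v * b w v * (K v w * K v u)"
        by (rule sum_d) (use \<open>v \<in> _\<close> in simp)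
      finally show "(\<Sum>x<n. b u v * b w x * d v x * (K v w * K x u))
          = b v u * K v u * (b v w * K v w)" by (simp add: mult_ac b_comm d_comm)
    qed
    also have "\<dots> = (\<Sum>v<n. \<Sum>u<n. \<Sum>w<n. b v u * K v u * (b v w * K v w))" by (rule swp)
    also have "\<dots> = (\<Sum>v<n. (\<Sum>u<n. b v u * K v u) * (\<Sum>w<n. b v w * K v w))"
      by (simp only: sum_product)
    also have "\<dots> = D" unfolding D_def by (intro sum.cong refl) (simp only: row lessThan_iff, simp add: power2_eq_square)
    finally show ?thesis .
  qed
  have S56: "?S (\<lambda>u v w x. d u w * d v x) = F - D"
    "?S (\<lambda>u v w x. d u x * d v w) = (tr n K)\<^sup>2 - D"
  proof -
    have "?S (\<lambda>u v w x. d u w * d v x) = (\<Sum>u<n. \<Sum>v<n. b u v * (K u v)\<^sup>2)"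
    proof (intro sum.cong refl)
      fix u v assume uv: "u \<in> {..<n}" "v \<in> {..<n}"
      have "(\<Sum>w<n. \<Sum>x<n. b u v * b w x * (d u w * d v x) * (K v w * K x u))
          = (\<Sum>w<n. d u w * (\<Sum>x<n. d v x * (b u v * b w x * (K v w * K x u))))"
        unfolding sum_distrib_left by (intro sum.cong refl) (simp add: mult_ac)
      also have "\<dots> = b u v * b u v * (K v u * K v u)"
        using uv by (simp only: sum_d lessThan_iff)
      finally show "(\<Sum>w<n. \<Sum>x<n. b u v * b w x * (d u w * d v x) * (K v w * K x u))
          = b u v * (K u v)\<^sup>2" using sym[of u v] uv by (simp add: bb power2_eq_square)
    qed
    also have "\<dots> = (\<Sum>u<n. (\<Sum>v<n. (K u v)\<^sup>2) - (K u u)\<^sup>2)"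
      by (intro sum.cong refl) (simp only: sum_b lessThan_iff)
    also have "\<dots> = F - D" by (simp add: F_def D_def sum_subtractf)
    finally show "?S (\<lambda>u v w x. d u w * d v x) = F - D" .
    have "?S (\<lambda>u v w x. d u x * d v w) = (\<Sum>u<n. \<Sum>v<n. b u v * (K u u * K v v))"
    proof (intro sum.cong refl)
      fix u v assume uv: "u \<in> {..<n}" "v \<in> {..<n}"
      have "(\<Sum>w<n. \<Sum>x<n. b u v * b w x * (d u x * d v w) * (K v w * K x u))
          = (\<Sum>w<n. d v w * (\<Sum>x<n. d u x * (b u v * b w x * (K v w * K x u))))"
        unfolding sum_distrib_left by (intro sum.cong refl) (simp add: mult_ac)
      also have "\<dots> = b u v * b v u * (K v v * K u u)"
        using uv by (simp only: sum_d lessThan_iff)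
      finally show "(\<Sum>w<n. \<Sum>x<n. b u v * b w x * (d u x * d v w) * (K v w * K x u))
          = b u v * (K u u * K v v)" unfolding b_comm[of v u] bb by (simp add: mult.commute)
    qed
    also have "\<dots> = (\<Sum>u<n. (\<Sum>v<n. K u u * K v v) - K u u * K u u)"
      by (intro sum.cong refl) (simp only: sum_b lessThan_iff)
    also have "\<dots> = (tr n K)\<^sup>2 - D"
      by (simp only: D_def sum_subtractf tr_def power2_eq_square sum_product)
    finally show "?S (\<lambda>u v w x. d u x * d v w) = (tr n K)\<^sup>2 - D" .
  qed
  have pat: "b u v * b w x * c (card {u, v, w, x}) * t
     = c 4 * (b u v * b w x * 1 * t)
     + (c 3 - c 4) * (b u v * b w x * d u w * t)
     + (c 3 - c 4) * (b u v * b w x * d u x * t)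
     + (c 3 - c 4) * (b u v * b w x * d v w * t)
     + (c 3 - c 4) * (b u v * b w x * d v x * t)
     + (c 2 - 2 * c 3 + c 4) * (b u v * b w x * (d u w * d v x) * t)
     + (c 2 - 2 * c 3 + c 4) * (b u v * b w x * (d u x * d v w) * t)"
    for u v w x :: nat and t :: complex
  proof (cases "u \<noteq> v \<and> w \<noteq> x")
    case True
    then have ne: "u \<noteq> v" "w \<noteq> x" by auto
    then have "b u v = 1" "b w x = 1" by (auto simp: b_def)
    then show ?thesis
      by (simp only: card_pairs_pattern[OF ne, of c, folded d_def]) (simp add: algebra_simps)
  qed (auto simp: b_def)
  have "(\<Sum>u<n. \<Sum>v<n. \<Sum>w<n. \<Sum>x<n. b u v * b w x * c (card {u, v, w, x}) * (K v w * K x u))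
     = c 4 * F + (c 3 - c 4) * D + (c 3 - c 4) * D + (c 3 - c 4) * D + (c 3 - c 4) * D
      + (c 2 - 2 * c 3 + c 4) * (F - D) + (c 2 - 2 * c 3 + c 4) * ((tr n K)\<^sup>2 - D)"
    unfolding pat sum.distrib sum_distrib_left[symmetric] S0 S1 S2 S3 S4 S56 ..
  then show ?thesis unfolding F_def[symmetric] D_def[symmetric] b_def[symmetric] by (simp add: algebra_simps)
qed

text \<open>
  The number of \<open>m\<close>-element sets of vertices that contain \<open>j\<close> given vertices.
\<close>

definition sup_count :: "nat \<Rightarrow> nat \<Rightarrow> nat \<Rightarrow> nat" where
  "sup_count n m j = (if j \<le> m then (n - j) choose (m - j) else 0)"

lemma card_supersets:
  assumes "S \<subseteq> {0..<n}"
  shows "card {e. e \<subseteq> {0..<n} \<and> card e = m \<and> S \<subseteq> e} = sup_count n m (card S)"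
proof (cases "card S \<le> m")
  case True
  have fS: "finite S" using assms finite_subset by blast
  have "bij_betw (\<lambda>e. e \<union> S) {d. d \<subseteq> {0..<n} - S \<and> card d = m - card S} {e. e \<subseteq> {0..<n} \<and> card e = m \<and> S \<subseteq> e}"
  proof (rule bij_betwI[where g = "\<lambda>e. e - S"])
    show "(\<lambda>e. e \<union> S) \<in> {d. d \<subseteq> {0..<n} - S \<and> card d = m - card S} \<rightarrow> {e. e \<subseteq> {0..<n} \<and> card e = m \<and> S \<subseteq> e}"
    proof
      fix d assume d: "d \<in> {d. d \<subseteq> {0..<n} - S \<and> card d = m - card S}"
      then have "finite d" "d \<inter> S = {}" using finite_subset[of d "{0..<n} - S"] by auto
      then have "card (d \<union> S) = m" using d True fS by (simp add: card_Un_disjoint)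
      then show "d \<union> S \<in> {e. e \<subseteq> {0..<n} \<and> card e = m \<and> S \<subseteq> e}" using d assms by auto
    qed
    show "(\<lambda>e. e - S) \<in> {e. e \<subseteq> {0..<n} \<and> card e = m \<and> S \<subseteq> e} \<rightarrow> {d. d \<subseteq> {0..<n} - S \<and> card d = m - card S}"
      using fS by (auto simp: card_Diff_subset)
  qed auto
  then have "card {e. e \<subseteq> {0..<n} \<and> card e = m \<and> S \<subseteq> e} = card {d. d \<subseteq> {0..<n} - S \<and> card d = m - card S}"
    by (simp add: bij_betw_same_card)
  also have "\<dots> = (n - card S) choose (m - card S)"
    using assms by (subst n_subsets) (auto simp: card_Diff_subset fS)
  finally show ?thesis using True by (simp add: sup_count_def)
next
  case False
  have "card S \<le> card e" if "e \<subseteq> {0..<n}" "S \<subseteq> e" for e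
    using that by (meson card_mono finite_atLeastLessThan finite_subset)
  then have "{e. e \<subseteq> {0..<n} \<and> card e = m \<and> S \<subseteq> e} = {}" using False by fastforce
  then show ?thesis using False by (simp add: sup_count_def)
qed

lemma sup_count_ratio:
  assumes m: "2 \<le> m" "m \<le> n" and n: "4 \<le> n"
  shows "real (sup_count n m 2) = real ((n - 2) choose (m - 2))"
    and "real (sup_count n m 3) = (real m - 2) / (real n - 2) * real ((n - 2) choose (m - 2))"
    and "real (sup_count n m 4) = (real m - 2) * (real m - 3) / ((real n - 2) * (real n - 3)) * real ((n - 2) choose (m - 2))"
proof -
  have absorb: "real b * real (a choose b) = real a * real ((a - 1) choose (b - 1))" if "0 < b" for a b
    using times_binomial_minus1_eq[OF that, of a] by (metis of_nat_mult)
  show "real (sup_count n m 2) = real ((n - 2) choose (m - 2))" using m by (simp add: sup_count_def)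
  have 3: "(real n - 2) * real (sup_count n m 3) = (real m - 2) * real ((n - 2) choose (m - 2))"
  proof (cases "m = 2")
    case False
    have "n - 2 - 1 = n - 3" "m - 2 - 1 = m - 3" "real (n - 2) = real n - 2" "real (m - 2) = real m - 2"
      using m n by (auto simp: of_nat_diff)
    then show ?thesis using absorb[of "m - 2" "n - 2"] m False by (simp add: sup_count_def)
  qed (simp add: sup_count_def)
  then show c3: "real (sup_count n m 3) = (real m - 2) / (real n - 2) * real ((n - 2) choose (m - 2))"
    using n by (simp add: field_simps)
  have 4: "(real n - 3) * real (sup_count n m 4) = (real m - 3) * real (sup_count n m 3)"
  proof (cases "m \<le> 3")
    case True
    then have "m = 2 \<or> m = 3" using m by auto
    then show ?thesis by (auto simp: sup_count_def)
  next
    case False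
    have "n - 3 - 1 = n - 4" "m - 3 - 1 = m - 4" "real (n - 3) = real n - 3" "real (m - 3) = real m - 3"
      using m n False by (auto simp: of_nat_diff)
    then show ?thesis using absorb[of "m - 3" "n - 3"] m False by (simp add: sup_count_def)
  qed
  then have "real (sup_count n m 4) = (real m - 3) / (real n - 3) * real (sup_count n m 3)"
    using n by (simp add: field_simps)
  then show "real (sup_count n m 4) = (real m - 2) * (real m - 3) / ((real n - 2) * (real n - 3)) * real ((n - 2) choose (m - 2))"
    unfolding c3 by (simp add: mult.commute mult.left_commute)
qed

lemma falling_ratio_bounds:
  fixes m n :: nat
  assumes "2 \<le> m" "m \<le> n" "4 \<le> n"
  shows "0 \<le> (real m - 2) / (real n - 2) \<and> (real m - 2) / (real n - 2) \<le> 1"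
    and "0 \<le> (real m - 2) * (real m - 3) / ((real n - 2) * (real n - 3))
      \<and> (real m - 2) * (real m - 3) / ((real n - 2) * (real n - 3)) \<le> 1"
proof -
  show \<alpha>: "0 \<le> (real m - 2) / (real n - 2) \<and> (real m - 2) / (real n - 2) \<le> 1"
    using assms by (auto simp: divide_simps)
  show "0 \<le> (real m - 2) * (real m - 3) / ((real n - 2) * (real n - 3))
      \<and> (real m - 2) * (real m - 3) / ((real n - 2) * (real n - 3)) \<le> 1"
  proof (cases "m = 2")
    case False
    define \<gamma> where "\<gamma> = (real m - 3) / (real n - 3)"
    have e: "(real m - 2) * (real m - 3) / ((real n - 2) * (real n - 3)) = (real m - 2) / (real n - 2) * \<gamma>"
      by (simp add: \<gamma>_def)
    have "0 \<le> \<gamma>" "\<gamma> \<le> 1"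
      using assms False by (auto simp: \<gamma>_def divide_simps)
    then show ?thesis
      unfolding e using \<alpha> by (intro conjI mult_nonneg_nonneg mult_le_one) auto
  qed simp
qed

lemma binomial_two_step:
  assumes m: "2 \<le> m" "m \<le> n"
  shows "real m * (real m - 1) * real (n choose m) = real n * (real n - 1) * real ((n - 2) choose (m - 2))"
proof -
  have absorb: "real b * real (a choose b) = real a * real ((a - 1) choose (b - 1))" if "0 < b" for a b
    using times_binomial_minus1_eq[OF that, of a] by (metis of_nat_mult)
  have e: "n - 1 - 1 = n - 2" "m - 1 - 1 = m - 2" "real (n - 1) = real n - 1" "real (m - 1) = real m - 1"
    using m by (auto simp: of_nat_diff)
  have "real m * real (n choose m) = real n * real ((n - 1) choose (m - 1))"
    using absorb[of m n] m by simp
  moreover have "(real m - 1) * real ((n - 1) choose (m - 1)) = (real n - 1) * real ((n - 2) choose (m - 2))"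
    using absorb[of "m - 1" "n - 1"] m unfolding e by simp
  ultimately show ?thesis by (metis mult.commute mult.left_commute)
qed

section \<open>The hypergraph matrix and its compression\<close>

text \<open>
  The random matrix for one fixed \<open>n\<close>. All estimates below are explicit in \<open>n\<close> and in the sizes, so that they
  can be used along the sequence of models.
\<close>

locale hypergraph_model =
  fixes k n :: nat and r :: "nat \<Rightarrow> nat" and p :: "nat \<Rightarrow> real"
  assumes n4: "4 \<le> n"
    and r: "\<And>i. i \<in> {1..k} \<Longrightarrow> 2 \<le> r i \<and> r i \<le> n"
    and p: "\<And>i. i \<in> {1..k} \<Longrightarrow> 0 \<le> p i \<and> p i \<le> 1"
    and var_pos: "total_var k n r p > 0"
begin

definition "L = potential_edges k n r"

definition a :: real where "a = 1 / sqrt (real n * total_var k n r p)"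

definition Q :: "nat \<times> nat set \<Rightarrow> nat \<Rightarrow> nat \<Rightarrow> real" where
  "Q l u v = of_bool (u \<noteq> v \<and> u \<in> snd l \<and> v \<in> snd l)"

text \<open>
  The orthogonal projection onto the complement of the constant vector.
\<close>

definition pj :: "nat \<Rightarrow> nat \<Rightarrow> real" where "pj u v = of_bool (u = v) - 1 / real n"

definition QP :: "nat \<times> nat set \<Rightarrow> nat \<Rightarrow> nat \<Rightarrow> real" where
  "QP l u v = (\<Sum>i<n. \<Sum>j<n. pj u i * Q l i j * pj j v)"

definition H :: "(nat \<times> nat set \<Rightarrow> real) \<Rightarrow> nat \<Rightarrow> nat \<Rightarrow> real" where
  "H x u v = a * (\<Sum>l\<in>L. x l * Q l u v)"

definition HP :: "(nat \<times> nat set \<Rightarrow> real) \<Rightarrow> nat \<Rightarrow> nat \<Rightarrow> real" where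
  "HP x u v = a * (\<Sum>l\<in>L. x l * QP l u v)"

definition X :: "(nat \<times> nat set \<Rightarrow> bool) \<Rightarrow> nat \<times> nat set \<Rightarrow> real" where
  "X h l = of_bool (h l) - p (fst l)"

abbreviation "\<Omega> \<equiv> Pi_pmf L False (\<lambda>l. bernoulli_pmf (p (fst l)))"

abbreviation "P \<equiv> cm n pj"

lemma n_pos: "0 < real n" using n4 by simp

lemma a_pos: "a > 0" and a_sq: "a\<^sup>2 = 1 / (real n * total_var k n r p)"
  using n4 var_pos by (auto simp: a_def power_divide real_sqrt_pow2)

lemma L_eq: "L = (SIGMA i:{1..k}. {e. e \<subseteq> {0..<n} \<and> card e = r i})"
  by (simp add: L_def potential_edges_def)

lemma finite_L [simp]: "finite L"
  unfolding L_eq by (intro finite_SigmaI) (auto intro: finite_subset[of _ "Pow {0..<n}"])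

lemma L_D: "l \<in> L \<Longrightarrow> fst l \<in> {1..k}" "l \<in> L \<Longrightarrow> snd l \<subseteq> {..<n}" "l \<in> L \<Longrightarrow> card (snd l) = r (fst l)"
  "l \<in> L \<Longrightarrow> finite (snd l)"
  unfolding L_eq by (auto intro: finite_subset[of _ "{0..<n}"])

lemma random_hypergraph_eq: "random_hypergraph k n r p = \<Omega>"
  proof -
  have "(\<lambda>(i, e :: nat set). bernoulli_pmf (p i)) = (\<lambda>l. bernoulli_pmf (p (fst l)))" by auto
  then show ?thesis by (simp add: random_hypergraph_def L_def)
qed

lemma symm_Q: "symm n (Q l)" by (auto simp: symm_def Q_def)

lemma pj_comm: "pj u v = pj v u" by (auto simp: pj_def)

lemma symm_QP: "symm n (QP l)"
  unfolding symm_def QP_def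
proof (intro allI impI)
  fix u v
  have "(\<Sum>i<n. \<Sum>j<n. pj u i * Q l i j * pj j v) = (\<Sum>j<n. \<Sum>i<n. pj u i * Q l i j * pj j v)"
    by (rule sum.swap)
  also have "\<dots> = (\<Sum>i<n. \<Sum>j<n. pj v i * Q l i j * pj j u)"
    using symm_Q[of l] by (intro sum.cong refl) (auto simp: symm_def pj_comm mult_ac)
  finally show "(\<Sum>i<n. \<Sum>j<n. pj u i * Q l i j * pj j v) = (\<Sum>i<n. \<Sum>j<n. pj v i * Q l i j * pj j u)" .
qed

lemma symm_H: "symm n (H x)"
  using symm_Q by (auto simp: symm_def H_def intro!: sum.cong)

lemma symm_HP: "symm n (HP x)"
  using symm_QP by (auto simp: symm_def HP_def intro!: sum.cong)

lemma sum_pj: "u < n \<Longrightarrow> (\<Sum>v<n. pj v u) = 0"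
  using n4 by (simp add: pj_def sum_subtractf sum.delta)

lemma cm_QP: "cm n (QP l) = mm n (mm n P (cm n (Q l))) P"
proof (intro ext)
  fix u v
  show "cm n (QP l) u v = mm n (mm n P (cm n (Q l))) P u v"
  proof (cases "u < n \<and> v < n")
    case True
    have "mm n (mm n P (cm n (Q l))) P u v = (\<Sum>j<n. \<Sum>i<n. of_real (pj u i * Q l i j * pj j v))"
      unfolding mm_def sum_distrib_right using True by (intro sum.cong refl) (simp add: cm_def)
    also have "\<dots> = (\<Sum>i<n. \<Sum>j<n. of_real (pj u i * Q l i j * pj j v))" by (rule sum.swap)
    finally show ?thesis using True by (simp add: cm_def QP_def)
  qed (auto simp: cm_def mm_def)
qed

lemma cm_HP: "cm n (HP x) = (\<lambda>i j. of_real a * (\<Sum>l\<in>L. of_real (x l) * cm n (QP l) i j))"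
  by (auto simp: cm_def HP_def fun_eq_iff)

lemma tr_QP: "tr n (mm n (cm n (QP l)) A) = tr n (mm n (cm n (Q l)) (mm n (mm n P A) P))"
  unfolding cm_QP by (simp only: mm_assoc tr_mm_comm[of n P]) 

text \<open>
  Products of matrices whose rows vanish outside \<open>e\<close> gain factors \<open>card e\<close> and not \<open>n\<close>.
\<close>

definition row_bd :: "nat set \<Rightarrow> real \<Rightarrow> (nat \<Rightarrow> nat \<Rightarrow> complex) \<Rightarrow> bool" where
  "row_bd e c A \<longleftrightarrow> (\<forall>u v. norm (A u v) \<le> c * of_bool (u \<in> e))"

lemma sum_of_bool_le_card:
  assumes "finite e"
  shows "(\<Sum>k<n. of_bool (k \<in> e) :: real) \<le> card e"
proof -
  have "(\<Sum>k<n. of_bool (k \<in> e) :: real) = real (card ({..<n} \<inter> e))"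
    by (simp add: sum.If_cases of_bool_def Int_def)
  also have "\<dots> \<le> card e" using assms by (simp add: card_mono)
  finally show ?thesis .
qed

lemma row_bd_mm:
  assumes A: "row_bd e c A" and B: "row_bd e d B" and "0 \<le> c" "0 \<le> d" "finite e"
  shows "row_bd e (real (card e) * (c * d)) (mm n A B)"
  unfolding row_bd_def
proof (intro allI)
  fix u v
  have "norm (mm n A B u v) \<le> (\<Sum>k<n. norm (A u k) * norm (B k v))"
    unfolding mm_def by (rule order_trans[OF norm_sum]) (simp add: norm_mult)
  also have "\<dots> \<le> (\<Sum>k<n. (c * of_bool (u \<in> e)) * (d * of_bool (k \<in> e)))"
    using assms by (intro sum_mono mult_mono) (auto simp: row_bd_def)
  also have "\<dots> = c * of_bool (u \<in> e) * d * (\<Sum>k<n. of_bool (k \<in> e))"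
    by (simp only: sum_distrib_left mult_ac)
  also have "\<dots> \<le> c * of_bool (u \<in> e) * d * card e"
    using assms by (intro mult_left_mono sum_of_bool_le_card) auto
  finally show "norm (mm n A B u v) \<le> real (card e) * (c * d) * of_bool (u \<in> e)"
    by (simp only: mult_ac)
qed

lemma row_bd_trace:
  assumes A: "row_bd e c A" and "0 \<le> c" "finite e"
  shows "norm (tr n A) \<le> real (card e) * c"
proof -
  have "norm (tr n A) \<le> (\<Sum>u<n. c * of_bool (u \<in> e))"
    unfolding tr_def using A by (intro order_trans[OF norm_sum] sum_mono) (auto simp: row_bd_def)
  also have "\<dots> = c * (\<Sum>k<n. of_bool (k \<in> e))" by (simp only: sum_distrib_left)
  also have "\<dots> \<le> c * card e"
    using assms by (intro mult_left_mono sum_of_bool_le_card) auto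
  finally show ?thesis by (simp only: mult.commute)
qed

lemma row_bd_Q:
  assumes l: "l \<in> L" and K: "\<And>u v. norm (K u v) \<le> \<kappa>"
  shows "row_bd (snd l) (real (r (fst l)) * \<kappa>) (mm n (cm n (Q l)) K)"
  unfolding row_bd_def
proof (intro allI)
  fix u v
  have k0: "0 \<le> \<kappa>" using K[of 0 0] norm_ge_zero order_trans by blast
  have "norm (mm n (cm n (Q l)) K u v) \<le> (\<Sum>k<n. norm (cm n (Q l) u k) * norm (K k v))"
    unfolding mm_def by (rule order_trans[OF norm_sum]) (simp add: norm_mult)
  also have "\<dots> \<le> (\<Sum>k<n. (of_bool (u \<in> snd l) * of_bool (k \<in> snd l)) * \<kappa>)"
    using K by (intro sum_mono mult_mono) (auto simp: cm_def Q_def)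
  also have "\<dots> = of_bool (u \<in> snd l) * \<kappa> * (\<Sum>k<n. of_bool (k \<in> snd l))"
    by (simp only: sum_distrib_left mult_ac)
  also have "(\<Sum>k<n. of_bool (k \<in> snd l) :: real) = real (card ({..<n} \<inter> snd l))"
    by (simp add: sum.If_cases of_bool_def Int_def)
  also have "{..<n} \<inter> snd l = snd l" using L_D(2)[OF l] by auto
  finally show "norm (mm n (cm n (Q l)) K u v) \<le> real (r (fst l)) * \<kappa> * of_bool (u \<in> snd l)"
    using L_D(3)[OF l] by (simp add: mult_ac)
qed

lemma trace_three_Q:
  assumes l: "l \<in> L" and K: "\<And>u v. norm (K0 u v) \<le> \<kappa>" "\<And>u v. norm (K1 u v) \<le> \<kappa>" "\<And>u v. norm (K2 u v) \<le> \<kappa>"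
  shows "norm (tr n (mm n (mm n (cm n (Q l)) K0) (mm n (mm n (cm n (Q l)) K1) (mm n (cm n (Q l)) K2))))
    \<le> real (r (fst l)) ^ 6 * \<kappa> ^ 3"
proof -
  let ?r = "real (r (fst l))"
  have k0: "0 \<le> \<kappa>" using K(1)[of 0 0] norm_ge_zero order_trans by blast
  note B = row_bd_Q[OF l K(1)] row_bd_Q[OF l K(2)] row_bd_Q[OF l K(3)]
  have 1: "row_bd (snd l) (?r * (?r * \<kappa> * (?r * \<kappa>))) (mm n (mm n (cm n (Q l)) K1) (mm n (cm n (Q l)) K2))"
    using row_bd_mm[OF B(2) B(3)] k0 L_D[OF l] by simp
  have 2: "row_bd (snd l) (?r * (?r * \<kappa> * (?r * (?r * \<kappa> * (?r * \<kappa>)))))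
      (mm n (mm n (cm n (Q l)) K0) (mm n (mm n (cm n (Q l)) K1) (mm n (cm n (Q l)) K2)))"
    using row_bd_mm[OF B(1) 1] k0 L_D[OF l] by simp
  have "norm (tr n (mm n (mm n (cm n (Q l)) K0) (mm n (mm n (cm n (Q l)) K1) (mm n (cm n (Q l)) K2))))
    \<le> ?r * (?r * (?r * \<kappa> * (?r * (?r * \<kappa> * (?r * \<kappa>)))))"
    using row_bd_trace[OF 2] k0 L_D[OF l] by simp
  also have "\<dots> = ?r ^ 6 * \<kappa> ^ 3" by (simp add: eval_nat_numeral mult_ac)
  finally show ?thesis .
qed

end

context hypergraph_model
begin

lemma finite_support: "finite (set_pmf \<Omega>)"
  by (rule finite_set_Pi_bernoulli) simp

lemma integrable_Omega [simp]:
  fixes f :: "_ \<Rightarrow> 'b :: {banach, second_countable_topology}"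
  shows "integrable (measure_pmf \<Omega>) f"
  by (rule integrable_measure_pmf_finite[OF finite_support])

abbreviation EV :: "((nat \<times> nat set \<Rightarrow> bool) \<Rightarrow> 'b :: {banach, second_countable_topology}) \<Rightarrow> 'b" where
  "EV f \<equiv> measure_pmf.expectation \<Omega> f"

lemma norm_EV_le:
  fixes f :: "_ \<Rightarrow> 'b :: {banach, second_countable_topology}"
  assumes "\<And>h. norm (f h) \<le> c"
  shows "norm (EV f) \<le> c"
proof -
  have "norm (EV f) \<le> EV (\<lambda>h. norm (f h))" by (rule integral_norm_bound)
  also have "\<dots> \<le> EV (\<lambda>h. c)" using assms by (intro integral_mono integrable_Omega) auto
  also have "\<dots> = c" by simp
  finally show ?thesis .
qed

lemma EV_resample:
  fixes f :: "_ \<Rightarrow> 'b :: {banach, second_countable_topology}"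
  assumes l: "l \<in> L"
  shows "EV f = EV (\<lambda>h. p (fst l) *\<^sub>R f (h(l := True)) + (1 - p (fst l)) *\<^sub>R f (h(l := False)))"
  using expectation_Pi_bernoulli_resample[where A = L and x = l and q = "\<lambda>l. p (fst l)" and f = f, OF finite_L l]
    p[OF L_D(1)[OF l]] by simp

lemma X_upd: "X (h(l := b)) = (X h)(l := of_bool b - p (fst l))"
  by (auto simp: X_def fun_eq_iff)

lemma EV_X: "l \<in> L \<Longrightarrow> EV (\<lambda>h. X h l) = 0"
  by (subst EV_resample[of l]) (auto simp: X_def algebra_simps)

lemma centered_indicators_eq:
  assumes "l \<in> L" shows "centered_indicators k n r p h l = X h l"
proof -
  have "EV (\<lambda>h'. of_bool (h' l) :: real) = p (fst l)"
    using assms by (subst EV_resample[of l]) auto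
  then show ?thesis by (simp add: centered_indicators_def random_hypergraph_eq X_def)
qed

lemma H_matrix_eq:
  "H_matrix k n r p (centered_indicators k n r p h) = Matrix.mat n n (\<lambda>(i, j). H (X h) i j)"
proof (rule eq_matI)
  fix i j assume ij: "i < dim_row (Matrix.mat n n (\<lambda>(i, j). H (X h) i j))" "j < dim_col (Matrix.mat n n (\<lambda>(i, j). H (X h) i j))"
  have "(\<Sum>l\<in>L. centered_indicators k n r p h l * edge_matrix n l $$ (i, j)) = (\<Sum>l\<in>L. X h l * Q l i j)"
    using ij by (intro sum.cong refl) (auto simp: centered_indicators_eq edge_matrix_def Q_def)
  then show "H_matrix k n r p (centered_indicators k n r p h) $$ (i, j) = Matrix.mat n n (\<lambda>(i, j). H (X h) i j) $$ (i, j)"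
    using ij by (simp add: H_matrix_def H_def L_def[symmetric] a_def)
qed (auto simp: H_matrix_def)

text \<open>
  The Efron-Stein inequality, which for linear functions of independent variables is an equality.
\<close>

lemma second_moment_linear:
  "EV (\<lambda>h. (\<Sum>l\<in>L. c l * X h l)\<^sup>2) \<le> (\<Sum>l\<in>L. edge_var p (fst l) * (c l)\<^sup>2)"
proof -
  let ?f = "\<lambda>h. \<Sum>l\<in>L. c l * X h l"
  have m: "EV ?f = 0" by (simp add: EV_X)
  have d: "?f (h(l := True)) - ?f (h(l := False)) = c l" if l: "l \<in> L" for l h
  proof -
    have "?f (h(l := True)) - ?f (h(l := False)) = (\<Sum>l'\<in>L. if l' = l then c l else 0)"
      unfolding sum_subtractf[symmetric] by (intro sum.cong refl) (auto simp: X_def algebra_simps)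
    then show ?thesis using l by simp
  qed
  have "EV (\<lambda>h. (?f h)\<^sup>2) - (EV ?f)\<^sup>2
    \<le> (\<Sum>l\<in>L. p (fst l) * (1 - p (fst l)) * EV (\<lambda>h. (?f (h(l := True)) - ?f (h(l := False)))\<^sup>2))"
    by (rule efron_stein_bernoulli) (use p L_D in auto)
  also have "\<dots> = (\<Sum>l\<in>L. edge_var p (fst l) * (c l)\<^sup>2)"
    by (intro sum.cong refl) (simp add: d edge_var_def)
  finally show ?thesis by (simp add: m)
qed

lemma sum_Q_row: "l \<in> L \<Longrightarrow> i < n \<Longrightarrow> (\<Sum>j<n. Q l i j) = (real (r (fst l)) - 1) * of_bool (i \<in> snd l)"
proof -
  assume l: "l \<in> L" and i: "i < n"
  have "(\<Sum>j<n. Q l i j) = of_bool (i \<in> snd l) * ((\<Sum>j<n. of_bool (j \<in> snd l)) - (\<Sum>j<n. if j = i then of_bool (i \<in> snd l) else 0))"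
    unfolding sum_subtractf[symmetric] sum_distrib_left by (intro sum.cong refl) (auto simp: Q_def)
  also have "(\<Sum>j<n. of_bool (j \<in> snd l) :: real) = real (card ({..<n} \<inter> snd l))"
    by (simp add: sum.If_cases of_bool_def Int_def)
  also have "{..<n} \<inter> snd l = snd l" using L_D(2)[OF l] by auto
  finally show ?thesis using L_D(3)[OF l] i by simp
qed

text \<open>
  The row sums of the uncompressed matrix. They measure how far \<open>H\<close> is from its compression.
\<close>

definition hv :: "(nat \<times> nat set \<Rightarrow> real) \<Rightarrow> nat \<Rightarrow> complex" where
  "hv x i = of_real (\<Sum>j<n. H x i j)"

lemma second_moment_hv:
  "EV (\<lambda>h. (vnorm n (hv (X h)))\<^sup>2) \<le> a\<^sup>2 * (\<Sum>l\<in>L. edge_var p (fst l) * ((real (r (fst l)) - 1)\<^sup>2 * real (r (fst l))))"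
proof -
  have hv: "(norm (hv x i))\<^sup>2 = (\<Sum>l\<in>L. a * ((real (r (fst l)) - 1) * of_bool (i \<in> snd l)) * x l)\<^sup>2" if i: "i < n" for x i
  proof -
    have "(\<Sum>j<n. H x i j) = a * (\<Sum>l\<in>L. x l * (\<Sum>j<n. Q l i j))"
      unfolding H_def sum_distrib_left[symmetric] by (subst sum.swap) (simp only: sum_distrib_left)
    also have "\<dots> = (\<Sum>l\<in>L. a * ((real (r (fst l)) - 1) * of_bool (i \<in> snd l)) * x l)"
    proof -
      have "(\<Sum>l\<in>L. x l * (\<Sum>j<n. Q l i j)) = (\<Sum>l\<in>L. x l * ((real (r (fst l)) - 1) * of_bool (i \<in> snd l)))"
        by (intro sum.cong refl) (simp only: sum_Q_row i)
      then show ?thesis by (simp only: sum_distrib_left mult_ac)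
    qed
    finally have e: "(\<Sum>j<n. H x i j) = (\<Sum>l\<in>L. a * ((real (r (fst l)) - 1) * of_bool (i \<in> snd l)) * x l)" .
    show ?thesis unfolding hv_def e norm_of_real power2_abs ..
  qed
  have "EV (\<lambda>h. (vnorm n (hv (X h)))\<^sup>2) = (\<Sum>i<n. EV (\<lambda>h. (norm (hv (X h) i))\<^sup>2))"
    unfolding vnorm_sq by (rule Bochner_Integration.integral_sum) simp
  also have "\<dots> \<le> (\<Sum>i<n. \<Sum>l\<in>L. edge_var p (fst l) * (a * ((real (r (fst l)) - 1) * of_bool (i \<in> snd l)))\<^sup>2)"
    by (intro sum_mono) (simp only: hv lessThan_iff second_moment_linear)
  also have "\<dots> = (\<Sum>l\<in>L. \<Sum>i<n. (edge_var p (fst l) * a\<^sup>2 * (real (r (fst l)) - 1)\<^sup>2) * of_bool (i \<in> snd l))"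
    by (subst sum.swap) (intro sum.cong refl, simp add: power_mult_distrib)
  also have "\<dots> = (\<Sum>l\<in>L. edge_var p (fst l) * a\<^sup>2 * (real (r (fst l)) - 1)\<^sup>2 * real (r (fst l)))"
  proof (intro sum.cong refl)
    fix l assume l: "l \<in> L"
    have "(\<Sum>j<n. of_bool (j \<in> snd l) :: real) = real (card ({..<n} \<inter> snd l))"
      by (simp add: sum.If_cases of_bool_def Int_def)
    also have "{..<n} \<inter> snd l = snd l" using L_D(2)[OF l] by auto
    finally show "(\<Sum>i<n. (edge_var p (fst l) * a\<^sup>2 * (real (r (fst l)) - 1)\<^sup>2) * of_bool (i \<in> snd l))
        = edge_var p (fst l) * a\<^sup>2 * (real (r (fst l)) - 1)\<^sup>2 * real (r (fst l))"
      unfolding sum_distrib_left[symmetric] using L_D(3)[OF l] by simp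
  qed
  also have "\<dots> = a\<^sup>2 * (\<Sum>l\<in>L. edge_var p (fst l) * ((real (r (fst l)) - 1)\<^sup>2 * real (r (fst l))))"
    unfolding sum_distrib_left by (intro sum.cong refl) (simp only: mult_ac)
  finally show ?thesis .
qed

lemma double_centering:
  assumes "u < n" "v < n"
  shows "(\<Sum>i<n. \<Sum>j<n. pj u i * M i j * pj j v)
    = M u v - (\<Sum>i<n. M i v) / real n - (\<Sum>j<n. M u j) / real n + (\<Sum>i<n. \<Sum>j<n. M i j) / (real n)\<^sup>2"
proof -
  have right: "(\<Sum>j<n. M i j * pj j v) = M i v - (\<Sum>j<n. M i j) / real n" for i
  proof -
    have "(\<Sum>j<n. M i j * pj j v) = (\<Sum>j<n. (if j = v then M i v else 0) - M i j / real n)"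
      by (intro sum.cong) (auto simp: pj_def algebra_simps)
    then show ?thesis using assms by (simp add: sum_subtractf sum_divide_distrib)
  qed
  have left: "(\<Sum>i<n. pj u i * f i) = f u - (\<Sum>i<n. f i) / real n" for f
  proof -
    have "(\<Sum>i<n. pj u i * f i) = (\<Sum>i<n. (if i = u then f u else 0) - f i / real n)"
      by (intro sum.cong) (auto simp: pj_def algebra_simps)
    then show ?thesis using assms by (simp add: sum_subtractf sum_divide_distrib)
  qed
  have "(\<Sum>i<n. \<Sum>j<n. pj u i * M i j * pj j v) = (\<Sum>i<n. pj u i * (\<Sum>j<n. M i j * pj j v))"
    by (simp add: sum_distrib_left mult.assoc)
  also have "\<dots> = M u v - (\<Sum>j<n. M u j) / real n - (\<Sum>i<n. M i v - (\<Sum>j<n. M i j) / real n) / real n"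
    unfolding right left ..
  finally show ?thesis
    by (simp add: sum_subtractf sum_divide_distrib[symmetric] diff_divide_distrib power2_eq_square)
qed

lemma HP_eq_proj: "HP x u v = (\<Sum>i<n. \<Sum>j<n. pj u i * H x i j * pj j v)"
proof -
  have "(\<Sum>i<n. \<Sum>j<n. pj u i * H x i j * pj j v)
    = (\<Sum>i<n. \<Sum>j<n. \<Sum>l\<in>L. a * (x l * (pj u i * Q l i j * pj j v)))"
    unfolding H_def sum_distrib_left sum_distrib_right by (intro sum.cong refl) (simp only: mult_ac)
  also have "\<dots> = (\<Sum>i<n. \<Sum>l\<in>L. \<Sum>j<n. a * (x l * (pj u i * Q l i j * pj j v)))"
    by (intro sum.cong refl sum.swap)
  also have "\<dots> = (\<Sum>l\<in>L. \<Sum>i<n. \<Sum>j<n. a * (x l * (pj u i * Q l i j * pj j v)))"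
    by (rule sum.swap)
  finally show ?thesis unfolding HP_def QP_def by (simp only: sum_distrib_left)
qed

lemma HP_row_sum: "i < n \<Longrightarrow> (\<Sum>j<n. HP x i j) = 0"
proof -
  have "(\<Sum>v<n. HP x i v) = (\<Sum>u<n. \<Sum>j<n. pj i u * H x u j * (\<Sum>v<n. pj j v))"
    unfolding HP_eq_proj sum_distrib_left
    by (rule trans[OF sum.swap], rule sum.cong[OF refl], rule sum.swap)
  also have "\<dots> = 0"
    by (intro sum.neutral ballI) (use sum_pj in \<open>simp add: pj_comm\<close>)
  finally show ?thesis .
qed

end

section \<open>Integration by parts in one hyperedge\<close>

context hypergraph_model
begin

context
  fixes z :: complex
  assumes z: "Im z > 0"
begin

abbreviation "G x \<equiv> res n (HP x) z"

text \<open>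
  The compressed resolvent. The constant vector is an eigenvector of \<open>G\<close> with eigenvalue \<open>- 1 / z\<close>, so the
  compression only adds the small constant \<open>1 / (n z)\<close> to all entries.
\<close>

definition K :: "(nat \<times> nat set \<Rightarrow> real) \<Rightarrow> nat \<Rightarrow> nat \<Rightarrow> complex" where
  "K x = mm n (mm n P (G x)) P"

lemma z_nz: "z \<noteq> 0" using z by auto

lemma Im_le_norm: "Im z \<le> norm z" using abs_Im_le_cmod[of z] by simp

lemma G_row_sum: "i < n \<Longrightarrow> (\<Sum>j<n. G x i j) = - 1 / z"
proof -
  assume i: "i < n"
  have 0: "mv n (cm n (HP x)) (\<lambda>_. 1) = (\<lambda>_. 0)"
  proof
    fix i
    show "mv n (cm n (HP x)) (\<lambda>_. 1) i = 0"
    proof (cases "i < n")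
      case True
      then have "mv n (cm n (HP x)) (\<lambda>_. 1) i = of_real (\<Sum>j<n. HP x i j)"
        by (simp add: mv_def cm_def)
      then show ?thesis using HP_row_sum[OF True] by simp
    qed (simp add: mv_def cm_def)
  qed
  have "mv n (mm n (G x) (cm n (HP x))) (\<lambda>_. 1) i = 0"
    unfolding mv_mm 0 by (simp add: mv_def)
  moreover have "mv n (mm n (G x) (cm n (HP x))) (\<lambda>_. 1) i = z * (\<Sum>j<n. G x i j) + (\<Sum>j<n. if j = i then 1 else 0)"
    unfolding res_left[OF symm_HP z] mv_def sum_distrib_left sum.distrib[symmetric]
    using i by (intro sum.cong refl) (auto simp: idn_def)
  ultimately have "z * (\<Sum>j<n. G x i j) + 1 = 0" using i by simp
  then have "z * (\<Sum>j<n. G x i j) = - 1" by (simp add: add_eq_0_iff2)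
  then show ?thesis using z_nz by (simp add: field_simps)
qed

lemma G_sym: "G x i j = G x j i" by (rule res_symmetric[OF symm_HP z])

lemma G_col_sum: "i < n \<Longrightarrow> (\<Sum>j<n. G x j i) = - 1 / z"
  using G_row_sum[of i x] by (subst G_sym)

lemma K_eq: "K x u v = (if u < n \<and> v < n then G x u v + 1 / (of_nat n * z) else 0)"
proof (cases "u < n \<and> v < n")
  case True
  have PG: "mm n P (G x) u j = G x u j + 1 / (of_nat n * z)" if "j < n" for j
  proof -
    have "mm n P (G x) u j = (\<Sum>i<n. (if i = u then G x u j else 0) - G x i j / of_nat n)"
      unfolding mm_def using True by (intro sum.cong refl) (auto simp: cm_def pj_def algebra_simps)
    also have "\<dots> = G x u j - (\<Sum>i<n. G x i j) / of_nat n"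
      using True by (simp add: sum_subtractf sum_divide_distrib)
    finally show ?thesis using G_col_sum[OF that] by (simp add: mult.commute)
  qed
  have "K x u v = (\<Sum>j<n. (if j = v then G x u v + 1 / (of_nat n * z) else 0) - (G x u j + 1 / (of_nat n * z)) / of_nat n)"
    unfolding K_def mm_def[of n "mm n P (G x)"] using True
    by (intro sum.cong refl) (auto simp: PG cm_def pj_def algebra_simps add_divide_distrib)
  also have "\<dots> = G x u v + 1 / (of_nat n * z) - ((\<Sum>j<n. G x u j) + of_nat n * (1 / (of_nat n * z))) / of_nat n"
    using True by (simp add: sum_subtractf sum_divide_distrib[symmetric] sum.distrib)
  also have "(\<Sum>j<n. G x u j) + of_nat n * (1 / (of_nat n * z)) = 0"
    using G_row_sum[of u x] True n_pos z_nz by simp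
  finally show ?thesis using True by simp
qed (auto simp: K_def mm_def cm_def)

lemma K_sym: "K x i j = K x j i" by (simp add: K_eq G_sym[of x i j])

lemma K_row_sum: "i < n \<Longrightarrow> (\<Sum>j<n. K x i j) = 0"
proof -
  assume i: "i < n"
  have "(\<Sum>j<n. K x i j) = (\<Sum>j<n. G x i j + 1 / (of_nat n * z))"
    using i by (intro sum.cong refl) (simp add: K_eq)
  then show ?thesis using G_row_sum[OF i] n_pos z_nz by (simp add: sum.distrib)
qed

lemma shift_bound: "norm (1 / (of_nat n * z)) \<le> 1 / (real n * Im z)"
  using Im_le_norm z n_pos by (simp add: norm_divide norm_mult frac_le)

lemma shift_bound': "norm (1 / (of_nat n * z)) \<le> 1 / Im z"
proof -
  have "1 / (real n * Im z) \<le> 1 / Im z"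
    using n4 z by (intro divide_left_mono mult_pos_pos) auto
  then show ?thesis using shift_bound by linarith
qed

lemma norm_K_le: "norm (K x u v) \<le> 2 / Im z"
proof (cases "u < n \<and> v < n")
  case True
  have "norm (K x u v) \<le> norm (G x u v) + norm (1 / (of_nat n * z))"
    using True unfolding K_eq by (simp only: if_True simp_thms) (rule norm_triangle_ineq)
  also have "\<dots> \<le> 1 / Im z + 1 / Im z"
    by (intro add_mono norm_res_le[OF symm_HP z] shift_bound')
  finally show ?thesis by simp
qed (use z in \<open>auto simp: K_eq\<close>)

lemma tr_K: "tr n (K x) = tr n (G x) + 1 / z"
proof -
  have "tr n (K x) = (\<Sum>i<n. G x i i + 1 / (of_nat n * z))"
    unfolding tr_def by (intro sum.cong refl) (simp add: K_eq)
  then show ?thesis using n_pos by (simp add: sum.distrib tr_def)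
qed

lemma norm_tr_G_le: "norm (tr n (G x)) \<le> real n / Im z"
proof -
  have "norm (tr n (G x)) \<le> (\<Sum>i<n. 1 / Im z)"
    unfolding tr_def by (intro order_trans[OF norm_sum] sum_mono norm_res_le[OF symm_HP z])
  then show ?thesis by simp
qed

lemma sum_sq_K: "(\<Sum>u<n. \<Sum>v<n. (norm (K x u v))\<^sup>2) \<le> 4 * real n / (Im z)\<^sup>2"
proof -
  have row: "(\<Sum>v<n. (norm (K x u v))\<^sup>2) \<le> 4 / (Im z)\<^sup>2" if u: "u < n" for u
  proof -
    have "(\<Sum>v<n. (norm (K x u v))\<^sup>2) \<le> (\<Sum>v<n. 2 * (norm (G x u v))\<^sup>2 + 2 * (1 / (real n * Im z))\<^sup>2)"
    proof (intro sum_mono)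
      fix v assume v: "v \<in> {..<n}"
      have "norm (K x u v) \<le> norm (G x u v) + norm (1 / (of_nat n * z))"
        using u v unfolding K_eq by (simp only: if_True simp_thms lessThan_iff) (rule norm_triangle_ineq)
      then have "norm (K x u v) \<le> norm (G x u v) + 1 / (real n * Im z)" using shift_bound by linarith
      then have "(norm (K x u v))\<^sup>2 \<le> (norm (G x u v) + 1 / (real n * Im z))\<^sup>2"
        by (rule power_mono) simp
      also have "\<dots> \<le> 2 * (norm (G x u v))\<^sup>2 + 2 * (1 / (real n * Im z))\<^sup>2"
        using sum_squares_bound[of "norm (G x u v)" "1 / (real n * Im z)"] by (simp add: power2_sum)
      finally show "(norm (K x u v))\<^sup>2 \<le> 2 * (norm (G x u v))\<^sup>2 + 2 * (1 / (real n * Im z))\<^sup>2" .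
    qed
    also have "\<dots> = 2 * (vnorm n (\<lambda>v. G x u v))\<^sup>2 + real n * (2 * (1 / (real n * Im z))\<^sup>2)"
      by (simp add: sum.distrib vnorm_sq sum_distrib_left)
    also have "\<dots> \<le> 2 * (1 / Im z)\<^sup>2 + 2 * (1 / Im z)\<^sup>2"
    proof (intro add_mono mult_left_mono power_mono)
      show "vnorm n (\<lambda>v. G x u v) \<le> 1 / Im z"
        using vnorm_res_row[OF symm_HP z, of x u] z by (simp add: field_simps)
      have "real n * (2 * (1 / (real n * Im z))\<^sup>2) = (2 * (1 / Im z)\<^sup>2) / real n"
        using n_pos by (simp add: power2_eq_square field_simps)
      also have "\<dots> \<le> (2 * (1 / Im z)\<^sup>2) / 1" using n4 by (intro divide_left_mono) auto
      finally show "real n * (2 * (1 / (real n * Im z))\<^sup>2) \<le> 2 * (1 / Im z)\<^sup>2" by simp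
    qed auto
    also have "\<dots> = 4 / (Im z)\<^sup>2" by (simp add: power_divide)
    finally show ?thesis .
  qed
  have "(\<Sum>u<n. \<Sum>v<n. (norm (K x u v))\<^sup>2) \<le> (\<Sum>u<n. 4 / (Im z)\<^sup>2)"
    by (intro sum_mono row) simp
  then show ?thesis by (simp add: mult.commute)
qed

abbreviation "T l x \<equiv> mm n (cm n (QP l)) (G x)"

lemma HP_remove:
  assumes l: "l \<in> L"
  shows "HP (x(l := t)) i j - HP x i j = a * (t - x l) * QP l i j"
proof -
  have "(\<Sum>l'\<in>L. (x(l := t)) l' * QP l' i j) - (\<Sum>l'\<in>L. x l' * QP l' i j)
      = (\<Sum>l'\<in>L. if l' = l then (t - x l) * QP l i j else 0)"
    unfolding sum_subtractf[symmetric] by (intro sum.cong refl) (auto simp: algebra_simps)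
  also have "\<dots> = (t - x l) * QP l i j" using l by simp
  finally show ?thesis unfolding HP_def by (simp add: right_diff_distrib[symmetric])
qed

lemma cm_scale: "cm n (\<lambda>i j. c * M i j) = (\<lambda>i j. of_real c * cm n M i j)"
  by (auto simp: cm_def fun_eq_iff)

lemma G_remove:
  assumes l: "l \<in> L"
  shows "G x i j - G (x(l := t)) i j = of_real (a * (t - x l)) * mm n (mm n (G (x(l := t))) (cm n (QP l))) (G x) i j"
  using res_diff[OF symm_HP symm_HP z, of x i j "x(l := t)"]
  unfolding HP_remove[OF l] cm_scale mm_scale_left mm_scale_right by simp

lemma T_remove:
  assumes l: "l \<in> L"
  shows "T l x = (\<lambda>i j. T l (x(l := 0)) i j - of_real (a * x l) * mm n (T l (x(l := 0))) (T l x) i j)"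
proof -
  have "G x = (\<lambda>i j. G (x(l := 0)) i j - of_real (a * x l) * mm n (mm n (G (x(l := 0))) (cm n (QP l))) (G x) i j)"
    (is "_ = ?R")
  proof (intro ext)
    fix i j
    show "G x i j = ?R i j" using G_remove[OF l, of x i j 0] by (simp add: algebra_simps)
  qed
  then have "T l x = mm n (cm n (QP l)) ?R" by simp
  also have "\<dots> = (\<lambda>i j. T l (x(l := 0)) i j - of_real (a * x l) * mm n (T l (x(l := 0))) (T l x) i j)"
    unfolding mm_diff_right mm_scale_right by (simp only: mm_assoc)
  finally show ?thesis .
qed

text \<open>
  Both traces as polynomials in the weight of the hyperedge \<open>l\<close>, with coefficients that do not depend
  on it except for the remainders of order three in the matrices.
\<close>

lemma trace_expansions:
  fixes x :: "nat \<times> nat set \<Rightarrow> real"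
  assumes l: "l \<in> L"
  defines "y \<equiv> of_real (a * x l)" and "T0 \<equiv> T l (x(l := 0))"
  shows "tr n (T l x) = tr n T0 - y * tr n (mm n T0 T0) + y\<^sup>2 * tr n (mm n T0 (mm n T0 (T l x)))"
    and "tr n (mm n (T l x) (T l x)) = tr n (mm n T0 T0)
      - y * (tr n (mm n T0 (mm n T0 (T l x))) + tr n (mm n T0 (mm n (T l x) (T l x))))"
proof -
  note R = T_remove[OF l, of x, folded y_def T0_def]
  have t1: "tr n (T l x) = tr n T0 - y * tr n (mm n T0 (T l x))"
    by (subst R) (simp only: tr_diff tr_scale)
  have R2: "mm n T0 (T l x) = (\<lambda>i j. mm n T0 T0 i j - y * mm n T0 (mm n T0 (T l x)) i j)"
    by (subst R) (simp only: mm_diff_right mm_scale_right)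
  have t2: "tr n (mm n T0 (T l x)) = tr n (mm n T0 T0) - y * tr n (mm n T0 (mm n T0 (T l x)))"
    by (subst R2) (simp only: tr_diff tr_scale)
  show "tr n (T l x) = tr n T0 - y * tr n (mm n T0 T0) + y\<^sup>2 * tr n (mm n T0 (mm n T0 (T l x)))"
    unfolding t1 t2 by (simp add: algebra_simps power2_eq_square)
  have "mm n (T l x) (T l x) = mm n (\<lambda>i j. T0 i j - y * mm n T0 (T l x) i j) (T l x)"
    by (subst (1) R) (rule refl)
  also have "\<dots> = (\<lambda>i j. mm n T0 (T l x) i j - y * mm n T0 (mm n (T l x) (T l x)) i j)"
    unfolding mm_diff_left mm_scale_left by (simp only: mm_assoc)
  finally have R3: "mm n (T l x) (T l x) = (\<lambda>i j. mm n T0 (T l x) i j - y * mm n T0 (mm n (T l x) (T l x)) i j)" .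
  show "tr n (mm n (T l x) (T l x)) = tr n (mm n T0 T0)
      - y * (tr n (mm n T0 (mm n T0 (T l x))) + tr n (mm n T0 (mm n (T l x) (T l x))))"
    by (subst R3) (simp only: tr_diff tr_scale t2 right_diff_distrib distrib_left diff_diff_eq)
qed

lemma tr_TT: "tr n (mm n (T l x) (T l x)) = tr n (mm n (mm n (cm n (Q l)) (K x)) (mm n (cm n (Q l)) (K x)))"
proof -
  have "tr n (mm n (T l x) (T l x)) = tr n (mm n (cm n (QP l)) (mm n (G x) (mm n (cm n (QP l)) (G x))))"
    by (simp only: mm_assoc)
  also have "\<dots> = tr n (mm n (cm n (Q l)) (mm n (mm n P (mm n (G x) (mm n (cm n (QP l)) (G x)))) P))"
    by (rule tr_QP)
  also have "\<dots> = tr n (mm n (mm n (cm n (Q l)) (K x)) (mm n (cm n (Q l)) (K x)))"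
    unfolding K_def cm_QP by (simp only: mm_assoc)
  finally show ?thesis .
qed

lemma tr_TTT: "tr n (mm n (T l x0) (mm n (T l x1) (T l x2)))
  = tr n (mm n (mm n (cm n (Q l)) (K x0)) (mm n (mm n (cm n (Q l)) (K x1)) (mm n (cm n (Q l)) (K x2))))"
proof -
  have "tr n (mm n (T l x0) (mm n (T l x1) (T l x2)))
    = tr n (mm n (cm n (QP l)) (mm n (G x0) (mm n (cm n (QP l)) (mm n (G x1) (mm n (cm n (QP l)) (G x2))))))"
    by (simp only: mm_assoc)
  also have "\<dots> = tr n (mm n (cm n (Q l)) (mm n (mm n P (mm n (G x0) (mm n (cm n (QP l)) (mm n (G x1) (mm n (cm n (QP l)) (G x2)))))) P))"
    by (rule tr_QP)
  also have "\<dots> = tr n (mm n (mm n (cm n (Q l)) (K x0)) (mm n (mm n (cm n (Q l)) (K x1)) (mm n (cm n (Q l)) (K x2))))"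
    unfolding K_def cm_QP by (simp only: mm_assoc)
  finally show ?thesis .
qed

lemma norm_tr_TTT: "l \<in> L \<Longrightarrow> norm (tr n (mm n (T l x0) (mm n (T l x1) (T l x2)))) \<le> real (r (fst l)) ^ 6 * (2 / Im z) ^ 3"
  unfolding tr_TTT by (rule trace_three_Q) (auto intro: norm_K_le)

text \<open>
  Conditionally on all other hyperedges this is \<open>two_point_ibp\<close>.
\<close>

lemma ibp_edge:
  assumes l: "l \<in> L"
  shows "norm (EV (\<lambda>h. of_real (X h l) * tr n (T l (X h)) + of_real (a * edge_var p (fst l)) * tr n (mm n (T l (X h)) (T l (X h)))))
    \<le> 3 * a\<^sup>2 * edge_var p (fst l) * (real (r (fst l)) ^ 6 * (2 / Im z) ^ 3)"
proof -
  define q where "q = p (fst l)"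
  have q: "0 \<le> q" "q \<le> 1" using p[OF L_D(1)[OF l]] by (auto simp: q_def)
  define F where "F h = of_real (X h l) * tr n (T l (X h)) + of_real (a * edge_var p (fst l)) * tr n (mm n (T l (X h)) (T l (X h)))" for h
  have "norm (q *\<^sub>R F (h(l := True)) + (1 - q) *\<^sub>R F (h(l := False)))
      \<le> 3 * a\<^sup>2 * edge_var p (fst l) * (real (r (fst l)) ^ 6 * (2 / Im z) ^ 3)" for h
  proof -
    \<comment> \<open>Setting the centred indicator to \<open>0\<close>, which need not be one of its values, removes its term.\<close>
    define x0 where "x0 = (X h)(l := 0)"
    define x1 where "x1 b = X (h(l := b))" for b
    have x1: "x1 b l = of_bool b - q" "(x1 b)(l := 0) = x0" for b
      by (auto simp: x1_def x0_def X_upd q_def)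
    define T0 where "T0 = T l x0"
    have F: "F (h(l := b)) = of_real (of_bool b - q) * (tr n T0 - of_real (a * (of_bool b - q)) * tr n (mm n T0 T0)
          + (of_real (a * (of_bool b - q)))\<^sup>2 * tr n (mm n T0 (mm n T0 (T l (x1 b)))))
        + of_real (a * (q * (1 - q))) * (tr n (mm n T0 T0) - of_real (a * (of_bool b - q))
          * (tr n (mm n T0 (mm n T0 (T l (x1 b)))) + tr n (mm n T0 (mm n (T l (x1 b)) (T l (x1 b))))))" for b
    proof -
      have "F (h(l := b)) = of_real (x1 b l) * tr n (T l (x1 b)) + of_real (a * edge_var p (fst l)) * tr n (mm n (T l (x1 b)) (T l (x1 b)))"
        by (simp only: F_def x1_def)
      also have "edge_var p (fst l) = q * (1 - q)" by (simp only: edge_var_def q_def)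
      finally show ?thesis
        unfolding trace_expansions[OF l, of "x1 b"] x1 T0_def[symmetric] .
    qed
    have "norm (of_real q * F (h(l := True)) + of_real (1 - q) * F (h(l := False)))
        \<le> 3 * a\<^sup>2 * (q * (1 - q)) * (real (r (fst l)) ^ 6 * (2 / Im z) ^ 3)"
      by (rule two_point_ibp[where ?t1.0 = "tr n T0" and ?t2.0 = "tr n (mm n T0 T0)"
            and ?w1.0 = "tr n (mm n T0 (mm n T0 (T l (x1 True))))" and w1' = "tr n (mm n T0 (mm n (T l (x1 True)) (T l (x1 True))))"
            and ?w0.0 = "tr n (mm n T0 (mm n T0 (T l (x1 False))))" and w0' = "tr n (mm n T0 (mm n (T l (x1 False)) (T l (x1 False))))"])
         (use q a_pos F[of True] F[of False] in \<open>auto simp: T0_def intro!: norm_tr_TTT[OF l] simp del: of_real_mult of_real_minus of_real_diff\<close>)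
    then show ?thesis by (simp add: scaleR_conv_of_real edge_var_def q_def)
  qed
  then show ?thesis
    unfolding F_def[symmetric] by (subst EV_resample[OF l, of F]) (rule norm_EV_le, simp add: q_def)
qed

end

end

section \<open>Concentration and the cost of the compression\<close>

context hypergraph_model
begin

lemma sum_over_subset:
  fixes f :: "nat \<Rightarrow> 'b :: comm_ring_1"
  assumes "e \<subseteq> {..<n}"
  shows "(\<Sum>u<n. of_bool (u \<in> e) * f u) = (\<Sum>u\<in>e. f u)"
proof -
  have "(\<Sum>u<n. of_bool (u \<in> e) * f u) = (\<Sum>u<n. if u \<in> e then f u else 0)"
    by (intro sum.cong) auto
  also have "\<dots> = (\<Sum>u\<in>{..<n} \<inter> e. f u)" by (simp add: sum.inter_restrict)
  also have "{..<n} \<inter> e = e" using assms by auto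
  finally show ?thesis .
qed

definition pvec :: "nat set \<Rightarrow> nat \<Rightarrow> complex" where "pvec S c = (\<Sum>v\<in>S. P v c)"

lemma pvec_eq:
  assumes "S \<subseteq> {..<n}" "c < n"
  shows "pvec S c = of_real (of_bool (c \<in> S) - real (card S) / real n)"
proof -
  have fS: "finite S" using assms finite_subset by blast
  have "pvec S c = of_real (\<Sum>v\<in>S. (if v = c then 1 else 0) - 1 / real n)"
    unfolding pvec_def of_real_sum using assms by (intro sum.cong) (auto simp: cm_def pj_def)
  also have "(\<Sum>v\<in>S. (if v = c then 1 else 0) - 1 / real n) = of_bool (c \<in> S) - real (card S) / real n"
    using fS by (simp add: sum_subtractf)
  finally show ?thesis .
qed

lemma vnorm_pvec:
  assumes S: "S \<subseteq> {..<n}"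
  shows "(vnorm n (pvec S))\<^sup>2 \<le> card S"
proof -
  have "(vnorm n (pvec S))\<^sup>2 = (\<Sum>c<n. of_bool (c \<in> S) * (1 - 2 * (real (card S) / real n)) + (real (card S) / real n)\<^sup>2)"
    unfolding vnorm_sq
  proof (intro sum.cong refl)
    fix c assume "c \<in> {..<n}"
    then have "norm (pvec S c) = \<bar>of_bool (c \<in> S) - real (card S) / real n\<bar>"
      using S by (simp only: pvec_eq lessThan_iff norm_of_real)
    then show "(norm (pvec S c))\<^sup>2 = of_bool (c \<in> S) * (1 - 2 * (real (card S) / real n)) + (real (card S) / real n)\<^sup>2"
      by (auto simp: power2_diff)
  qed
  also have "\<dots> = real (card S) * (1 - 2 * (real (card S) / real n)) + real n * (real (card S) / real n)\<^sup>2"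
    by (simp only: sum.distrib sum_over_subset[OF S]) simp
  also have "\<dots> = real (card S) - (real (card S))\<^sup>2 / real n"
    using n_pos by (simp add: field_simps power2_eq_square)
  also have "\<dots> \<le> card S" by simp
  finally show ?thesis .
qed

context
  fixes z :: complex
  assumes z: "Im z > 0"
begin

lemma block_sum:
  fixes S :: "nat set" and x1 x2 :: "nat \<times> nat set \<Rightarrow> real"
  assumes S: "S \<subseteq> {..<n}"
  defines "M \<equiv> mm n (mm n P (mm n (G z x2) (G z x1))) P"
  shows "norm (\<Sum>u\<in>S. \<Sum>v\<in>S. M v u) \<le> card S / (Im z)\<^sup>2"
proof -
  have P_comm: "P i j = P j i" for i j by (auto simp: cm_def pj_comm)
  have M: "M v u = (\<Sum>b<n. mm n P (G z x2) v b * mm n (G z x1) P b u)" for u v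
  proof -
    have "M = mm n (mm n P (G z x2)) (mm n (G z x1) P)" unfolding M_def by (simp only: mm_assoc)
    then show ?thesis by (simp add: mm_def)
  qed
  have vr: "vnorm n (mv n (G z x) v) \<le> vnorm n v / Im z" for x v
    using vnorm_res[OF symm_HP z, of x v] z by (simp add: pos_le_divide_eq mult.commute)
  have left: "(\<Sum>v\<in>S. mm n P (G z x2) v b) = mv n (G z x2) (pvec S) b" for b
    unfolding mm_def mv_def pvec_def sum_distrib_left
    by (subst sum.swap) (intro sum.cong refl, subst G_sym[OF z], simp add: mult.commute)
  have right: "(\<Sum>u\<in>S. mm n (G z x1) P b u) = mv n (G z x1) (pvec S) b" for b
    unfolding mm_def mv_def pvec_def sum_distrib_left
    by (subst sum.swap) (intro sum.cong refl, subst P_comm, simp)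
  have "(\<Sum>u\<in>S. \<Sum>v\<in>S. M v u) = (\<Sum>b<n. \<Sum>u\<in>S. \<Sum>v\<in>S. mm n P (G z x2) v b * mm n (G z x1) P b u)"
    unfolding M by (rule trans[OF sum.cong[OF refl sum.swap] sum.swap])
  also have "\<dots> = (\<Sum>b<n. mv n (G z x2) (pvec S) b * mv n (G z x1) (pvec S) b)"
    unfolding left[symmetric] right[symmetric] sum_product by (intro sum.cong refl sum.swap)
  finally have eq: "(\<Sum>u\<in>S. \<Sum>v\<in>S. M v u) = (\<Sum>b<n. mv n (G z x2) (pvec S) b * mv n (G z x1) (pvec S) b)" .
  have "norm (\<Sum>u\<in>S. \<Sum>v\<in>S. M v u) \<le> vnorm n (mv n (G z x2) (pvec S)) * vnorm n (mv n (G z x1) (pvec S))"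
    unfolding eq by (rule cauchy_schwarz_vnorm)
  also have "\<dots> \<le> (vnorm n (pvec S) / Im z) * (vnorm n (pvec S) / Im z)"
    using z by (intro mult_mono vr) auto
  also have "\<dots> = (vnorm n (pvec S))\<^sup>2 / (Im z)\<^sup>2" by (simp add: power2_eq_square)
  also have "\<dots> \<le> card S / (Im z)\<^sup>2"
    using vnorm_pvec[OF S] by (intro divide_right_mono) auto
  finally show ?thesis .
qed

text \<open>
  The edge matrix is a rank one matrix minus a diagonal one, so that its trace norm is of order \<open>r\<close>. The
  entrywise bound would only give \<open>r\<^sup>2\<close>, which is too much if \<open>r\<close> is of order \<open>n\<close>.
\<close>

lemma norm_tr_G_QP_G:
  assumes l: "l \<in> L"
  shows "norm (tr n (mm n (mm n (G z x1) (cm n (QP l))) (G z x2))) \<le> 2 * real (r (fst l)) / (Im z)\<^sup>2"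
proof -
  define e where "e = snd l"
  have e: "e \<subseteq> {..<n}" "finite e" "card e = r (fst l)" using L_D[OF l] by (auto simp: e_def)
  define M where "M = mm n (mm n P (mm n (G z x2) (G z x1))) P"
  have "tr n (mm n (mm n (G z x1) (cm n (QP l))) (G z x2)) = tr n (mm n (cm n (QP l)) (mm n (G z x2) (G z x1)))"
    by (simp only: mm_assoc tr_mm_comm[of n "G z x1"])
  also have "\<dots> = tr n (mm n (cm n (Q l)) M)" unfolding M_def by (rule tr_QP)
  also have "\<dots> = (\<Sum>u<n. \<Sum>v<n. of_bool (u \<in> e) * (of_bool (v \<in> e) * M v u) - (if v = u then of_bool (u \<in> e) * M u u else 0))"
    unfolding tr_def mm_def[of n "cm n (Q l)"] by (intro sum.cong refl) (auto simp: cm_def Q_def e_def)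
  also have "\<dots> = (\<Sum>u<n. of_bool (u \<in> e) * (\<Sum>v<n. of_bool (v \<in> e) * M v u)) - (\<Sum>u<n. of_bool (u \<in> e) * M u u)"
    unfolding sum_subtractf[symmetric]
  proof (rule sum.cong[OF refl])
    fix u assume u: "u \<in> {..<n}"
    have d: "(\<Sum>v<n. if v = u then c else 0) = c" for c :: complex using u by simp
    show "(\<Sum>v<n. of_bool (u \<in> e) * (of_bool (v \<in> e) * M v u) - (if v = u then of_bool (u \<in> e) * M u u else 0))
      = of_bool (u \<in> e) * (\<Sum>v<n. of_bool (v \<in> e) * M v u) - of_bool (u \<in> e) * M u u"
      by (simp only: sum_subtractf sum_distrib_left d)
  qed
  also have "\<dots> = (\<Sum>u\<in>e. \<Sum>v\<in>e. M v u) - (\<Sum>u\<in>e. M u u)"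
    by (simp only: sum_over_subset[OF e(1)])
  finally have eq: "tr n (mm n (mm n (G z x1) (cm n (QP l))) (G z x2)) = (\<Sum>u\<in>e. \<Sum>v\<in>e. M v u) - (\<Sum>u\<in>e. M u u)" .
  have "norm (tr n (mm n (mm n (G z x1) (cm n (QP l))) (G z x2))) \<le> card e / (Im z)\<^sup>2 + (\<Sum>u\<in>e. 1 / (Im z)\<^sup>2)"
    unfolding eq
  proof (rule order_trans[OF norm_triangle_ineq4], rule add_mono[OF _ order_trans[OF norm_sum sum_mono]])
    show "norm (\<Sum>u\<in>e. \<Sum>v\<in>e. M v u) \<le> card e / (Im z)\<^sup>2"
      unfolding M_def by (rule block_sum[OF e(1)])
    fix u assume "u \<in> e"
    then show "norm (M u u) \<le> 1 / (Im z)\<^sup>2"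
      unfolding M_def using block_sum[of "{u}" x2 x1] e(1) by auto
  qed
  also have "\<dots> = 2 * real (r (fst l)) / (Im z)\<^sup>2" by (simp add: e(3))
  finally show ?thesis .
qed

lemma trace_flip:
  assumes l: "l \<in> L"
  shows "norm (tr n (G z (X (h(l := True)))) - tr n (G z (X (h(l := False))))) \<le> a * (2 * real (r (fst l)) / (Im z)\<^sup>2)"
proof -
  let ?x1 = "X (h(l := True))" and ?x0 = "X (h(l := False))"
  have x0: "?x0 = ?x1(l := - p (fst l))" by (auto simp: X_def fun_eq_iff)
  have "tr n (G z ?x1) - tr n (G z ?x0)
    = of_real (a * (- p (fst l) - ?x1 l)) * tr n (mm n (mm n (G z ?x0) (cm n (QP l))) (G z ?x1))"
    unfolding tr_diff[symmetric] tr_scale[symmetric]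
    by (rule arg_cong[where f = "tr n"], intro ext, unfold x0, rule G_remove[OF z l])
  also have "- p (fst l) - ?x1 l = -1" by (simp add: X_def)
  finally have eq: "tr n (G z ?x1) - tr n (G z ?x0) = of_real (a * -1) * tr n (mm n (mm n (G z ?x0) (cm n (QP l))) (G z ?x1))" .
  have na: "norm (complex_of_real (a * -1) * t) = a * norm t" for t using a_pos by (simp add: norm_mult)
  show ?thesis
    unfolding eq na by (intro mult_left_mono norm_tr_G_QP_G[OF l]) (use a_pos in simp)
qed

definition m :: "(nat \<times> nat set \<Rightarrow> bool) \<Rightarrow> complex" where "m h = tr n (G z (X h)) / of_nat n"

lemma norm_m_le: "norm (m h) \<le> 1 / Im z"
proof -
  have "norm (m h) = norm (tr n (G z (X h))) / real n" by (simp add: m_def norm_divide)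
  also have "\<dots> \<le> (real n / Im z) / real n" by (intro divide_right_mono norm_tr_G_le[OF z]) simp
  finally show ?thesis using n_pos by simp
qed

lemma EV_Re: "EV (\<lambda>h. Re (f h)) = Re (EV f)" and EV_Im: "EV (\<lambda>h. Im (f h)) = Im (EV f)"
  by (rule integral_bounded_linear[OF bounded_linear_Re integrable_Omega],
      rule integral_bounded_linear[OF bounded_linear_Im integrable_Omega])

text \<open>
  The Efron-Stein inequality for the real and the imaginary part. Flipping a hyperedge changes the trace
  by the quantity bounded in \<open>trace_flip\<close>.
\<close>

lemma variance_m:
  "norm (EV (\<lambda>h. (m h)\<^sup>2) - (EV m)\<^sup>2)
    \<le> (\<Sum>l\<in>L. edge_var p (fst l) * (a * (2 * real (r (fst l)) / (Im z)\<^sup>2) / real n)\<^sup>2)"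
proof -
  define S where "S = EV m"
  define D where "D l h = m (h(l := True)) - m (h(l := False))" for l h
  have D: "(norm (D l h))\<^sup>2 \<le> (a * (2 * real (r (fst l)) / (Im z)\<^sup>2) / real n)\<^sup>2" if "l \<in> L" for l h
  proof (rule power_mono)
    have e: "norm (D l h) = norm (tr n (G z (X (h(l := True)))) - tr n (G z (X (h(l := False))))) / real n"
      by (simp add: D_def m_def diff_divide_distrib[symmetric] norm_divide)
    show "norm (D l h) \<le> a * (2 * real (r (fst l)) / (Im z)\<^sup>2) / real n"
      unfolding e by (rule divide_right_mono[OF trace_flip[OF that]]) simp
  qed simp
  have eq: "EV (\<lambda>h. (m h)\<^sup>2) - S\<^sup>2 = EV (\<lambda>h. (m h - S)\<^sup>2)"
  proof -
    have "EV (\<lambda>h. (m h - S)\<^sup>2) = EV (\<lambda>h. (m h)\<^sup>2 - 2 * S * m h + S\<^sup>2)"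
      by (intro Bochner_Integration.integral_cong refl) (simp add: power2_eq_square algebra_simps)
    also have "\<dots> = EV (\<lambda>h. (m h)\<^sup>2) - 2 * S * S + S\<^sup>2"
      by (simp add: S_def)
    finally show ?thesis by (simp add: power2_eq_square)
  qed
  have pw: "norm ((m h - S)\<^sup>2) = (Re (m h) - Re S)\<^sup>2 + (Im (m h) - Im S)\<^sup>2" for h
    by (simp only: norm_power cmod_power2 minus_complex.simps)
  have "norm (EV (\<lambda>h. (m h)\<^sup>2) - S\<^sup>2) \<le> EV (\<lambda>h. norm ((m h - S)\<^sup>2))"
    unfolding eq by (rule integral_norm_bound)
  also have "\<dots> = EV (\<lambda>h. (Re (m h))\<^sup>2 + (Im (m h))\<^sup>2 - 2 * Re S * Re (m h) - 2 * Im S * Im (m h) + ((Re S)\<^sup>2 + (Im S)\<^sup>2))"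
    by (intro Bochner_Integration.integral_cong refl) (simp only: pw, simp add: power2_diff)
  also have "\<dots> = (EV (\<lambda>h. (Re (m h))\<^sup>2) - (EV (\<lambda>h. Re (m h)))\<^sup>2) + (EV (\<lambda>h. (Im (m h))\<^sup>2) - (EV (\<lambda>h. Im (m h)))\<^sup>2)"
    by (simp add: EV_Re EV_Im S_def power2_eq_square)
  also have "\<dots> \<le> (\<Sum>l\<in>L. p (fst l) * (1 - p (fst l)) * EV (\<lambda>h. (Re (m (h(l := True))) - Re (m (h(l := False))))\<^sup>2))
     + (\<Sum>l\<in>L. p (fst l) * (1 - p (fst l)) * EV (\<lambda>h. (Im (m (h(l := True))) - Im (m (h(l := False))))\<^sup>2))"
    by (intro add_mono efron_stein_bernoulli) (use p L_D in auto)
  also have "\<dots> = (\<Sum>l\<in>L. edge_var p (fst l) * EV (\<lambda>h. (norm (D l h))\<^sup>2))"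
    unfolding sum.distrib[symmetric] distrib_left[symmetric] edge_var_def
    by (simp add: D_def cmod_power2)
  also have "\<dots> \<le> (\<Sum>l\<in>L. edge_var p (fst l) * (a * (2 * real (r (fst l)) / (Im z)\<^sup>2) / real n)\<^sup>2)"
  proof (intro sum_mono mult_left_mono)
    fix l assume l: "l \<in> L"
    show "0 \<le> edge_var p (fst l)" using p[OF L_D(1)[OF l]] by (simp add: edge_var_def)
    have "norm (EV (\<lambda>h. (norm (D l h))\<^sup>2)) \<le> (a * (2 * real (r (fst l)) / (Im z)\<^sup>2) / real n)\<^sup>2"
      by (rule norm_EV_le) (use D[OF l] in simp)
    then show "EV (\<lambda>h. (norm (D l h))\<^sup>2) \<le> (a * (2 * real (r (fst l)) / (Im z)\<^sup>2) / real n)\<^sup>2" by simp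
  qed
  finally show ?thesis by (simp add: S_def)
qed

lemma vnorm_ones: "vnorm n (\<lambda>_. c) = sqrt n * norm c"
proof -
  have "(vnorm n (\<lambda>_. c))\<^sup>2 = (sqrt n * norm c)\<^sup>2" by (simp add: vnorm_sq power_mult_distrib)
  then show ?thesis by (metis vnorm_nonneg norm_ge_zero mult_nonneg_nonneg power2_eq_iff_nonneg real_sqrt_ge_zero of_nat_0_le_iff)
qed

text \<open>
  By double centering, \<open>H\<close> and its compression differ by \<open>(h\<^sub>i + h\<^sub>j - h\<^sub>0) / n\<close> at the entry \<open>(i, j)\<close>, with \<open>h\<close> the row
  sums and \<open>h\<^sub>0\<close> their average. In the trace each of the three terms is a scalar product with
  a product of two resolvents applied to the constant vector.
\<close>

lemma projection_trace_bound:
  "norm (tr n (res n (H x) z) - tr n (G z x)) \<le> 3 * vnorm n (hv x) * sqrt n / (real n * (Im z)\<^sup>2)"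
proof -
  let ?A = "res n (H x) z" and ?B = "G z x"
  define hb where "hb = (\<Sum>i<n. hv x i) / of_nat n"
  define D where "D = cm n (\<lambda>i j. HP x i j - H x i j)"
  define M where "M = mm n ?A ?B"
  have D: "D i j = - (hv x i + hv x j - hb) / of_nat n" if ij: "i < n" "j < n" for i j
  proof -
    have col: "(\<Sum>i<n. H x i j) = (\<Sum>i<n. H x j i)"
      using symm_H[of x] ij by (intro sum.cong) (auto simp: symm_def)
    have "HP x i j - H x i j = - (((\<Sum>k<n. H x i k) + (\<Sum>k<n. H x j k) - (\<Sum>i<n. \<Sum>k<n. H x i k) / real n) / real n)"
      unfolding HP_eq_proj double_centering[OF ij] col
      by (simp add: diff_divide_distrib add_divide_distrib power2_eq_square)
    then have "D i j = - (of_real (\<Sum>k<n. H x i k) + of_real (\<Sum>k<n. H x j k) - of_real (\<Sum>i<n. \<Sum>k<n. H x i k) / of_nat n) / of_nat n"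
      using ij by (simp only: D_def cm_def if_True simp_thms of_real_minus of_real_divide of_real_add of_real_diff of_real_of_nat_eq minus_divide_left)
    moreover have "hb = of_real (\<Sum>i<n. \<Sum>k<n. H x i k) / of_nat n"
      by (simp only: hb_def hv_def of_real_sum)
    ultimately show ?thesis by (simp only: hv_def)
  qed
  have A_sym: "?A i j = ?A j i" for i j by (rule res_symmetric[OF symm_H z])
  have row: "(\<Sum>i<n. M i j) = mv n ?B (mv n ?A (\<lambda>_. 1)) j" for j
  proof -
    have "(\<Sum>i<n. M i j) = (\<Sum>k<n. (\<Sum>i<n. ?A i k) * ?B k j)"
      unfolding M_def mm_def sum_distrib_right by (rule sum.swap)
    also have "\<dots> = (\<Sum>k<n. ?B j k * (\<Sum>i<n. ?A k i * 1))"
    proof (intro sum.cong refl)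
      fix k
      have "(\<Sum>i<n. ?A i k) = (\<Sum>i<n. ?A k i * 1)" by (intro sum.cong refl) (simp add: A_sym)
      then show "(\<Sum>i<n. ?A i k) * ?B k j = ?B j k * (\<Sum>i<n. ?A k i * 1)"
        by (simp add: G_sym[OF z, of x k j])
    qed
    finally show ?thesis by (simp add: mv_def)
  qed
  have col: "(\<Sum>j<n. M i j) = mv n ?A (mv n ?B (\<lambda>_. 1)) i" for i
    unfolding mv_mm[symmetric] M_def[symmetric] by (simp add: mv_def)
  have w: "Im z * vnorm n (mv n ?A v) \<le> vnorm n v" "Im z * vnorm n (mv n ?B v) \<le> vnorm n v" for v
    by (rule vnorm_res[OF symm_H z], rule vnorm_res[OF symm_HP z])
  have two: "vnorm n (mv n ?A (mv n ?B v)) \<le> vnorm n v / (Im z)\<^sup>2" "vnorm n (mv n ?B (mv n ?A v)) \<le> vnorm n v / (Im z)\<^sup>2" for v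
  proof -
    have "Im z * (Im z * vnorm n (mv n ?A (mv n ?B v))) \<le> vnorm n v"
      using order_trans[OF mult_left_mono[OF w(1)[of "mv n ?B v"], of "Im z"] w(2)] z by simp
    then show "vnorm n (mv n ?A (mv n ?B v)) \<le> vnorm n v / (Im z)\<^sup>2"
      using z by (simp add: pos_le_divide_eq power2_eq_square mult_ac)
    have "Im z * (Im z * vnorm n (mv n ?B (mv n ?A v))) \<le> vnorm n v"
      using order_trans[OF mult_left_mono[OF w(2)[of "mv n ?A v"], of "Im z"] w(1)] z by simp
    then show "vnorm n (mv n ?B (mv n ?A v)) \<le> vnorm n v / (Im z)\<^sup>2"
      using z by (simp add: pos_le_divide_eq power2_eq_square mult_ac)
  qed
  have "tr n ?A - tr n ?B = tr n (mm n (mm n ?B D) ?A)"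
    unfolding tr_diff[symmetric] D_def
    by (rule arg_cong[where f = "tr n"], intro ext, rule res_diff[OF symm_HP symm_H z])
  also have "\<dots> = tr n (mm n D M)"
    unfolding M_def by (simp only: mm_assoc tr_mm_comm[of n ?B])
  also have "\<dots> = (\<Sum>i<n. \<Sum>j<n. - (hv x i + hv x j - hb) / of_nat n * M j i)"
    unfolding tr_def mm_def[of n D] by (intro sum.cong refl) (simp add: D)
  also have "\<dots> = - ((\<Sum>i<n. hv x i * (\<Sum>j<n. M j i)) + (\<Sum>i<n. \<Sum>j<n. hv x j * M j i) - (\<Sum>i<n. hb * (\<Sum>j<n. M j i))) / of_nat n"
    unfolding sum_distrib_left sum.distrib[symmetric] sum_subtractf[symmetric] sum_negf[symmetric] sum_divide_distrib
    by (intro sum.cong refl) (simp add: algebra_simps)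
  also have "(\<Sum>i<n. \<Sum>j<n. hv x j * M j i) = (\<Sum>j<n. hv x j * (\<Sum>i<n. M j i))"
    unfolding sum_distrib_left by (rule sum.swap)
  also have "- ((\<Sum>i<n. hv x i * (\<Sum>j<n. M j i)) + (\<Sum>j<n. hv x j * (\<Sum>i<n. M j i)) - (\<Sum>i<n. hb * (\<Sum>j<n. M j i))) / of_nat n
     = - ((\<Sum>i<n. hv x i * mv n ?B (mv n ?A (\<lambda>_. 1)) i) + (\<Sum>j<n. hv x j * mv n ?A (mv n ?B (\<lambda>_. 1)) j)
        - (\<Sum>i<n. hb * mv n ?B (mv n ?A (\<lambda>_. 1)) i)) / of_nat n"
    unfolding row col ..
  finally have eq: "norm (tr n ?A - tr n ?B) = norm ((\<Sum>i<n. hv x i * mv n ?B (mv n ?A (\<lambda>_. 1)) i)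
      + (\<Sum>j<n. hv x j * mv n ?A (mv n ?B (\<lambda>_. 1)) j) - (\<Sum>i<n. hb * mv n ?B (mv n ?A (\<lambda>_. 1)) i)) / real n"
    by (simp add: norm_divide del: minus_add_distrib minus_diff_eq)
  have one: "vnorm n (\<lambda>_. 1 :: complex) = sqrt n" by (simp add: vnorm_ones)
  have hbn: "vnorm n (\<lambda>_. hb) \<le> vnorm n (hv x)"
  proof -
    have "norm (\<Sum>i<n. hv x i * 1) \<le> vnorm n (hv x) * vnorm n (\<lambda>_. 1)" by (rule cauchy_schwarz_vnorm)
    then have "norm hb \<le> vnorm n (hv x) * sqrt n / real n"
      by (simp add: hb_def norm_divide one divide_right_mono)
    then have "sqrt n * norm hb \<le> sqrt n * (vnorm n (hv x) * sqrt n / real n)"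
      by (intro mult_left_mono) auto
    also have "\<dots> = vnorm n (hv x)" using n_pos by (simp add: field_simps)
    finally show ?thesis by (simp add: vnorm_ones)
  qed
  have b1: "norm (\<Sum>i<n. hv x i * mv n ?B (mv n ?A (\<lambda>_. 1)) i) \<le> vnorm n (hv x) * (sqrt n / (Im z)\<^sup>2)"
    by (intro order_trans[OF cauchy_schwarz_vnorm] mult_left_mono) (use two(2)[of "\<lambda>_. 1"] one in auto)
  have b2: "norm (\<Sum>i<n. hv x i * mv n ?A (mv n ?B (\<lambda>_. 1)) i) \<le> vnorm n (hv x) * (sqrt n / (Im z)\<^sup>2)"
    by (intro order_trans[OF cauchy_schwarz_vnorm] mult_left_mono) (use two(1)[of "\<lambda>_. 1"] one in auto)
  have b3: "norm (\<Sum>i<n. hb * mv n ?B (mv n ?A (\<lambda>_. 1)) i) \<le> vnorm n (hv x) * (sqrt n / (Im z)\<^sup>2)"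
    by (rule order_trans[OF cauchy_schwarz_vnorm], rule mult_mono[OF hbn]) (use two(2)[of "\<lambda>_. 1"] one in auto)
  have "norm (tr n ?A - tr n ?B) \<le> (vnorm n (hv x) * (sqrt n / (Im z)\<^sup>2) + vnorm n (hv x) * (sqrt n / (Im z)\<^sup>2) + vnorm n (hv x) * (sqrt n / (Im z)\<^sup>2)) / real n"
    unfolding eq
    by (intro divide_right_mono order_trans[OF norm_triangle_ineq4] add_mono order_trans[OF norm_triangle_ineq] b1 b2 b3) simp
  then show ?thesis by (simp add: mult_ac)
qed

end

end

section \<open>The self-consistent equation\<close>

context hypergraph_model
begin

text \<open>
  The number of hyperedges of size \<open>r i\<close> through two given vertices.
\<close>

definition "Nb i = real ((n - 2) choose (r i - 2))"

text \<open>
  The ratio \<open>(c\<^sub>2 - 2 c\<^sub>3 + c\<^sub>4) / c\<^sub>2\<close> for the numbers \<open>c\<^sub>j\<close> of hyperedges of size \<open>r i\<close> through \<open>j\<close> given vertices.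
\<close>

definition "pair_coeff i = 1 - 2 * ((real (r i) - 2) / (real n - 2))
  + (real (r i) - 2) * (real (r i) - 3) / ((real n - 2) * (real n - 3))"

definition "tv = total_var k n r p"

definition "edges i = {e. e \<subseteq> {0..<n} \<and> card e = r i}"

lemma finite_edges [simp]: "finite (edges i)"
  unfolding edges_def by (rule finite_subset[of _ "Pow {0..<n}"]) auto

lemma sum_over_L: "(\<Sum>l\<in>L. g (fst l) (snd l)) = (\<Sum>i=1..k. \<Sum>e\<in>edges i. g i e)"
  unfolding L_eq edges_def[symmetric] by (subst sum.Sigma) (auto simp: case_prod_beta)

lemma tv_eq: "tv = (\<Sum>i=1..k. Nb i * edge_var p i)"
  by (simp add: tv_def total_var_def Nb_def)

lemma tv_pos: "tv > 0" using var_pos by (simp add: tv_def)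

lemma a_sq_tv: "a\<^sup>2 * tv = 1 / real n"
  using tv_pos by (simp add: a_sq tv_def)

lemma edge_var_nonneg: "i \<in> {1..k} \<Longrightarrow> 0 \<le> edge_var p i"
  using p by (simp add: edge_var_def)

text \<open>
  There are \<open>n (n - 1) / (r (r - 1))\<close> times as many hyperedges of size \<open>r\<close> as hyperedges through two given
  vertices.
\<close>

lemma edge_sum_bound:
  assumes g: "\<And>i. i \<in> {1..k} \<Longrightarrow> g i \<le> c * (real (r i))\<^sup>2" and c: "0 \<le> c"
  shows "(\<Sum>l\<in>L. edge_var p (fst l) * g (fst l)) \<le> 2 * (real n)\<^sup>2 * c * tv"
proof -
  have "(\<Sum>l\<in>L. edge_var p (fst l) * g (fst l)) = (\<Sum>i=1..k. real (n choose r i) * (edge_var p i * g i))"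
    using sum_over_L[of "\<lambda>i e. edge_var p i * g i"] by (simp add: edges_def n_subsets)
  also have "\<dots> \<le> (\<Sum>i=1..k. 2 * (real n)\<^sup>2 * c * (Nb i * edge_var p i))"
  proof (rule sum_mono)
    fix i assume i: "i \<in> {1..k}"
    have ri: "2 \<le> r i" "r i \<le> n" using r[OF i] by auto
    have b: "real (n choose r i) * (real (r i))\<^sup>2 \<le> 2 * (real n)\<^sup>2 * Nb i"
    proof -
      have "(real (r i))\<^sup>2 \<le> 2 * (real (r i) * (real (r i) - 1))"
      proof -
        have "0 \<le> real (r i) * (real (r i) - 2)" using ri by (intro mult_nonneg_nonneg) auto
        then show ?thesis by (simp add: power2_eq_square algebra_simps)
      qed
      then have "real (n choose r i) * (real (r i))\<^sup>2 \<le> real (n choose r i) * (2 * (real (r i) * (real (r i) - 1)))"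
        by (rule mult_left_mono) simp
      also have "\<dots> = 2 * (real (r i) * (real (r i) - 1) * real (n choose r i))" by (simp only: mult_ac)
      also have "\<dots> = 2 * (real n * (real n - 1) * Nb i)"
        using binomial_two_step[OF ri] by (simp add: Nb_def)
      also have "\<dots> \<le> 2 * ((real n)\<^sup>2 * Nb i)"
        by (intro mult_left_mono mult_right_mono) (auto simp: power2_eq_square Nb_def mult_left_mono)
      finally show ?thesis by simp
    qed
    have "real (n choose r i) * (edge_var p i * g i) \<le> real (n choose r i) * (edge_var p i * (c * (real (r i))\<^sup>2))"
      using g[OF i] edge_var_nonneg[OF i] by (intro mult_left_mono) auto
    also have "\<dots> = (c * edge_var p i) * (real (n choose r i) * (real (r i))\<^sup>2)" by (simp only: mult_ac)
    also have "\<dots> \<le> (c * edge_var p i) * (2 * (real n)\<^sup>2 * Nb i)"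
      using b c edge_var_nonneg[OF i] by (intro mult_left_mono) auto
    finally show "real (n choose r i) * (edge_var p i * g i) \<le> 2 * (real n)\<^sup>2 * c * (Nb i * edge_var p i)"
      by (simp only: mult_ac)
  qed
  also have "\<dots> = 2 * (real n)\<^sup>2 * c * tv" by (simp add: tv_eq sum_distrib_left)
  finally show ?thesis .
qed

lemma edge_pair_count:
  assumes "u < n" "v < n" "w < n" "x < n"
  shows "(\<Sum>e\<in>edges i. Q (i, e) u v * Q (i, e) w x)
    = of_bool (u \<noteq> v) * of_bool (w \<noteq> x) * real (sup_count n (r i) (card {u, v, w, x}))"
proof -
  have "(\<Sum>e\<in>edges i. Q (i, e) u v * Q (i, e) w x)
    = (\<Sum>e\<in>edges i. if {u, v, w, x} \<subseteq> e then of_bool (u \<noteq> v) * of_bool (w \<noteq> x) else 0)"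
    by (intro sum.cong refl) (auto simp: Q_def)
  also have "\<dots> = (\<Sum>e\<in>{e\<in>edges i. {u, v, w, x} \<subseteq> e}. of_bool (u \<noteq> v) * of_bool (w \<noteq> x))"
    by (rule sum.inter_filter[symmetric]) simp
  also have "\<dots> = real (card {e\<in>edges i. {u, v, w, x} \<subseteq> e}) * (of_bool (u \<noteq> v) * of_bool (w \<noteq> x))"
    by simp
  also have "{e\<in>edges i. {u, v, w, x} \<subseteq> e} = {e. e \<subseteq> {0..<n} \<and> card e = r i \<and> {u, v, w, x} \<subseteq> e}"
    by (auto simp: edges_def)
  also have "card \<dots> = sup_count n (r i) (card {u, v, w, x})"
    by (rule card_supersets) (use assms in auto)
  finally show ?thesis by (simp only: mult_ac)
qed

lemma sum_swap4:
  fixes f :: "'e \<Rightarrow> nat \<Rightarrow> nat \<Rightarrow> nat \<Rightarrow> nat \<Rightarrow> complex"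
  shows "(\<Sum>e\<in>E. \<Sum>u<n. \<Sum>v<n. \<Sum>w<n. \<Sum>x<n. f e u v w x) = (\<Sum>u<n. \<Sum>v<n. \<Sum>w<n. \<Sum>x<n. \<Sum>e\<in>E. f e u v w x)"
  by (rule trans[OF sum.swap], rule sum.cong[OF refl], rule trans[OF sum.swap], rule sum.cong[OF refl],
      rule trans[OF sum.swap], rule sum.cong[OF refl], rule sum.swap)

lemma trace_QKQK:
  "tr n (mm n (mm n (cm n (Q l)) A) (mm n (cm n (Q l)) A))
    = (\<Sum>u<n. \<Sum>v<n. \<Sum>w<n. \<Sum>x<n. of_real (Q l u v * Q l w x) * (A v w * A x u))"
proof -
  have "tr n (mm n (mm n (cm n (Q l)) A) (mm n (cm n (Q l)) A))
    = (\<Sum>u<n. \<Sum>w<n. (\<Sum>v<n. of_real (Q l u v) * A v w) * (\<Sum>x<n. of_real (Q l w x) * A x u))"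
    unfolding tr_def mm_def by (intro sum.cong refl arg_cong2[where f = "(*)"]) (auto simp: cm_def)
  also have "\<dots> = (\<Sum>u<n. \<Sum>w<n. \<Sum>v<n. \<Sum>x<n. of_real (Q l u v * Q l w x) * (A v w * A x u))"
    unfolding sum_product by (intro sum.cong refl) (simp add: mult_ac)
  also have "\<dots> = (\<Sum>u<n. \<Sum>v<n. \<Sum>w<n. \<Sum>x<n. of_real (Q l u v * Q l w x) * (A v w * A x u))"
    by (rule sum.cong[OF refl], rule sum.swap)
  finally show ?thesis .
qed

context
  fixes z :: complex
  assumes z: "Im z > 0"
begin

text \<open>
  The factor \<open>44\<close> is \<open>11\<close> times the constant of \<open>sum_sq_K\<close>: the terms of \<open>four_point_sum\<close> other than the
  square of the trace have coefficients that add up to at most \<open>11 * Nb i\<close>.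
\<close>

lemma edge_quadratic:
  assumes i: "i \<in> {1..k}"
  shows "norm ((\<Sum>e\<in>edges i. tr n (mm n (mm n (cm n (Q (i, e))) (K z x)) (mm n (cm n (Q (i, e))) (K z x))))
      - of_real (Nb i * pair_coeff i) * (tr n (K z x))\<^sup>2) \<le> 44 * Nb i * real n / (Im z)\<^sup>2"
proof -
  let ?K = "K z x"
  have ri: "2 \<le> r i" "r i \<le> n" using r[OF i] by auto
  define c where "c j = complex_of_nat (sup_count n (r i) j)" for j
  define \<alpha> where "\<alpha> = (real (r i) - 2) / (real n - 2)"
  define \<beta> where "\<beta> = (real (r i) - 2) * (real (r i) - 3) / ((real n - 2) * (real n - 3))"
  define N where "N = Nb i"
  have N0: "0 \<le> N" by (simp add: N_def Nb_def)
  have \<alpha>: "0 \<le> \<alpha>" "\<alpha> \<le> 1" and \<beta>: "0 \<le> \<beta> \<and> \<beta> \<le> 1"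
    using falling_ratio_bounds[OF ri n4] by (auto simp: \<alpha>_def \<beta>_def)
  have c: "c 2 = of_real N" "c 3 = of_real (\<alpha> * N)" "c 4 = of_real (\<beta> * N)"
  proof -
    have c': "c j = of_real (real (sup_count n (r i) j))" for j by (simp add: c_def)
    show "c 2 = of_real N" "c 3 = of_real (\<alpha> * N)" "c 4 = of_real (\<beta> * N)"
      unfolding c' sup_count_ratio[OF ri n4] N_def Nb_def \<alpha>_def \<beta>_def by (rule refl)+
  qed
  have pair_coeff: "pair_coeff i = 1 - 2 * \<alpha> + \<beta>" by (simp add: pair_coeff_def \<alpha>_def \<beta>_def)
  define F where "F = (\<Sum>u<n. \<Sum>v<n. (?K u v)\<^sup>2)"
  define D where "D = (\<Sum>u<n. (?K u u)\<^sup>2)"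
  define B where "B = 4 * real n / (Im z)\<^sup>2"
  have B: "(\<Sum>u<n. \<Sum>v<n. (norm (?K u v))\<^sup>2) \<le> B"
    unfolding B_def by (rule sum_sq_K[OF z])
  have F: "norm F \<le> B"
  proof -
    have "norm F \<le> (\<Sum>u<n. \<Sum>v<n. (norm (?K u v))\<^sup>2)"
      unfolding F_def norm_power[symmetric] by (intro order_trans[OF norm_sum] sum_mono order_refl)
    then show ?thesis using B by linarith
  qed
  have D: "norm D \<le> B"
  proof -
    have "norm D \<le> (\<Sum>u<n. (norm (?K u u))\<^sup>2)"
      unfolding D_def norm_power[symmetric] by (rule norm_sum)
    also have "\<dots> \<le> (\<Sum>u<n. \<Sum>v<n. (norm (?K u v))\<^sup>2)"
      by (intro sum_mono member_le_sum) auto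
    finally show ?thesis using B by linarith
  qed
  have "(\<Sum>e\<in>edges i. tr n (mm n (mm n (cm n (Q (i, e))) ?K) (mm n (cm n (Q (i, e))) ?K)))
    = (\<Sum>u<n. \<Sum>v<n. \<Sum>w<n. \<Sum>x<n. of_real (\<Sum>e\<in>edges i. Q (i, e) u v * Q (i, e) w x) * (?K v w * ?K x u))"
    unfolding trace_QKQK of_real_sum sum_distrib_right by (rule sum_swap4)
  also have "\<dots> = (\<Sum>u<n. \<Sum>v<n. \<Sum>w<n. \<Sum>x<n. of_bool (u \<noteq> v) * of_bool (w \<noteq> x) * c (card {u, v, w, x}) * (?K v w * ?K x u))"
  proof (intro sum.cong refl)
    fix u v w y assume "u \<in> {..<n}" "v \<in> {..<n}" "w \<in> {..<n}" "y \<in> {..<n}"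
    then have e: "(\<Sum>e\<in>edges i. Q (i, e) u v * Q (i, e) w y)
      = of_bool (u \<noteq> v) * of_bool (w \<noteq> y) * real (sup_count n (r i) (card {u, v, w, y}))"
      by (intro edge_pair_count) auto
    show "of_real (\<Sum>e\<in>edges i. Q (i, e) u v * Q (i, e) w y) * (?K v w * ?K y u)
      = of_bool (u \<noteq> v) * of_bool (w \<noteq> y) * c (card {u, v, w, y}) * (?K v w * ?K y u)"
      unfolding e c_def by simp
  qed
  also have "\<dots> = (c 2 - 2 * c 3 + c 4) * ((tr n ?K)\<^sup>2 + F - 2 * D) + c 4 * F + 4 * (c 3 - c 4) * D"
    unfolding F_def D_def by (rule four_point_sum) (auto intro: K_sym[OF z] K_row_sum[OF z])
  also have "c 2 - 2 * c 3 + c 4 = of_real (N * pair_coeff i)"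
    unfolding c pair_coeff by (simp add: algebra_simps)
  finally have eq: "(\<Sum>e\<in>edges i. tr n (mm n (mm n (cm n (Q (i, e))) ?K) (mm n (cm n (Q (i, e))) ?K)))
      - of_real (N * pair_coeff i) * (tr n ?K)\<^sup>2
      = of_real (N * pair_coeff i) * (F - 2 * D) + c 4 * F + 4 * (c 3 - c 4) * D"
    by (simp add: algebra_simps)
  have T2: "\<bar>pair_coeff i\<bar> \<le> 2" using \<alpha> \<beta> unfolding pair_coeff by auto
  have "norm (of_real (N * pair_coeff i) * (F - 2 * D) + c 4 * F + 4 * (c 3 - c 4) * D)
    \<le> (2 * N) * (3 * B) + N * B + 4 * N * B"
  proof (intro order_trans[OF norm_triangle_ineq] add_mono)
    have "norm (F - 2 * D) \<le> norm F + norm (2 * D)" by (rule norm_triangle_ineq4)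
    then have FD: "norm (F - 2 * D) \<le> 3 * B" using F D by (simp add: norm_mult)
    show "norm (of_real (N * pair_coeff i) * (F - 2 * D)) \<le> (2 * N) * (3 * B)"
      unfolding norm_mult norm_of_real using FD T2 N0 by (intro mult_mono) (auto simp: abs_mult mult.commute[of _ N] mult_left_mono)
    show "norm (c 4 * F) \<le> N * B"
      unfolding norm_mult c norm_of_real using F \<beta> N0
      by (intro mult_mono) (auto simp: abs_mult intro: mult_left_le_one_le)
    have "c 3 - c 4 = of_real ((\<alpha> - \<beta>) * N)" unfolding c by (simp add: algebra_simps)
    moreover have "\<bar>\<alpha> - \<beta>\<bar> \<le> 1" using \<alpha> \<beta> by auto
    ultimately have "norm (c 3 - c 4) \<le> N"
      using N0 by (simp only: norm_of_real abs_mult) (auto intro: mult_left_le_one_le)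
    then show "norm (4 * (c 3 - c 4) * D) \<le> 4 * N * B"
      unfolding norm_mult using D N0 by (intro mult_mono) auto
  qed
  then show ?thesis unfolding eq[folded N_def, symmetric] N_def[symmetric]
    by (simp add: B_def mult_ac)
qed

end

end

lemma norm_eq_diff_le:
  fixes x y w :: "'a :: real_normed_vector"
  assumes "x = y - w" "norm y \<le> b" "norm w \<le> c"
  shows "norm x \<le> b + c"
  using assms by (auto intro: order_trans[OF norm_triangle_ineq4])

lemma norm_eq_add_le:
  fixes x y w :: "'a :: real_normed_vector"
  assumes "x = y + w" "norm y \<le> b" "norm w \<le> c"
  shows "norm x \<le> b + c"
  using assms by (auto intro: order_trans[OF norm_triangle_ineq])

context hypergraph_model
begin

text \<open>
  The variance of the limit law before passage to the limit.
\<close>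

definition "mean_coeff = (\<Sum>i=1..k. Nb i * edge_var p i / tv * pair_coeff i)"

lemma pair_coeff_bound: "i \<in> {1..k} \<Longrightarrow> \<bar>pair_coeff i\<bar> \<le> 2"
proof -
  assume i: "i \<in> {1..k}"
  have ri: "2 \<le> r i" "r i \<le> n" using r[OF i] by auto
  define \<alpha> where "\<alpha> = (real (r i) - 2) / (real n - 2)"
  define \<beta> where "\<beta> = (real (r i) - 2) * (real (r i) - 3) / ((real n - 2) * (real n - 3))"
  have \<alpha>: "0 \<le> \<alpha>" "\<alpha> \<le> 1" and \<beta>: "0 \<le> \<beta> \<and> \<beta> \<le> 1"
    using falling_ratio_bounds[OF ri n4] by (auto simp: \<alpha>_def \<beta>_def)
  have "pair_coeff i = 1 - 2 * \<alpha> + \<beta>" by (simp add: pair_coeff_def \<alpha>_def \<beta>_def)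
  then show ?thesis using \<alpha> \<beta> by auto
qed

lemma mean_coeff_bound: "\<bar>mean_coeff\<bar> \<le> 2"
proof -
  have "\<bar>mean_coeff\<bar> \<le> (\<Sum>i=1..k. \<bar>Nb i * edge_var p i / tv * pair_coeff i\<bar>)" unfolding mean_coeff_def by (rule sum_abs)
  also have "\<dots> \<le> (\<Sum>i=1..k. Nb i * edge_var p i / tv * 2)"
  proof (rule sum_mono)
    fix i assume i: "i \<in> {1..k}"
    have nn: "0 \<le> Nb i * edge_var p i / tv" using edge_var_nonneg[OF i] tv_pos by (simp add: Nb_def)
    then show "\<bar>Nb i * edge_var p i / tv * pair_coeff i\<bar> \<le> Nb i * edge_var p i / tv * 2"
      using mult_left_mono[OF pair_coeff_bound[OF i] nn] by (simp only: abs_mult abs_of_nonneg)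
  qed
  also have "\<dots> = 2"
    unfolding sum_distrib_right[symmetric] sum_divide_distrib[symmetric] tv_eq[symmetric] using tv_pos by simp
  finally show ?thesis .
qed

context
  fixes z :: complex
  assumes z: "Im z > 0"
begin

lemma trace_identity:
  "z * tr n (G z x) + of_nat n = of_real a * (\<Sum>l\<in>L. of_real (x l) * tr n (T z l x))"
proof -
  have "tr n (mm n (cm n (HP x)) (G z x)) = z * tr n (G z x) + of_nat n"
    unfolding res_right[OF symm_HP z] by (simp only: tr_add tr_scale tr_idn)
  moreover have "tr n (mm n (cm n (HP x)) (G z x)) = of_real a * (\<Sum>l\<in>L. of_real (x l) * tr n (T z l x))"
  proof -
    have "tr n (\<lambda>i j. \<Sum>l\<in>L. of_real (x l) * T z l x i j) = (\<Sum>l\<in>L. of_real (x l) * tr n (T z l x))"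
      unfolding tr_def sum_distrib_left by (rule sum.swap)
    then show ?thesis
      unfolding cm_HP mm_scale_left mm_sum_left tr_scale by (simp only:)
  qed
  ultimately show ?thesis by simp
qed

text \<open>
  The second order terms that integration by parts produces.
\<close>

definition U :: "(nat \<times> nat set \<Rightarrow> real) \<Rightarrow> complex" where
  "U x = (\<Sum>l\<in>L. of_real (edge_var p (fst l)) * tr n (mm n (T z l x) (T z l x)))"

text \<open>
  The sum of the errors in \<open>ibp_edge\<close> is small because \<open>a\<^sup>2\<close> times the sum of the variances over the
  hyperedges through two given vertices is \<open>1 / n\<close>.
\<close>

lemma expected_trace_approx:
  assumes R: "\<And>i. i \<in> {1..k} \<Longrightarrow> real (r i) \<le> R"
  shows "norm (z * EV (\<lambda>h. tr n (G z (X h))) + of_nat n + of_real (a\<^sup>2) * EV (\<lambda>h. U (X h)))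
    \<le> 48 * a * real n * R ^ 4 / (Im z) ^ 3"
proof -
  define F where "F l h = of_real (X h l) * tr n (T z l (X h)) + of_real (a * edge_var p (fst l)) * tr n (mm n (T z l (X h)) (T z l (X h)))" for l h
  have "z * EV (\<lambda>h. tr n (G z (X h))) + of_nat n + of_real (a\<^sup>2) * EV (\<lambda>h. U (X h))
    = EV (\<lambda>h. (z * tr n (G z (X h)) + of_nat n) + of_real (a\<^sup>2) * U (X h))"
    by simp
  also have "\<dots> = EV (\<lambda>h. of_real a * (\<Sum>l\<in>L. F l h))"
  proof (intro Bochner_Integration.integral_cong refl)
    fix h
    show "(z * tr n (G z (X h)) + of_nat n) + of_real (a\<^sup>2) * U (X h) = of_real a * (\<Sum>l\<in>L. F l h)"
      unfolding trace_identity U_def F_def sum.distrib distrib_left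
      by (simp add: sum_distrib_left power2_eq_square mult_ac)
  qed
  also have "\<dots> = of_real a * (\<Sum>l\<in>L. EV (F l))" by simp
  finally have eq: "z * EV (\<lambda>h. tr n (G z (X h))) + of_nat n + of_real (a\<^sup>2) * EV (\<lambda>h. U (X h)) = of_real a * (\<Sum>l\<in>L. EV (F l))" .
  have "norm (of_real a * (\<Sum>l\<in>L. EV (F l))) \<le> a * (\<Sum>l\<in>L. norm (EV (F l)))"
    unfolding norm_mult norm_of_real using a_pos by (simp add: mult_left_mono norm_sum)
  also have "\<dots> \<le> a * (\<Sum>l\<in>L. 3 * a\<^sup>2 * edge_var p (fst l) * (real (r (fst l)) ^ 6 * (2 / Im z) ^ 3))"
    unfolding F_def using a_pos by (intro mult_left_mono sum_mono ibp_edge[OF z]) auto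
  also have "\<dots> = 24 * a * a\<^sup>2 / (Im z) ^ 3 * (\<Sum>l\<in>L. edge_var p (fst l) * real (r (fst l)) ^ 6)"
    unfolding sum_distrib_left by (intro sum.cong refl) (simp add: power_divide)
  also have "\<dots> \<le> 24 * a * a\<^sup>2 / (Im z) ^ 3 * (2 * (real n)\<^sup>2 * R ^ 4 * tv)"
  proof (intro mult_left_mono edge_sum_bound)
    fix i assume i: "i \<in> {1..k}"
    have "real (r i) ^ 6 = real (r i) ^ 4 * (real (r i))\<^sup>2" by (simp add: power_add[symmetric])
    also have "\<dots> \<le> R ^ 4 * (real (r i))\<^sup>2" using R[OF i] by (intro mult_right_mono power_mono) auto
    finally show "real (r i) ^ 6 \<le> R ^ 4 * (real (r i))\<^sup>2" .
  qed (use a_pos z in auto)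
  also have "\<dots> = 48 * a * R ^ 4 * (real n)\<^sup>2 / (Im z) ^ 3 * (a\<^sup>2 * tv)" by simp
  also have "\<dots> = 48 * a * real n * R ^ 4 / (Im z) ^ 3"
    unfolding a_sq_tv using n_pos by (simp add: power2_eq_square)
  finally show ?thesis unfolding eq .
qed

lemma U_approx: "norm (U x - of_real (tv * mean_coeff) * (tr n (K z x))\<^sup>2) \<le> 44 * tv * real n / (Im z)\<^sup>2"
proof -
  define Y where "Y i = (\<Sum>e\<in>edges i. tr n (mm n (mm n (cm n (Q (i, e))) (K z x)) (mm n (cm n (Q (i, e))) (K z x))))" for i
  have U: "U x = (\<Sum>i=1..k. of_real (edge_var p i) * Y i)"
    using sum_over_L[of "\<lambda>i e. of_real (edge_var p i) * tr n (mm n (mm n (cm n (Q (i, e))) (K z x)) (mm n (cm n (Q (i, e))) (K z x)))"]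
    unfolding U_def tr_TT[OF z] Y_def sum_distrib_left by simp
  have tmean_coeff: "tv * mean_coeff = (\<Sum>i=1..k. edge_var p i * (Nb i * pair_coeff i))"
    unfolding mean_coeff_def sum_distrib_left using tv_pos by (intro sum.cong refl) simp
  have "U x - of_real (tv * mean_coeff) * (tr n (K z x))\<^sup>2
    = (\<Sum>i=1..k. of_real (edge_var p i) * (Y i - of_real (Nb i * pair_coeff i) * (tr n (K z x))\<^sup>2))"
    unfolding U tmean_coeff of_real_sum sum_distrib_right sum_subtractf[symmetric]
    by (intro sum.cong refl) (simp add: algebra_simps)
  then have "norm (U x - of_real (tv * mean_coeff) * (tr n (K z x))\<^sup>2)
    \<le> (\<Sum>i=1..k. norm (of_real (edge_var p i) * (Y i - of_real (Nb i * pair_coeff i) * (tr n (K z x))\<^sup>2)))"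
    by (simp only: norm_sum)
  also have "\<dots> \<le> (\<Sum>i=1..k. edge_var p i * (44 * Nb i * real n / (Im z)\<^sup>2))"
  proof (rule sum_mono)
    fix i assume i: "i \<in> {1..k}"
    show "norm (of_real (edge_var p i) * (Y i - of_real (Nb i * pair_coeff i) * (tr n (K z x))\<^sup>2)) \<le> edge_var p i * (44 * Nb i * real n / (Im z)\<^sup>2)"
      unfolding norm_mult[of "of_real (edge_var p i)"] norm_of_real abs_of_nonneg[OF edge_var_nonneg[OF i]] Y_def
      by (intro mult_left_mono edge_quadratic[OF z i] edge_var_nonneg[OF i])
  qed
  also have "\<dots> = 44 * tv * real n / (Im z)\<^sup>2"
    unfolding tv_eq sum_distrib_left sum_distrib_right sum_divide_distrib by (intro sum.cong refl) simp
  finally show ?thesis .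
qed

lemma second_moment_m: "norm (EV (\<lambda>h. (m z h)\<^sup>2) - (EV (m z))\<^sup>2) \<le> 8 / (real n * (Im z) ^ 4)"
proof -
  let ?c = "4 * a\<^sup>2 / ((real n)\<^sup>2 * (Im z) ^ 4)"
  have "norm (EV (\<lambda>h. (m z h)\<^sup>2) - (EV (m z))\<^sup>2)
    \<le> (\<Sum>l\<in>L. edge_var p (fst l) * (a * (2 * real (r (fst l)) / (Im z)\<^sup>2) / real n)\<^sup>2)"
    by (rule variance_m[OF z])
  also have "\<dots> \<le> 2 * (real n)\<^sup>2 * ?c * tv"
    by (rule edge_sum_bound[where g = "\<lambda>i. (a * (2 * real (r i) / (Im z)\<^sup>2) / real n)\<^sup>2"])
       (simp_all add: power_divide power_mult_distrib power_mult[symmetric] mult_ac)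
  also have "\<dots> = 8 / (Im z) ^ 4 * (a\<^sup>2 * tv)"
    using n_pos by (simp add: power2_eq_square)
  also have "\<dots> = 8 / (real n * (Im z) ^ 4)" unfolding a_sq_tv by simp
  finally show ?thesis .
qed

text \<open>
  Three replacements lead from \<open>trace_identity\<close> to an equation for \<open>S\<close> alone: integration by parts, the
  evaluation of the quadratic sum by \<open>U_approx\<close>, and \<open>second_moment_m\<close> for the square of the mean. The
  shift by \<open>1 / (n z)\<close> between \<open>G\<close> and \<open>K\<close> is also of order \<open>1 / n\<close>.
\<close>

theorem self_consistent:
  assumes R: "\<And>i. i \<in> {1..k} \<Longrightarrow> real (r i) \<le> R"
  defines "S \<equiv> EV (m z)"
  shows "norm (z * S + 1 + of_real mean_coeff * S\<^sup>2)
    \<le> 48 * a * R ^ 4 / (Im z) ^ 3 + (50 / (Im z)\<^sup>2 + 16 / (Im z) ^ 4) / real n"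
proof -
  define \<eta> where "\<eta> = Im z"
  have \<eta>: "\<eta> > 0" using z by (simp add: \<eta>_def)
  define W where "W h = m z h + 1 / (of_nat n * z)" for h
  have nC: "(of_nat n :: complex) \<noteq> 0" using n4 by simp
  have trK: "tr n (K z (X h)) = of_nat n * W h" for h
    unfolding tr_K[OF z] W_def m_def[OF z] using nC z_nz[OF z] by (simp add: algebra_simps)
  have trG: "tr n (G z (X h)) = of_nat n * m z h" for h
    unfolding m_def[OF z] using nC by simp
  have U1: "norm (of_real (a\<^sup>2) * EV (\<lambda>h. U (X h)) - of_nat n * (of_real mean_coeff * EV (\<lambda>h. (W h)\<^sup>2))) \<le> 44 / \<eta>\<^sup>2"
  proof -
    have "of_nat n * (of_real mean_coeff * w\<^sup>2) = of_real (a\<^sup>2) * (of_real (tv * mean_coeff) * (of_nat n * w)\<^sup>2)" for w :: complex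
    proof -
      have "of_real (a\<^sup>2) * (of_real (tv * mean_coeff) * (of_nat n * w)\<^sup>2) = of_real (a\<^sup>2 * tv) * of_real mean_coeff * (of_nat n)\<^sup>2 * w\<^sup>2"
        by (simp add: power_mult_distrib)
      also have "\<dots> = of_nat n * (of_real mean_coeff * w\<^sup>2)"
        unfolding a_sq_tv using nC by (simp add: power2_eq_square)
      finally show ?thesis by (rule sym)
    qed
    note e = this
    have "EV (\<lambda>h. of_real (a\<^sup>2) * (U (X h) - of_real (tv * mean_coeff) * (tr n (K z (X h)))\<^sup>2))
      = EV (\<lambda>h. of_real (a\<^sup>2) * U (X h) - of_nat n * (of_real mean_coeff * (W h)\<^sup>2))"
      unfolding trK right_diff_distrib e ..
    then have eqU: "of_real (a\<^sup>2) * EV (\<lambda>h. U (X h)) - of_nat n * (of_real mean_coeff * EV (\<lambda>h. (W h)\<^sup>2))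
      = EV (\<lambda>h. of_real (a\<^sup>2) * (U (X h) - of_real (tv * mean_coeff) * (tr n (K z (X h)))\<^sup>2))"
      by simp
    have nU: "norm (EV (\<lambda>h. of_real (a\<^sup>2) * (U (X h) - of_real (tv * mean_coeff) * (tr n (K z (X h)))\<^sup>2))) \<le> a\<^sup>2 * (44 * tv * real n / \<eta>\<^sup>2)"
    proof (rule norm_EV_le)
      fix h
      show "norm (of_real (a\<^sup>2) * (U (X h) - of_real (tv * mean_coeff) * (tr n (K z (X h)))\<^sup>2)) \<le> a\<^sup>2 * (44 * tv * real n / \<eta>\<^sup>2)"
        unfolding norm_mult[of "of_real (a\<^sup>2)"] norm_of_real abs_power2 \<eta>_def by (intro mult_left_mono U_approx) simp
    qed
    have "a\<^sup>2 * (44 * tv * real n / \<eta>\<^sup>2) = 44 * real n / \<eta>\<^sup>2 * (a\<^sup>2 * tv)" by simp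
    also have "\<dots> = 44 / \<eta>\<^sup>2" unfolding a_sq_tv using n_pos by simp
    finally show ?thesis using nU unfolding eqU by (simp only:)
  qed
  have main: "norm (of_nat n * (z * S + 1 + of_real mean_coeff * EV (\<lambda>h. (W h)\<^sup>2))) \<le> 48 * a * real n * R ^ 4 / \<eta> ^ 3 + 44 / \<eta>\<^sup>2"
  proof -
    have "of_nat n * (z * S + 1 + of_real mean_coeff * EV (\<lambda>h. (W h)\<^sup>2))
      = (z * EV (\<lambda>h. tr n (G z (X h))) + of_nat n + of_real (a\<^sup>2) * EV (\<lambda>h. U (X h)))
       - (of_real (a\<^sup>2) * EV (\<lambda>h. U (X h)) - of_nat n * (of_real mean_coeff * EV (\<lambda>h. (W h)\<^sup>2)))"
      unfolding trG S_def by (simp add: algebra_simps)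
    then show ?thesis
      by (rule norm_eq_diff_le) (use expected_trace_approx[OF R] U1 in \<open>simp_all only: \<eta>_def\<close>)
  qed
  then have A: "norm (z * S + 1 + of_real mean_coeff * EV (\<lambda>h. (W h)\<^sup>2)) \<le> 48 * a * R ^ 4 / \<eta> ^ 3 + 44 / \<eta>\<^sup>2 / real n"
  proof -
    define V where "V = z * S + 1 + of_real mean_coeff * EV (\<lambda>h. (W h)\<^sup>2)"
    have "real n * norm V \<le> 48 * a * real n * R ^ 4 / \<eta> ^ 3 + 44 / \<eta>\<^sup>2"
      using main unfolding V_def[symmetric] norm_mult norm_of_nat .
    also have "\<dots> = real n * (48 * a * R ^ 4 / \<eta> ^ 3 + 44 / \<eta>\<^sup>2 / real n)"
      using n_pos by (simp add: distrib_left)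
    finally show ?thesis using n_pos unfolding V_def[symmetric] by (simp only: mult_le_cancel_left_pos)
  qed
  have B: "norm (EV (\<lambda>h. (W h)\<^sup>2) - EV (\<lambda>h. (m z h)\<^sup>2)) \<le> 3 / (real n * \<eta>\<^sup>2)"
  proof -
    have "EV (\<lambda>h. (W h)\<^sup>2) - EV (\<lambda>h. (m z h)\<^sup>2) = EV (\<lambda>h. (W h)\<^sup>2 - (m z h)\<^sup>2)" by simp
    moreover have "norm (EV (\<lambda>h. (W h)\<^sup>2 - (m z h)\<^sup>2)) \<le> 3 / (real n * \<eta>\<^sup>2)"
    proof (rule norm_EV_le)
      fix h
      let ?d = "1 / (of_nat n * z)"
      have "(W h)\<^sup>2 - (m z h)\<^sup>2 = ?d * (2 * m z h + ?d)" by (simp add: W_def power2_eq_square algebra_simps)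
      also have "norm \<dots> \<le> 1 / (real n * \<eta>) * (3 / \<eta>)"
        unfolding norm_mult[of ?d]
      proof (intro mult_mono)
        show "norm ?d \<le> 1 / (real n * \<eta>)" unfolding \<eta>_def by (rule shift_bound[OF z])
        have "norm (2 * m z h + ?d) \<le> 2 * norm (m z h) + norm ?d"
          by (rule order_trans[OF norm_triangle_ineq]) (simp add: norm_mult)
        also have "\<dots> \<le> 2 * (1 / \<eta>) + 1 / \<eta>"
          unfolding \<eta>_def by (intro add_mono mult_left_mono norm_m_le[OF z] shift_bound'[OF z]) simp
        finally show "norm (2 * m z h + ?d) \<le> 3 / \<eta>" by simp
      qed (use \<eta> n_pos in auto)
      finally show "norm ((W h)\<^sup>2 - (m z h)\<^sup>2) \<le> 3 / (real n * \<eta>\<^sup>2)" by (simp add: power2_eq_square)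
    qed
    ultimately show ?thesis by simp
  qed
  have C: "norm (EV (\<lambda>h. (W h)\<^sup>2) - S\<^sup>2) \<le> 3 / (real n * \<eta>\<^sup>2) + 8 / (real n * \<eta> ^ 4)"
  proof -
    have "EV (\<lambda>h. (W h)\<^sup>2) - S\<^sup>2 = (EV (\<lambda>h. (W h)\<^sup>2) - EV (\<lambda>h. (m z h)\<^sup>2)) + (EV (\<lambda>h. (m z h)\<^sup>2) - S\<^sup>2)" by simp
    then show ?thesis
      by (rule norm_eq_add_le[OF _ B]) (use second_moment_m in \<open>simp only: S_def \<eta>_def\<close>)
  qed
  have D: "norm (of_real mean_coeff * (EV (\<lambda>h. (W h)\<^sup>2) - S\<^sup>2)) \<le> 2 * (3 / (real n * \<eta>\<^sup>2) + 8 / (real n * \<eta> ^ 4))"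
    unfolding norm_mult norm_of_real using mean_coeff_bound C by (intro mult_mono) auto
  have "z * S + 1 + of_real mean_coeff * S\<^sup>2 = (z * S + 1 + of_real mean_coeff * EV (\<lambda>h. (W h)\<^sup>2)) - of_real mean_coeff * (EV (\<lambda>h. (W h)\<^sup>2) - S\<^sup>2)"
    by (simp add: algebra_simps)
  then have "norm (z * S + 1 + of_real mean_coeff * S\<^sup>2) \<le> (48 * a * R ^ 4 / \<eta> ^ 3 + 44 / \<eta>\<^sup>2 / real n) + 2 * (3 / (real n * \<eta>\<^sup>2) + 8 / (real n * \<eta> ^ 4))"
    by (rule norm_eq_diff_le[OF _ A D])
  also have "\<dots> = 48 * a * R ^ 4 / \<eta> ^ 3 + (50 / \<eta>\<^sup>2 + 16 / \<eta> ^ 4) / real n"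
    by (simp add: divide_inverse algebra_simps)
  finally show ?thesis unfolding \<eta>_def .
qed

lemma Im_S_nonneg: "0 \<le> Im (EV (m z))"
proof -
  have "0 \<le> Im (m z h)" for h
  proof -
    have "pi * measure_pmf.expectation (esd (Matrix.mat n n (\<lambda>(i, j). HP (X h) i j))) (\<lambda>x. poisson (Im z) (Re z - x))
      = Im (tr n (res n (HP (X h)) (Complex (Re z) (Im z))) / of_nat n)"
      by (rule esd_poisson_eq_trace) (use n4 symm_HP z in auto)
    moreover have "0 \<le> measure_pmf.expectation (esd (Matrix.mat n n (\<lambda>(i, j). HP (X h) i j))) (\<lambda>x. poisson (Im z) (Re z - x))"
      by (intro integral_nonneg_AE) (simp add: poisson_nonneg z)
    ultimately show ?thesis unfolding m_def[OF z]
      by (simp del: Im_divide_of_nat) (metis mult_nonneg_nonneg pi_ge_zero)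
  qed
  then show ?thesis unfolding EV_Im[OF z, symmetric] by (intro integral_nonneg_AE) simp
qed

text \<open>
  Since \<open>E |h|\<^sup>2 \<le> 2 n\<^sup>2\<close> for the vector \<open>h\<close> of row sums, also \<open>E |h|\<close> is of order \<open>n\<close>.
\<close>

lemma unprojected_close:
  "norm (EV (\<lambda>h. tr n (res n (H (X h)) z) / of_nat n) - EV (m z)) \<le> 5 / (sqrt n * (Im z)\<^sup>2)"
proof -
  let ?v = "\<lambda>h. vnorm n (hv (X h))"
  define C where "C = 3 * sqrt n / ((real n)\<^sup>2 * (Im z)\<^sup>2)"
  have C0: "0 \<le> C" by (simp add: C_def)
  have "(\<Sum>l\<in>L. edge_var p (fst l) * ((real (r (fst l)) - 1)\<^sup>2 * real (r (fst l)))) \<le> 2 * (real n)\<^sup>2 * real n * tv"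
  proof (rule edge_sum_bound)
    fix i assume i: "i \<in> {1..k}"
    have "(real (r i) - 1)\<^sup>2 * real (r i) \<le> (real (r i))\<^sup>2 * real n"
      using r[OF i] by (intro mult_mono power_mono) auto
    then show "(real (r i) - 1)\<^sup>2 * real (r i) \<le> real n * (real (r i))\<^sup>2" by (simp add: mult.commute)
  qed simp
  then have "EV (\<lambda>h. (?v h)\<^sup>2) \<le> a\<^sup>2 * (2 * (real n)\<^sup>2 * real n * tv)"
    by (intro order_trans[OF second_moment_hv] mult_left_mono) auto
  also have "\<dots> = 2 * (real n)\<^sup>2 * real n * (a\<^sup>2 * tv)" by (simp only: mult_ac)
  also have "\<dots> = 2 * (real n)\<^sup>2" unfolding a_sq_tv using n_pos by simp
  finally have v2: "EV (\<lambda>h. (?v h)\<^sup>2) \<le> 2 * (real n)\<^sup>2" .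
  have "EV ?v \<le> EV (\<lambda>h. ((?v h)\<^sup>2 / real n + real n) / 2)"
  proof (intro integral_mono integrable_Omega)
    fix h
    \<comment> \<open>The scale \<open>n\<close> balances the two terms, because the second moment is of order \<open>n\<^sup>2\<close>.\<close>
    have "0 \<le> (?v h - real n)\<^sup>2" by simp
    then have "2 * ?v h * real n \<le> (?v h)\<^sup>2 + (real n)\<^sup>2" by (simp add: power2_diff)
    then show "?v h \<le> ((?v h)\<^sup>2 / real n + real n) / 2"
      using n_pos by (simp add: field_simps power2_eq_square)
  qed
  also have "\<dots> = (EV (\<lambda>h. (?v h)\<^sup>2) / real n + real n) / 2" by simp
  also have "\<dots> \<le> (2 * (real n)\<^sup>2 / real n + real n) / 2"
    using v2 by (intro divide_right_mono add_right_mono) auto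
  also have "\<dots> = 3 / 2 * real n" using n_pos by (simp add: power2_eq_square)
  finally have v1: "EV ?v \<le> 3 / 2 * real n" .
  have "EV (\<lambda>h. tr n (res n (H (X h)) z) / of_nat n) - EV (m z)
    = EV (\<lambda>h. (tr n (res n (H (X h)) z) - tr n (G z (X h))) / of_nat n)"
    unfolding m_def[OF z] by (simp add: diff_divide_distrib)
  then have "norm (EV (\<lambda>h. tr n (res n (H (X h)) z) / of_nat n) - EV (m z))
    \<le> EV (\<lambda>h. norm ((tr n (res n (H (X h)) z) - tr n (G z (X h))) / of_nat n))"
    by (simp only: integral_norm_bound)
  also have "\<dots> \<le> EV (\<lambda>h. C * ?v h)"
  proof (intro integral_mono integrable_Omega)
    fix h
    have "norm ((tr n (res n (H (X h)) z) - tr n (G z (X h))) / of_nat n) = norm (tr n (res n (H (X h)) z) - tr n (G z (X h))) / real n"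
      by (simp add: norm_divide)
    also have "\<dots> \<le> 3 * ?v h * sqrt n / (real n * (Im z)\<^sup>2) / real n"
      by (intro divide_right_mono projection_trace_bound[OF z]) simp
    also have "\<dots> = C * ?v h" by (simp add: C_def power2_eq_square mult_ac)
    finally show "norm ((tr n (res n (H (X h)) z) - tr n (G z (X h))) / of_nat n) \<le> C * ?v h" .
  qed
  also have "\<dots> = C * EV ?v" by simp
  also have "\<dots> \<le> C * (3 / 2 * real n)" using v1 C0 by (rule mult_left_mono)
  also have "\<dots> = (9 / 2) / (sqrt n * (Im z)\<^sup>2)"
  proof -
    have "C * (3 / 2 * real n) = 9 / 2 * (sqrt n / real n) / (Im z)\<^sup>2"
      using n_pos by (simp add: C_def power2_eq_square)
    moreover have "sqrt n / real n = 1 / sqrt n"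
      by (simp only: sqrt_divide_self_eq[OF of_nat_0_le_iff] inverse_eq_divide)
    ultimately show ?thesis by (simp only:) simp
  qed
  also have "\<dots> \<le> 5 / (sqrt n * (Im z)\<^sup>2)"
    by (intro divide_right_mono) auto
  finally show ?thesis .
qed

end

end

section \<open>Passage to the limit\<close>

context hypergraph_model
begin

text \<open>
  What the limit argument needs, free of resolvents: the mean spectral law has nearly the Poisson
  integrals of a number \<open>S\<close> that nearly solves the quadratic equation.
\<close>

lemma stieltjes_summary:
  assumes \<eta>: "\<eta> > 0" and R: "\<And>i. i \<in> {1..k} \<Longrightarrow> real (r i) \<le> R"
  shows "\<exists>S. 0 \<le> Im S \<and> norm S \<le> 1 / \<eta>
    \<and> norm (Complex E \<eta> * S + 1 + of_real mean_coeff * S\<^sup>2) \<le> 48 * a * R ^ 4 / \<eta> ^ 3 + (50 / \<eta>\<^sup>2 + 16 / \<eta> ^ 4) / real n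
    \<and> \<bar>pi * (\<integral>x. poisson \<eta> (E - x) \<partial>mean_esd (random_hypergraph k n r p)
          (\<lambda>h. H_matrix k n r p (centered_indicators k n r p h))) - Im S\<bar> \<le> 5 / (sqrt n * \<eta>\<^sup>2)"
proof -
  define z where "z = Complex E \<eta>"
  have z: "Im z > 0" and Imz: "Im z = \<eta>" using \<eta> by (auto simp: z_def)
  define S where "S = EV (m z)"
  have cont: "continuous_on UNIV (\<lambda>x. poisson \<eta> (E - x))"
    unfolding poisson_def using \<eta> by (intro continuous_intros) (auto simp: add_nonneg_eq_0_iff)
  have bd: "\<bar>poisson \<eta> (E - x)\<bar> \<le> 1 / (pi * \<eta>)" for x
    using poisson_le[OF \<eta>] poisson_nonneg[OF \<eta>] by simp
  have "pi * (\<integral>x. poisson \<eta> (E - x) \<partial>mean_esd (random_hypergraph k n r p)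
          (\<lambda>h. H_matrix k n r p (centered_indicators k n r p h)))
    = EV (\<lambda>h. pi * measure_pmf.expectation (esd (Matrix.mat n n (\<lambda>(i, j). H (X h) i j))) (\<lambda>x. poisson \<eta> (E - x)))"
    unfolding integral_mean_esd[OF cont bd] H_matrix_eq random_hypergraph_eq by simp
  also have "\<dots> = EV (\<lambda>h. Im (tr n (res n (H (X h)) z) / of_nat n))"
    unfolding z_def by (intro Bochner_Integration.integral_cong refl esd_poisson_eq_trace) (use n4 symm_H \<eta> in auto)
  also have "\<dots> = Im (EV (\<lambda>h. tr n (res n (H (X h)) z) / of_nat n))" by (rule EV_Im[OF z])
  finally have eq: "pi * (\<integral>x. poisson \<eta> (E - x) \<partial>mean_esd (random_hypergraph k n r p)
          (\<lambda>h. H_matrix k n r p (centered_indicators k n r p h))) - Im S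
    = Im (EV (\<lambda>h. tr n (res n (H (X h)) z) / of_nat n) - S)" by simp
  have close: "\<bar>Im (EV (\<lambda>h. tr n (res n (H (X h)) z) / of_nat n) - S)\<bar> \<le> 5 / (sqrt n * \<eta>\<^sup>2)"
    using unprojected_close[OF z] unfolding Imz S_def by (rule order_trans[OF abs_Im_le_cmod])
  show ?thesis
  proof (intro exI conjI)
    show "0 \<le> Im S" unfolding S_def by (rule Im_S_nonneg[OF z])
    show "norm S \<le> 1 / \<eta>"
      unfolding S_def Imz[symmetric] by (rule norm_EV_le) (rule norm_m_le[OF z])
    show "norm (Complex E \<eta> * S + 1 + of_real mean_coeff * S\<^sup>2) \<le> 48 * a * R ^ 4 / \<eta> ^ 3 + (50 / \<eta>\<^sup>2 + 16 / \<eta> ^ 4) / real n"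
      using self_consistent[OF z R] unfolding z_def[symmetric] S_def Imz .
    show "\<bar>pi * (\<integral>x. poisson \<eta> (E - x) \<partial>mean_esd (random_hypergraph k n r p)
          (\<lambda>h. H_matrix k n r p (centered_indicators k n r p h))) - Im S\<bar> \<le> 5 / (sqrt n * \<eta>\<^sup>2)"
      unfolding eq by (rule close)
  qed
qed

end

text \<open>
  The difference of the quadratic polynomial at two points factors as
  \<open>(S - m) (z + v (S + m))\<close>, and the second factor has imaginary part at least \<open>Im z\<close>.
\<close>

lemma self_consistent_stability:
  fixes S m z :: complex and v :: real
  assumes v: "0 \<le> v" and S: "0 \<le> Im S" and m: "0 \<le> Im m" "of_real v * m\<^sup>2 + z * m + 1 = 0" and z: "Im z > 0"
  shows "norm (S - m) \<le> norm (z * S + 1 + of_real v * S\<^sup>2) / Im z"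
proof -
  have "z * S + 1 + of_real v * S\<^sup>2 = (z * S + 1 + of_real v * S\<^sup>2) - (of_real v * m\<^sup>2 + z * m + 1)"
    using m(2) by simp
  also have "\<dots> = (S - m) * (z + of_real v * (S + m))"
    by (simp add: power2_eq_square algebra_simps)
  finally have "norm (z * S + 1 + of_real v * S\<^sup>2) = norm (S - m) * norm (z + of_real v * (S + m))"
    by (simp add: norm_mult)
  moreover have "Im z \<le> norm (z + of_real v * (S + m))"
  proof -
    have "Im z \<le> Im (z + of_real v * (S + m))" using v S m by simp
    also have "\<dots> \<le> norm (z + of_real v * (S + m))" using abs_Im_le_cmod[of "z + of_real v * (S + m)"] by linarith
    finally show ?thesis .
  qed
  ultimately have "norm (S - m) * Im z \<le> norm (z * S + 1 + of_real v * S\<^sup>2)"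
    by (simp add: mult_left_mono)
  then show ?thesis using z by (simp add: pos_le_divide_eq)
qed

text \<open>
  With \<open>N\<^sub>i\<close> the number of \<open>r\<^sub>i\<close>-edges through two given vertices, \<open>r\<^sub>i d\<^sub>i\<close> is \<open>n N\<^sub>i p\<^sub>i\<close> up to a factor \<open>2\<close>, and \<open>p\<^sub>i\<close>
  is comparable to the variance because \<open>1 - p\<^sub>i\<close> stays away from \<open>0\<close>. The other factors are estimated
  crudely, by \<open>1 / r\<^sub>i\<^sup>2 \<ge> 1 / R\<^sup>2\<close> with \<open>R\<close> the largest size, which turns the power \<open>16\<close> into \<open>10\<close>.
\<close>

lemma growth_comparison:
  fixes r :: "nat \<Rightarrow> nat" and p w :: "nat \<Rightarrow> real"
  assumes k: "1 \<le> k" and n: "2 \<le> n"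
    and mod: "\<And>i. i \<in> {1..k} \<Longrightarrow> 2 \<le> r i \<and> r i \<le> n \<and> 0 \<le> p i \<and> p i \<le> 1"
    and w: "\<And>i. i \<in> {1..k} \<Longrightarrow> 0 \<le> w i" "(\<Sum>i=1..k. w i) = 1"
    and e: "0 < e" "\<And>i. i \<in> {1..k} \<Longrightarrow> e \<le> 1 - p i"
  shows "(\<Sum>i=1..k. real (r i) * avg_degree n r p i)\<^sup>2 /
           (real (r_max k r) ^ 16 * (xi k r w)\<^sup>2 * (\<Sum>i=1..k. avg_degree n r p i / real (r i)))
     \<le> 2 / e * (real n * total_var k n r p / real (r_max k r) ^ 10)"
proof -
  define R where "R = real (r_max k r)"
  define B where "B = (\<Sum>i=1..k. real (r i) * avg_degree n r p i)"
  define D where "D = (\<Sum>i=1..k. avg_degree n r p i / real (r i))"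
  have rR: "real (r i) \<le> R" if "i \<in> {1..k}" for i
    unfolding R_def r_max_def using that by simp
  have R2: "2 \<le> R" using rR[of 1] mod[of 1] k by simp
  have d0: "0 \<le> avg_degree n r p i" if "i \<in> {1..k}" for i
    using mod[OF that] by (simp add: avg_degree_def)
  have B0: "0 \<le> B" unfolding B_def by (intro sum_nonneg mult_nonneg_nonneg d0) auto
  have xi: "1 / R\<^sup>2 \<le> xi k r w"
  proof -
    have "1 / R\<^sup>2 = (\<Sum>i=1..k. w i * (1 / R\<^sup>2))" unfolding sum_distrib_right[symmetric] w(2) by simp
    also have "\<dots> \<le> xi k r w" unfolding xi_def
    proof (intro sum_mono mult_left_mono w(1) divide_left_mono power_mono)
      fix i assume "i \<in> {1..k}"
      then show "0 < R\<^sup>2 * (real (r i))\<^sup>2" using mod[of i] R2 by simp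
    qed (use rR in auto)
    finally show ?thesis .
  qed
  have D: "B / R\<^sup>2 \<le> D"
    unfolding B_def D_def sum_divide_distrib
  proof (rule sum_mono)
    fix i assume i: "i \<in> {1..k}"
    have ri: "0 < real (r i)" using mod[OF i] by simp
    have "(real (r i))\<^sup>2 \<le> R\<^sup>2" using rR[OF i] by (intro power_mono) auto
    then have "avg_degree n r p i * (real (r i))\<^sup>2 \<le> avg_degree n r p i * R\<^sup>2"
      using d0[OF i] by (intro mult_left_mono)
    then show "real (r i) * avg_degree n r p i / R\<^sup>2 \<le> avg_degree n r p i / real (r i)"
      using ri R2 by (simp add: divide_simps power2_eq_square mult_ac)
  qed
  have Bub: "B \<le> 2 / e * (real n * total_var k n r p)"
  proof -
    have "B \<le> (\<Sum>i=1..k. 2 / e * real n * (real ((n - 2) choose (r i - 2)) * edge_var p i))"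
      unfolding B_def
    proof (rule sum_mono)
      fix i assume i: "i \<in> {1..k}"
      have ri: "2 \<le> r i" "r i \<le> n" and pi: "0 \<le> p i" "p i \<le> 1" using mod[OF i] by auto
      define N where "N = real ((n - 2) choose (r i - 2))"
      have "(r i - 1) * ((n - 1) choose (r i - 1)) = (n - 1) * ((n - 1 - 1) choose (r i - 1 - 1))"
        using times_binomial_minus1_eq[of "r i - 1" "n - 1"] ri by simp
      moreover have "n - 1 - 1 = n - 2" "r i - 1 - 1 = r i - 2" by auto
      ultimately have "real ((r i - 1) * ((n - 1) choose (r i - 1))) = real ((n - 1) * ((n - 2) choose (r i - 2)))" by simp
      then have b: "(real (r i) - 1) * real ((n - 1) choose (r i - 1)) = (real n - 1) * N"
        using ri by (simp add: of_nat_diff N_def)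
      have "real (r i) * real ((n - 1) choose (r i - 1)) \<le> 2 * (real (r i) - 1) * real ((n - 1) choose (r i - 1))"
        using ri by (intro mult_right_mono) auto
      also have "\<dots> = 2 * ((real n - 1) * N)" unfolding b[symmetric] by (simp only: mult.assoc)
      also have "\<dots> \<le> 2 * (real n * N)" by (intro mult_left_mono mult_right_mono) (auto simp: N_def)
      finally have c: "real (r i) * real ((n - 1) choose (r i - 1)) \<le> 2 * (real n * N)" .
      have "e * p i \<le> edge_var p i"
        using mult_left_mono[OF e(2)[OF i] pi(1)] by (simp add: edge_var_def mult.commute)
      then have pe: "p i \<le> edge_var p i / e" using e(1) by (simp add: pos_le_divide_eq mult.commute)
      have "real (r i) * avg_degree n r p i = (real (r i) * real ((n - 1) choose (r i - 1))) * p i"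
        by (simp add: avg_degree_def)
      also have "\<dots> \<le> (2 * (real n * N)) * (edge_var p i / e)"
        by (rule mult_mono[OF c pe]) (use pi in \<open>auto simp: N_def\<close>)
      finally show "real (r i) * avg_degree n r p i \<le> 2 / e * real n * (real ((n - 2) choose (r i - 2)) * edge_var p i)"
        by (simp add: N_def mult_ac)
    qed
    also have "\<dots> = 2 / e * (real n * total_var k n r p)"
      by (simp add: total_var_def sum_distrib_left mult_ac)
    finally show ?thesis .
  qed
  have "B\<^sup>2 / (R ^ 16 * (xi k r w)\<^sup>2 * D) \<le> B / R ^ 10"
  proof (cases "B = 0")
    case False
    then have Bp: "0 < B" using B0 by simp
    have "B * R ^ 10 = R ^ 16 * (1 / R\<^sup>2)\<^sup>2 * (B / R\<^sup>2)"
      using R2 by (simp add: field_simps power_add[symmetric] power_mult[symmetric])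
    also have "\<dots> \<le> R ^ 16 * (xi k r w)\<^sup>2 * D"
      using xi D R2 Bp by (intro mult_mono power_mono) auto
    finally have den: "B * R ^ 10 \<le> R ^ 16 * (xi k r w)\<^sup>2 * D" .
    have pos: "0 < B * R ^ 10" using Bp R2 by simp
    have "B\<^sup>2 / (R ^ 16 * (xi k r w)\<^sup>2 * D) \<le> B\<^sup>2 / (B * R ^ 10)"
      using den pos by (intro divide_left_mono) auto
    also have "\<dots> = B / R ^ 10" using Bp by (simp add: power2_eq_square)
    finally show ?thesis .
  qed (use R2 in simp)
  also have "\<dots> \<le> 2 / e * (real n * total_var k n r p) / R ^ 10"
    using Bub R2 by (intro divide_right_mono) auto
  finally show ?thesis by (simp add: B_def D_def R_def)
qed

lemma tendsto_thetas:
  fixes r :: "nat \<Rightarrow> nat"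
  assumes "(\<lambda>n. real (r n) / real n) \<longlonglongrightarrow> c"
  shows "(\<lambda>n. 1 - 2 * ((real (r n) - 2) / (real n - 2))
    + (real (r n) - 2) * (real (r n) - 3) / ((real n - 2) * (real n - 3))) \<longlonglongrightarrow> (1 - c)\<^sup>2"
proof -
  have lim: "(\<lambda>n. (real (r n) - d) / (real n - d)) \<longlonglongrightarrow> c" for d :: real
  proof -
    have inv: "(\<lambda>n. d / real n) \<longlonglongrightarrow> 0" by (rule lim_const_over_n)
    have "(\<lambda>n. (real (r n) / real n - d / real n) / (1 - d / real n)) \<longlonglongrightarrow> (c - 0) / (1 - 0)"
      by (intro tendsto_intros assms inv) simp
    moreover have "\<forall>\<^sub>F n in sequentially. (real (r n) / real n - d / real n) / (1 - d / real n) = (real (r n) - d) / (real n - d)"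
      using eventually_gt_at_top[of 0]
    proof eventually_elim
      case (elim n)
      then have "real (r n) / real n - d / real n = (real (r n) - d) / real n" "1 - d / real n = (real n - d) / real n"
        by (simp_all add: field_simps)
      then show ?case using elim by simp
    qed
    ultimately show ?thesis by (simp add: tendsto_cong)
  qed
  have quo: "(\<lambda>n. (real (r n) - 3) / (real n - 3) * ((real (r n) - 2) / (real n - 2))) \<longlonglongrightarrow> c * c"
    by (intro tendsto_mult lim)
  have "(\<lambda>n. 1 - 2 * ((real (r n) - 2) / (real n - 2)) + (real (r n) - 3) / (real n - 3) * ((real (r n) - 2) / (real n - 2)))
     \<longlonglongrightarrow> 1 - 2 * c + c * c"
    by (intro tendsto_intros lim quo)
  then show ?thesis by (simp add: power2_eq_square algebra_simps)
qed

theorem theorem3p4: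
  fixes k :: nat
    and r :: "nat \<Rightarrow> nat \<Rightarrow> nat"
    and p :: "nat \<Rightarrow> nat \<Rightarrow> real"
    and w c :: "nat \<Rightarrow> real"
  assumes k: "1 \<le> k"
    and model: "\<forall>\<^sub>F n in sequentially.
      \<forall>i\<in>{1..k}. 2 \<le> r n i \<and> r n i \<le> n \<and> 0 \<le> p n i \<and> p n i \<le> 1"
    and var_pos: "\<forall>\<^sub>F n in sequentially. total_var k n (r n) (p n) > 0"
    and weights: "\<And>i. i \<in> {1..k} \<Longrightarrow>
      (\<lambda>n. real ((n - 2) choose (r n i - 2)) * edge_var (p n) i /
           (\<Sum>j=1..k. real ((n - 2) choose (r n j - 2)) * edge_var (p n) j)) \<longlonglongrightarrow> w i"
    and sizes: "\<And>i. i \<in> {1..k} \<Longrightarrow> (\<lambda>n. real (r n i) / real n) \<longlonglongrightarrow> c i"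
    and c_range: "\<And>i. i \<in> {1..k} \<Longrightarrow> 0 \<le> c i \<and> c i < 1"
    and probs: "\<And>i. i \<in> {1..k} \<Longrightarrow> (\<lambda>n. 1 - p n i) \<in> \<Theta>(\<lambda>n. 1)"
    and growth: "filterlim
      (\<lambda>n. (\<Sum>i=1..k. real (r n i) * avg_degree n (r n) (p n) i)\<^sup>2 /
           (real (r_max k (r n)) ^ 16 * (xi k (r n) w)\<^sup>2 *
            (\<Sum>i=1..k. avg_degree n (r n) (p n) i / real (r n i))))
      at_top sequentially"
  shows "weak_conv_m
    (\<lambda>n. mean_esd (random_hypergraph k n (r n) (p n))
           (\<lambda>h. H_matrix k n (r n) (p n) (centered_indicators k n (r n) (p n) h)))
    (semicircle (\<Sum>i=1..k. w i * (1 - c i)\<^sup>2))"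
proof -
  define v where "v = (\<Sum>i=1..k. w i * (1 - c i)\<^sup>2)"
  define t where "t n = total_var k n (r n) (p n)" for n
  define W where "W n i = real ((n - 2) choose (r n i - 2)) * edge_var (p n) i / t n" for n i
  define R where "R n = real (r_max k (r n))" for n
  define \<mu> where "\<mu> n = mean_esd (random_hypergraph k n (r n) (p n))
           (\<lambda>h. H_matrix k n (r n) (p n) (centered_indicators k n (r n) (p n) h))" for n
  have mod: "\<forall>\<^sub>F n in sequentially. hypergraph_model k n (r n) (p n)"
    using model var_pos eventually_ge_at_top[of 4]
    by eventually_elim (auto simp: hypergraph_model_def)
  have W_lim: "(\<lambda>n. W n i) \<longlonglongrightarrow> w i" if "i \<in> {1..k}" for i
    using weights[OF that] by (simp add: W_def t_def total_var_def)
  have W_nn: "\<forall>\<^sub>F n in sequentially. 0 \<le> W n i" if i: "i \<in> {1..k}" for i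
    using model var_pos by eventually_elim (use i in \<open>auto simp: W_def t_def edge_var_def\<close>)
  have w_nn: "0 \<le> w i" if "i \<in> {1..k}" for i
    by (rule tendsto_lowerbound[OF W_lim[OF that] W_nn[OF that]]) simp
  have w_sum: "(\<Sum>i=1..k. w i) = 1"
  proof (rule tendsto_unique[OF sequentially_bot])
    show "(\<lambda>n. \<Sum>i=1..k. W n i) \<longlonglongrightarrow> (\<Sum>i=1..k. w i)" by (intro tendsto_sum W_lim)
    have "\<forall>\<^sub>F n in sequentially. 1 = (\<Sum>i=1..k. W n i)"
      using var_pos by eventually_elim (auto simp: W_def t_def sum_divide_distrib[symmetric] total_var_def)
    then show "(\<lambda>n. \<Sum>i=1..k. W n i) \<longlonglongrightarrow> 1" by (rule Lim_transform_eventually[OF tendsto_const])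
  qed
  have v_pos: "v > 0"
  proof -
    obtain j where j: "j \<in> {1..k}" "w j > 0"
    proof -
      have "\<exists>j\<in>{1..k}. w j \<noteq> 0" using w_sum by (metis sum.neutral zero_neq_one)
      then show ?thesis using that w_nn by (metis less_le)
    qed
    have "0 < w j * (1 - c j)\<^sup>2" using j c_range[OF j(1)] by simp
    also have "\<dots> \<le> v" unfolding v_def using w_nn by (intro member_le_sum j) auto
    finally show ?thesis .
  qed
  define \<theta> where "\<theta> n = (\<Sum>i=1..k. W n i * (1 - 2 * ((real (r n i) - 2) / (real n - 2))
    + (real (r n i) - 2) * (real (r n i) - 3) / ((real n - 2) * (real n - 3))))" for n
  have \<theta>_lim: "\<theta> \<longlonglongrightarrow> v"
    unfolding \<theta>_def v_def by (intro tendsto_sum tendsto_mult W_lim tendsto_thetas sizes)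
  obtain e where e: "e > 0" "\<forall>\<^sub>F n in sequentially. \<forall>i\<in>{1..k}. e \<le> 1 - p n i"
  proof -
    have "\<exists>d>0. \<forall>\<^sub>F n in sequentially. d \<le> 1 - p n i" if i: "i \<in> {1..k}" for i
    proof -
      have "(\<lambda>n. 1 - p n i) \<in> \<Omega>(\<lambda>n. 1)" using probs[OF i] by (rule bigthetaD2)
      then obtain d where d: "d > 0" "\<forall>\<^sub>F n in sequentially. norm (1 - p n i) \<ge> d * norm (1 :: real)"
        by (elim landau_omega.bigE)
      have "\<forall>\<^sub>F n in sequentially. d \<le> 1 - p n i"
        using d(2) model by eventually_elim (use i in auto)
      with d(1) show ?thesis by blast
    qed
    then obtain d where d: "\<And>i. i \<in> {1..k} \<Longrightarrow> d i > 0 \<and> (\<forall>\<^sub>F n in sequentially. d i \<le> 1 - p n i)"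
      by metis
    define e where "e = Min (d ` {1..k})"
    have ne: "d ` {1..k} \<noteq> {}" "finite (d ` {1..k})" using k by auto
    have "e > 0" unfolding e_def using ne d by (subst Min_gr_iff) auto
    moreover have "\<forall>\<^sub>F n in sequentially. \<forall>i\<in>{1..k}. e \<le> 1 - p n i"
    proof (rule eventually_ball_finite, simp, rule ballI)
      fix i assume i: "i \<in> {1..k}"
      then have "e \<le> d i" unfolding e_def by simp
      then show "\<forall>\<^sub>F n in sequentially. e \<le> 1 - p n i"
        using d[OF i] by (auto elim: eventually_mono)
    qed
    ultimately show ?thesis using that by blast
  qed
  have big: "filterlim (\<lambda>n. 2 / e * (real n * t n / R n ^ 10)) at_top sequentially"
  proof (rule filterlim_at_top_mono[OF growth])
    show "\<forall>\<^sub>F n in sequentially. (\<Sum>i=1..k. real (r n i) * avg_degree n (r n) (p n) i)\<^sup>2 /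
           (real (r_max k (r n)) ^ 16 * (xi k (r n) w)\<^sup>2 *
            (\<Sum>i=1..k. avg_degree n (r n) (p n) i / real (r n i))) \<le> 2 / e * (real n * t n / R n ^ 10)"
      using model e(2) eventually_ge_at_top[of 2]
    proof eventually_elim
      case (elim n)
      show ?case unfolding t_def R_def
        by (rule growth_comparison[OF k]) (use elim w_nn w_sum e(1) in auto)
    qed
  qed
  have rR: "\<forall>\<^sub>F n in sequentially. 2 \<le> R n \<and> (\<forall>i\<in>{1..k}. real (r n i) \<le> R n)"
    using model
  proof eventually_elim
    case (elim n)
    have le: "real (r n i) \<le> R n" if "i \<in> {1..k}" for i
      unfolding R_def r_max_def using that by simp
    then show ?case using elim k le[of 1] by force
  qed
  \<comment> \<open>The size of the third order terms.\<close>
  define b where "b n = 1 / sqrt (real n * t n) * R n ^ 4" for n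
  have b_lim: "b \<longlonglongrightarrow> 0"
  proof -
    have "filterlim (\<lambda>n. sqrt (2 / e * (real n * t n / R n ^ 10))) at_top sequentially"
      by (rule filterlim_compose[OF sqrt_at_top big])
    then have inv: "(\<lambda>n. inverse (sqrt (2 / e * (real n * t n / R n ^ 10)))) \<longlonglongrightarrow> 0"
      by (rule tendsto_inverse_0_at_top)
    then have "(\<lambda>n. sqrt (2 / e) * inverse (sqrt (2 / e * (real n * t n / R n ^ 10)))) \<longlonglongrightarrow> sqrt (2 / e) * 0"
      by (intro tendsto_intros)
    then have lim: "(\<lambda>n. sqrt (2 / e) * inverse (sqrt (2 / e * (real n * t n / R n ^ 10)))) \<longlonglongrightarrow> 0" by simp
    have "\<forall>\<^sub>F n in sequentially. 0 \<le> b n \<and> b n \<le> sqrt (2 / e) * inverse (sqrt (2 / e * (real n * t n / R n ^ 10)))"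
      using var_pos rR eventually_ge_at_top[of 1]
    proof eventually_elim
      case (elim n)
      have R2: "2 \<le> R n" using elim by auto
      have nt: "0 < real n * t n" using elim by (simp add: t_def)
      have "sqrt (R n ^ 10) = R n ^ 5"
        using R2 by (intro real_sqrt_unique) (auto simp: power_mult[symmetric])
      then have "sqrt (2 / e) * inverse (sqrt (2 / e * (real n * t n / R n ^ 10))) = R n ^ 5 / sqrt (real n * t n)"
        using e(1) nt R2 by (simp add: real_sqrt_mult real_sqrt_divide field_simps)
      moreover have "R n ^ 4 \<le> R n ^ 5" using R2 by (intro power_increasing) auto
      ultimately show ?case using nt R2 unfolding b_def by (auto intro: divide_right_mono)
    qed
    then show ?thesis
      by (intro tendsto_sandwich[OF _ _ tendsto_const lim]) (auto elim: eventually_mono)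
  qed
  show ?thesis unfolding v_def[symmetric] \<mu>_def[symmetric]
  proof (rule weak_conv_m_of_poisson)
    show "real_distribution (\<mu> n)" for n unfolding \<mu>_def by (rule real_distribution_mean_esd)
    show "real_distribution (semicircle v)" by (rule real_distribution_semicircle[OF v_pos])
    fix E \<eta> :: real assume \<eta>: "\<eta> > 0"
    define z where "z = Complex E \<eta>"
    have Imz: "Im z = \<eta>" by (simp add: z_def)
    obtain m where m: "of_real v * m\<^sup>2 + z * m + 1 = 0" "0 \<le> Im m"
      "pi * (\<integral>x. poisson \<eta> (E - x) \<partial>semicircle v) = Im m"
      using semicircle_stieltjes[OF v_pos \<eta>, of E] unfolding z_def by blast
    define P where "P n S \<longleftrightarrow> 0 \<le> Im S \<and> norm S \<le> 1 / \<eta>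
      \<and> norm (z * S + 1 + of_real (\<theta> n) * S\<^sup>2) \<le> 48 * b n / \<eta> ^ 3 + (50 / \<eta>\<^sup>2 + 16 / \<eta> ^ 4) / real n
      \<and> \<bar>pi * (\<integral>x. poisson \<eta> (E - x) \<partial>\<mu> n) - Im S\<bar> \<le> 5 / (sqrt n * \<eta>\<^sup>2)" for n S
    have "\<forall>\<^sub>F n in sequentially. \<exists>S. P n S"
      using mod rR
    proof eventually_elim
      case (elim n)
      interpret hypergraph_model k n "r n" "p n" by (rule elim(1))
      have th: "\<theta> n = mean_coeff"
        by (simp add: \<theta>_def mean_coeff_def W_def t_def Nb_def tv_def pair_coeff_def)
      have ab: "48 * a * R n ^ 4 / \<eta> ^ 3 = 48 * b n / \<eta> ^ 3"
        by (simp add: b_def a_def t_def)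
      show ?case
        using stieltjes_summary[OF \<eta>, of "R n" E] elim(2)
        unfolding P_def z_def \<mu>_def th ab by blast
    qed
    then have ev: "\<forall>\<^sub>F n in sequentially. P n (SOME S. P n S)" by eventually_elim (rule someI_ex)
    \<comment> \<open>For the finitely many \<open>n\<close> without a model the choice is arbitrary.\<close>
    define S where "S n = (SOME S. P n S)" for n
    have ev: "\<forall>\<^sub>F n in sequentially. P n (S n)" using ev by (simp add: S_def)
    have inv_n: "(\<lambda>n. c / real n) \<longlonglongrightarrow> 0" for c :: real by (rule lim_const_over_n)
    have S_lim: "(\<lambda>n. norm (S n - m)) \<longlonglongrightarrow> 0"
    proof (rule tendsto_sandwich[OF _ _ tendsto_const])
      show "(\<lambda>n. (48 * b n / \<eta> ^ 3 + (50 / \<eta>\<^sup>2 + 16 / \<eta> ^ 4) / real n + \<bar>v - \<theta> n\<bar> * (1 / \<eta>)\<^sup>2) / \<eta>) \<longlonglongrightarrow> 0"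
      proof -
        have "(\<lambda>n. (48 * b n / \<eta> ^ 3 + (50 / \<eta>\<^sup>2 + 16 / \<eta> ^ 4) / real n + \<bar>v - \<theta> n\<bar> * (1 / \<eta>)\<^sup>2) / \<eta>)
          \<longlonglongrightarrow> (48 * 0 / \<eta> ^ 3 + 0 + \<bar>v - v\<bar> * (1 / \<eta>)\<^sup>2) / \<eta>"
          using \<eta> by (intro tendsto_intros b_lim inv_n \<theta>_lim) auto
        then show ?thesis by simp
      qed
      show "\<forall>\<^sub>F n in sequentially. norm (S n - m) \<le> (48 * b n / \<eta> ^ 3 + (50 / \<eta>\<^sup>2 + 16 / \<eta> ^ 4) / real n + \<bar>v - \<theta> n\<bar> * (1 / \<eta>)\<^sup>2) / \<eta>"
        using ev
      proof eventually_elim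
        case (elim n)
        have "norm (S n - m) \<le> norm (z * S n + 1 + of_real v * (S n)\<^sup>2) / Im z"
          by (rule self_consistent_stability) (use elim v_pos m Imz \<eta> in \<open>auto simp: P_def\<close>)
        also have "norm (z * S n + 1 + of_real v * (S n)\<^sup>2)
          \<le> (48 * b n / \<eta> ^ 3 + (50 / \<eta>\<^sup>2 + 16 / \<eta> ^ 4) / real n) + \<bar>v - \<theta> n\<bar> * (1 / \<eta>)\<^sup>2"
        proof (rule norm_eq_add_le)
          show "z * S n + 1 + of_real v * (S n)\<^sup>2 = (z * S n + 1 + of_real (\<theta> n) * (S n)\<^sup>2) + of_real (v - \<theta> n) * (S n)\<^sup>2"
            by (simp add: algebra_simps)
          show "norm (z * S n + 1 + of_real (\<theta> n) * (S n)\<^sup>2) \<le> 48 * b n / \<eta> ^ 3 + (50 / \<eta>\<^sup>2 + 16 / \<eta> ^ 4) / real n"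
            using elim by (simp add: P_def)
          have "norm (S n) \<le> 1 / \<eta>" using elim by (simp add: P_def)
          then show "norm (of_real (v - \<theta> n) * (S n)\<^sup>2) \<le> \<bar>v - \<theta> n\<bar> * (1 / \<eta>)\<^sup>2"
            unfolding norm_mult norm_power norm_of_real by (intro mult_left_mono power_mono) auto
        qed
        finally show ?case using \<eta> by (simp add: Imz divide_right_mono)
      qed
    qed simp
    then have "S \<longlonglongrightarrow> m" by (simp add: tendsto_norm_zero_iff LIM_zero_iff)
    then have ImS: "(\<lambda>n. Im (S n)) \<longlonglongrightarrow> Im m" by (rule tendsto_Im)
    have "(\<lambda>n. pi * (\<integral>x. poisson \<eta> (E - x) \<partial>\<mu> n) - Im (S n)) \<longlonglongrightarrow> 0"
    proof (rule Lim_null_comparison)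
      show "\<forall>\<^sub>F n in sequentially. norm (pi * (\<integral>x. poisson \<eta> (E - x) \<partial>\<mu> n) - Im (S n)) \<le> 5 / \<eta>\<^sup>2 * (1 / sqrt (real n))"
        using ev by eventually_elim (simp add: P_def mult.commute)
      have "(\<lambda>n. inverse (sqrt (real n))) \<longlonglongrightarrow> 0"
        by (intro tendsto_inverse_0_at_top filterlim_compose[OF sqrt_at_top filterlim_real_sequentially])
      then have "(\<lambda>n. 5 / \<eta>\<^sup>2 * (1 / sqrt (real n))) \<longlonglongrightarrow> 5 / \<eta>\<^sup>2 * 0"
        by (intro tendsto_mult tendsto_const) (simp add: inverse_eq_divide)
      then show "(\<lambda>n. 5 / \<eta>\<^sup>2 * (1 / sqrt (real n))) \<longlonglongrightarrow> 0" by simp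
    qed
    from tendsto_add[OF this ImS] have "(\<lambda>n. pi * (\<integral>x. poisson \<eta> (E - x) \<partial>\<mu> n)) \<longlonglongrightarrow> Im m" by simp
    then have "(\<lambda>n. inverse pi * (pi * (\<integral>x. poisson \<eta> (E - x) \<partial>\<mu> n))) \<longlonglongrightarrow> inverse pi * Im m"
      by (intro tendsto_mult tendsto_const)
    then show "(\<lambda>n. \<integral>x. poisson \<eta> (E - x) \<partial>\<mu> n) \<longlonglongrightarrow> (\<integral>x. poisson \<eta> (E - x) \<partial>semicircle v)"
      unfolding m(3)[symmetric] by simp
  qed
qed

end
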